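(* Let $\mathbf{C}$ be a hyperextensive category with binary coproducts. Then the monad $\mathbb{L}$ with $LX=X+1$ (with its canonical strength) is $\omega$-continuous, where the order on Kleisli hom-sets is the extension order of the corresponding summand-partial morphisms. Equipped with the complete Elgot monad structure obtained by taking $f^{\dagger}$ to be the least fixpoint of $h\mapsto[\eta,h]^{*}\circ f$, $\mathbb{L}$ is the initial object of the category of complete Elgot monads on $\mathbf{C}$ and complete Elgot monad morphisms.
   Context: A category is hyperextensive if it has countable coproducts that are disjoint and universal (stable under pullback), and countable disjoint unions of subobjects that are coproduct injections are again coproduct injections. A summand-partial morphism from $X$ to $Y$ is a span $X\leftarrow D\to Y$ whose left leg is a coproduct injection; Kleisli morphisms $X\to Y+1$ correspond to these. A strong monad is a Kleisli triple $(T,\eta,(-)^{*})$ with strength $\tau$. An $\omega$-continuous monad is a strong monad whose Kleisli hom-sets are $\omega$-complete partial orders with bottom, with Kleisli composition continuous in both arguments, such that $\tau\circ(\mathrm{id}\times\bigsqcup_i f_i)=\bigsqcup_i\tau\circ(\mathrm{id}\times f_i)$, $[\bigsqcup_i f_i,\bigsqcup_i g_i]=\bigsqcup_i[f_i,g_i]$, $\tau\circ(\mathrm{id}\times\bot)=\bot$ and $f^{*}\circ\bot=\bot$. A complete Elgot monad is a strong monad with an operator assigning to every $f:X\to T(Y+X)$ a morphism $f^{\dagger}:X\to TY$ satisfying: unfolding $[\eta,f^{\dagger}]^{*}f=f^{\dagger}$; naturality $g^{*}f^{\dagger}=([T\mathrm{inl}\circ g,\eta\mathrm{inr}]^{*}f)^{\dagger}$;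 dinaturality $([\eta\mathrm{inl},h]^{*}g)^{\dagger}=[\eta,([\eta\mathrm{inl},g]^{*}h)^{\dagger}]^{*}g$; codiagonal $(T[\mathrm{id},\mathrm{inr}]g)^{\dagger}=(g^{\dagger})^{\dagger}$; uniformity ($f h=T(\mathrm{id}+h)g$ implies $f^{\dagger}h=g^{\dagger}$); strength compatibility $\tau(\mathrm{id}\times f^{\dagger})=(T\mathrm{dist}\circ\tau\circ(\mathrm{id}\times f))^{\dagger}$, where $\mathrm{dist}$ is the inverse distributivity isomorphism. A complete Elgot monad morphism is a natural transformation $\xi$ with $\xi\eta=\eta$, $\xi f^{*}=(\xi f)^{*}\xi$, $\xi\tau=\tau(\mathrm{id}\times\xi)$, $(\xi g)^{\dagger}=\xi g^{\dagger}$. *)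

theory Defs
  imports Main
begin

section \<open>Categories\<close>

text \<open>
  The objects of a category are all elements of the type \<open>'o\<close> and its arrows all elements of the
  type \<open>'a\<close>; composition is unspecified on pairs of arrows that do not compose.
\<close>

record ('o, 'a) cat =
  Dom :: "'a \<Rightarrow> 'o"
  Cod :: "'a \<Rightarrow> 'o"
  idm :: "'o \<Rightarrow> 'a"
  cmp :: "'a \<Rightarrow> 'a \<Rightarrow> 'a"  (infixr "\<cdot>\<index>" 55)

definition hom :: "('o, 'a, 'm) cat_scheme \<Rightarrow> 'o \<Rightarrow> 'o \<Rightarrow> 'a set" where
  "hom C X Y = {f. Dom C f = X \<and> Cod C f = Y}"

locale category =
  fixes C :: "('o, 'a, 'm) cat_scheme" (structure)
  assumes idm_hom: "idm C X \<in> hom C X X"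
    and cmp_hom: "f \<in> hom C X Y \<Longrightarrow> g \<in> hom C Y Z \<Longrightarrow> g \<cdot> f \<in> hom C X Z"
    and idm_left: "f \<in> hom C X Y \<Longrightarrow> idm C Y \<cdot> f = f"
    and idm_right: "f \<in> hom C X Y \<Longrightarrow> f \<cdot> idm C X = f"
    and cmp_assoc: "f \<in> hom C W X \<Longrightarrow> g \<in> hom C X Y \<Longrightarrow> h \<in> hom C Y Z \<Longrightarrow>
      (h \<cdot> g) \<cdot> f = h \<cdot> (g \<cdot> f)"

definition is_initial :: "('o, 'a, 'm) cat_scheme \<Rightarrow> 'o \<Rightarrow> bool" where
  "is_initial C Z \<longleftrightarrow> (\<forall>X. \<exists>!f. f \<in> hom C Z X)"

definition is_terminal :: "('o, 'a, 'm) cat_scheme \<Rightarrow> 'o \<Rightarrow> bool" where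
  "is_terminal C Z \<longleftrightarrow> (\<forall>X. \<exists>!f. f \<in> hom C X Z)"

definition is_mono :: "('o, 'a, 'm) cat_scheme \<Rightarrow> 'a \<Rightarrow> bool" where
  "is_mono C m \<longleftrightarrow> (\<forall>W. \<forall>u \<in> hom C W (Dom C m). \<forall>v \<in> hom C W (Dom C m).
     m \<cdot>\<^bsub>C\<^esub> u = m \<cdot>\<^bsub>C\<^esub> v \<longrightarrow> u = v)"

definition is_inverse :: "('o, 'a, 'm) cat_scheme \<Rightarrow> 'a \<Rightarrow> 'a \<Rightarrow> bool" where
  "is_inverse C f g \<longleftrightarrow> g \<in> hom C (Cod C f) (Dom C f)
     \<and> g \<cdot>\<^bsub>C\<^esub> f = idm C (Dom C f) \<and> f \<cdot>\<^bsub>C\<^esub> g = idm C (Cod C f)"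

definition is_product :: "('o, 'a, 'm) cat_scheme \<Rightarrow> 'o \<Rightarrow> 'a \<Rightarrow> 'a \<Rightarrow> bool" where
  "is_product C P p q \<longleftrightarrow> Dom C p = P \<and> Dom C q = P \<and>
     (\<forall>W. \<forall>f \<in> hom C W (Cod C p). \<forall>g \<in> hom C W (Cod C q).
        \<exists>!h. h \<in> hom C W P \<and> p \<cdot>\<^bsub>C\<^esub> h = f \<and> q \<cdot>\<^bsub>C\<^esub> h = g)"

definition is_binary_coproduct :: "('o, 'a, 'm) cat_scheme \<Rightarrow> 'o \<Rightarrow> 'a \<Rightarrow> 'a \<Rightarrow> bool" where
  "is_binary_coproduct C S i j \<longleftrightarrow> Cod C i = S \<and> Cod C j = S \<and>
     (\<forall>Z. \<forall>f \<in> hom C (Dom C i) Z. \<forall>g \<in> hom C (Dom C j) Z.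
        \<exists>!h. h \<in> hom C S Z \<and> h \<cdot>\<^bsub>C\<^esub> i = f \<and> h \<cdot>\<^bsub>C\<^esub> j = g)"

definition is_coproduct :: "('o, 'a, 'm) cat_scheme \<Rightarrow> 'i set \<Rightarrow> 'o \<Rightarrow> ('i \<Rightarrow> 'a) \<Rightarrow> bool" where
  "is_coproduct C I S c \<longleftrightarrow> (\<forall>i\<in>I. Cod C (c i) = S) \<and>
     (\<forall>Z f. (\<forall>i\<in>I. f i \<in> hom C (Dom C (c i)) Z) \<longrightarrow>
        (\<exists>!h. h \<in> hom C S Z \<and> (\<forall>i\<in>I. h \<cdot>\<^bsub>C\<^esub> c i = f i)))"

text \<open>\<open>is_pullback C p q f g\<close>: the square with \<open>f \<cdot> p = g \<cdot> q\<close> is a pullback of \<open>f\<close> and \<open>g\<close>.\<close>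

definition is_pullback :: "('o, 'a, 'm) cat_scheme \<Rightarrow> 'a \<Rightarrow> 'a \<Rightarrow> 'a \<Rightarrow> 'a \<Rightarrow> bool" where
  "is_pullback C p q f g \<longleftrightarrow>
     Dom C p = Dom C q \<and> Cod C p = Dom C f \<and> Cod C q = Dom C g \<and> Cod C f = Cod C g \<and>
     f \<cdot>\<^bsub>C\<^esub> p = g \<cdot>\<^bsub>C\<^esub> q \<and>
     (\<forall>W. \<forall>u \<in> hom C W (Dom C f). \<forall>v \<in> hom C W (Dom C g). f \<cdot>\<^bsub>C\<^esub> u = g \<cdot>\<^bsub>C\<^esub> v \<longrightarrow>
        (\<exists>!h. h \<in> hom C W (Dom C p) \<and> p \<cdot>\<^bsub>C\<^esub> h = u \<and> q \<cdot>\<^bsub>C\<^esub> h = v))"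

definition coproduct_injection :: "('o, 'a, 'm) cat_scheme \<Rightarrow> 'a \<Rightarrow> bool" where
  "coproduct_injection C d \<longleftrightarrow> (\<exists>e. is_binary_coproduct C (Cod C d) d e)"

definition disjoint_arrows :: "('o, 'a, 'm) cat_scheme \<Rightarrow> 'a \<Rightarrow> 'a \<Rightarrow> bool" where
  "disjoint_arrows C f g \<longleftrightarrow> (\<exists>p q. is_pullback C p q f g \<and> is_initial C (Dom C p))"

text \<open>
  Countable families are indexed by arbitrary subsets of \<open>nat\<close>, so that finite (in particular empty)
  families are included. Universality includes, as usual for extensive categories, the existence of
  the pullbacks of coproduct injections. The disjoint union of pairwise disjoint subobjects
  \<open>c i\<close> of \<open>X\<close> is the arrow from their coproduct to \<open>X\<close> induced by the \<open>c i\<close>.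
\<close>

locale hyperextensive = category C for C :: "('o, 'a, 'm) cat_scheme" (structure) +
  assumes countable_coproducts: "\<And>(I :: nat set) D. \<exists>S c. is_coproduct C I S c \<and> (\<forall>i\<in>I. Dom C (c i) = D i)"
    and injections_mono: "\<And>(I :: nat set) S c i. is_coproduct C I S c \<Longrightarrow> i \<in> I \<Longrightarrow> is_mono C (c i)"
    and coproducts_disjoint: "\<And>(I :: nat set) S c i j. is_coproduct C I S c \<Longrightarrow> i \<in> I \<Longrightarrow> j \<in> I \<Longrightarrow>
      i \<noteq> j \<Longrightarrow> disjoint_arrows C (c i) (c j)"
    and injection_pullbacks: "\<And>(I :: nat set) S c i X f. is_coproduct C I S c \<Longrightarrow> i \<in> I \<Longrightarrow>
      f \<in> hom C X S \<Longrightarrow> \<exists>d p. is_pullback C d p f (c i)"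
    and coproducts_universal: "\<And>(I :: nat set) S c X f d p. is_coproduct C I S c \<Longrightarrow> f \<in> hom C X S \<Longrightarrow>
      (\<forall>i\<in>I. is_pullback C (d i) (p i) f (c i)) \<Longrightarrow> is_coproduct C I X d"
    and disjoint_unions: "\<And>(I :: nat set) X c S s u.
      (\<forall>i\<in>I. Cod C (c i) = X \<and> coproduct_injection C (c i)) \<Longrightarrow>
      (\<forall>i\<in>I. \<forall>j\<in>I. i \<noteq> j \<longrightarrow> disjoint_arrows C (c i) (c j)) \<Longrightarrow>
      is_coproduct C I S s \<Longrightarrow> u \<in> hom C S X \<Longrightarrow>
      (\<forall>i\<in>I. Dom C (s i) = Dom C (c i) \<and> u \<cdot> s i = c i) \<Longrightarrow> coproduct_injection C u"


section \<open>Chosen finite products and binary coproducts\<close>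

record ('o, 'a) bicart = "('o, 'a) cat" +
  One :: 'o  ("\<one>\<index>")
  prd :: "'o \<Rightarrow> 'o \<Rightarrow> 'o"  (infixr "\<otimes>\<index>" 70)
  prl :: "'o \<Rightarrow> 'o \<Rightarrow> 'a"
  prr :: "'o \<Rightarrow> 'o \<Rightarrow> 'a"
  sm :: "'o \<Rightarrow> 'o \<Rightarrow> 'o"  (infixr "\<oplus>\<index>" 65)
  inl :: "'o \<Rightarrow> 'o \<Rightarrow> 'a"
  inr :: "'o \<Rightarrow> 'o \<Rightarrow> 'a"

locale chosen_finite_products = category C for C :: "('o, 'a, 'm) bicart_scheme" (structure) +
  assumes terminal: "is_terminal C \<one>"
    and product: "is_product C (X \<otimes> Y) (prl C X Y) (prr C X Y)"
      "Cod C (prl C X Y) = X" "Cod C (prr C X Y) = Y"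

locale chosen_binary_coproducts = category C for C :: "('o, 'a, 'm) bicart_scheme" (structure) +
  assumes coproduct: "is_binary_coproduct C (X \<oplus> Y) (inl C X Y) (inr C X Y)"
      "Dom C (inl C X Y) = X" "Dom C (inr C X Y) = Y"

definition bang :: "('o, 'a, 'm) bicart_scheme \<Rightarrow> 'o \<Rightarrow> 'a" where
  "bang C X = (THE f. f \<in> hom C X \<one>\<^bsub>C\<^esub>)"

definition pairing :: "('o, 'a, 'm) bicart_scheme \<Rightarrow> 'a \<Rightarrow> 'a \<Rightarrow> 'a" where
  "pairing C f g = (THE h. h \<in> hom C (Dom C f) (Cod C f \<otimes>\<^bsub>C\<^esub> Cod C g)
     \<and> prl C (Cod C f) (Cod C g) \<cdot>\<^bsub>C\<^esub> h = f \<and> prr C (Cod C f) (Cod C g) \<cdot>\<^bsub>C\<^esub> h = g)"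

definition copair :: "('o, 'a, 'm) bicart_scheme \<Rightarrow> 'a \<Rightarrow> 'a \<Rightarrow> 'a"  ("(\<lblot>_,/ _\<rblot>\<index>)") where
  "\<lblot>f, g\<rblot>\<^bsub>C\<^esub> = (THE h. h \<in> hom C (Dom C f \<oplus>\<^bsub>C\<^esub> Dom C g) (Cod C f)
     \<and> h \<cdot>\<^bsub>C\<^esub> inl C (Dom C f) (Dom C g) = f \<and> h \<cdot>\<^bsub>C\<^esub> inr C (Dom C f) (Dom C g) = g)"

definition prod_map :: "('o, 'a, 'm) bicart_scheme \<Rightarrow> 'a \<Rightarrow> 'a \<Rightarrow> 'a"  (infixr "\<otimes>\<^sub>m\<index>" 70) where
  "f \<otimes>\<^sub>m\<^bsub>C\<^esub> g = pairing C (f \<cdot>\<^bsub>C\<^esub> prl C (Dom C f) (Dom C g)) (g \<cdot>\<^bsub>C\<^esub> prr C (Dom C f) (Dom C g))"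

definition sum_map :: "('o, 'a, 'm) bicart_scheme \<Rightarrow> 'a \<Rightarrow> 'a \<Rightarrow> 'a"  (infixr "\<oplus>\<^sub>m\<index>" 65) where
  "f \<oplus>\<^sub>m\<^bsub>C\<^esub> g = \<lblot>inl C (Cod C f) (Cod C g) \<cdot>\<^bsub>C\<^esub> f, inr C (Cod C f) (Cod C g) \<cdot>\<^bsub>C\<^esub> g\<rblot>\<^bsub>C\<^esub>"

text \<open>\<open>prod_assoc C X Y Z : (X \<times> Y) \<times> Z \<rightarrow> X \<times> (Y \<times> Z)\<close>\<close>

definition prod_assoc :: "('o, 'a, 'm) bicart_scheme \<Rightarrow> 'o \<Rightarrow> 'o \<Rightarrow> 'o \<Rightarrow> 'a" where
  "prod_assoc C X Y Z =
     pairing C (prl C X Y \<cdot>\<^bsub>C\<^esub> prl C (X \<otimes>\<^bsub>C\<^esub> Y) Z) (prr C X Y \<otimes>\<^sub>m\<^bsub>C\<^esub> idm C Z)"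

text \<open>
  \<open>dist C X Y Z : X \<times> (Y + Z) \<rightarrow> X \<times> Y + X \<times> Z\<close>. The canonical map it inverts is an isomorphism
  in every (hyper)extensive category with finite products.
\<close>

definition dist :: "('o, 'a, 'm) bicart_scheme \<Rightarrow> 'o \<Rightarrow> 'o \<Rightarrow> 'o \<Rightarrow> 'a" where
  "dist C X Y Z = (THE k. is_inverse C
     \<lblot>idm C X \<otimes>\<^sub>m\<^bsub>C\<^esub> inl C Y Z, idm C X \<otimes>\<^sub>m\<^bsub>C\<^esub> inr C Y Z\<rblot>\<^bsub>C\<^esub> k)"


section \<open>Strong monads\<close>

text \<open>
  \<open>ext M Y f : T X \<rightarrow> T Y\<close> is the Kleisli extension of \<open>f : X \<rightarrow> T Y\<close>. The object \<open>Y\<close> has to be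
  given explicitly, since \<open>T\<close> need not be injective on objects; \<open>X\<close> is the domain of \<open>f\<close>.
  \<open>str M X Y : X \<times> T Y \<rightarrow> T (X \<times> Y)\<close> is the strength.
\<close>

record ('o, 'a) smonad =
  Tob :: "'o \<Rightarrow> 'o"
  eta :: "'o \<Rightarrow> 'a"
  ext :: "'o \<Rightarrow> 'a \<Rightarrow> 'a"
  str :: "'o \<Rightarrow> 'o \<Rightarrow> 'a"

definition Tmap :: "('o, 'a, 'm) cat_scheme \<Rightarrow> ('o, 'a, 'n) smonad_scheme \<Rightarrow> 'a \<Rightarrow> 'a" where
  "Tmap C M f = ext M (Cod C f) (eta M (Cod C f) \<cdot>\<^bsub>C\<^esub> f)"

locale strong_monad =
  fixes C :: "('o, 'a, 'm) bicart_scheme" (structure)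
    and M :: "('o, 'a, 'n) smonad_scheme"
  assumes eta_hom: "eta M X \<in> hom C X (Tob M X)"
    and ext_hom: "f \<in> hom C X (Tob M Y) \<Longrightarrow> ext M Y f \<in> hom C (Tob M X) (Tob M Y)"
    and ext_eta: "ext M X (eta M X) = idm C (Tob M X)"
    and ext_unit: "f \<in> hom C X (Tob M Y) \<Longrightarrow> ext M Y f \<cdot> eta M X = f"
    and ext_ext: "f \<in> hom C X (Tob M Y) \<Longrightarrow> g \<in> hom C Y (Tob M Z) \<Longrightarrow>
      ext M Z (ext M Z g \<cdot> f) = ext M Z g \<cdot> ext M Y f"
    and str_hom: "str M X Y \<in> hom C (X \<otimes> Tob M Y) (Tob M (X \<otimes> Y))"
    and str_natural: "f \<in> hom C X X' \<Longrightarrow> g \<in> hom C Y Y' \<Longrightarrow>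
      str M X' Y' \<cdot> (f \<otimes>\<^sub>m Tmap C M g) = Tmap C M (f \<otimes>\<^sub>m g) \<cdot> str M X Y"
    and str_unit: "Tmap C M (prr C \<one> Y) \<cdot> str M \<one> Y = prr C \<one> (Tob M Y)"
    and str_assoc: "Tmap C M (prod_assoc C X Y Z) \<cdot> str M (X \<otimes> Y) Z
      = str M X (Y \<otimes> Z) \<cdot> (idm C X \<otimes>\<^sub>m str M Y Z) \<cdot> prod_assoc C X Y (Tob M Z)"
    and str_eta: "str M X Y \<cdot> (idm C X \<otimes>\<^sub>m eta M Y) = eta M (X \<otimes> Y)"
    and str_mult: "str M X Y \<cdot> (idm C X \<otimes>\<^sub>m ext M Y (idm C (Tob M Y)))
      = ext M (X \<otimes> Y) (str M X Y) \<cdot> str M X (Tob M Y)"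


section \<open>\<open>\<omega>\<close>-continuous monads\<close>

definition omega_chain :: "'a set \<Rightarrow> ('a \<Rightarrow> 'a \<Rightarrow> bool) \<Rightarrow> (nat \<Rightarrow> 'a) \<Rightarrow> bool" where
  "omega_chain A le f \<longleftrightarrow> (\<forall>i. f i \<in> A) \<and> (\<forall>i. le (f i) (f (Suc i)))"

definition is_lub :: "'a set \<Rightarrow> ('a \<Rightarrow> 'a \<Rightarrow> bool) \<Rightarrow> (nat \<Rightarrow> 'a) \<Rightarrow> 'a \<Rightarrow> bool" where
  "is_lub A le f s \<longleftrightarrow> s \<in> A \<and> (\<forall>i. le (f i) s) \<and> (\<forall>u\<in>A. (\<forall>i. le (f i) u) \<longrightarrow> le s u)"

definition is_bottom :: "'a set \<Rightarrow> ('a \<Rightarrow> 'a \<Rightarrow> bool) \<Rightarrow> 'a \<Rightarrow> bool" where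
  "is_bottom A le b \<longleftrightarrow> b \<in> A \<and> (\<forall>u\<in>A. le b u)"

definition omega_cpo_bot :: "'a set \<Rightarrow> ('a \<Rightarrow> 'a \<Rightarrow> bool) \<Rightarrow> bool" where
  "omega_cpo_bot A le \<longleftrightarrow> reflp_on A le \<and> transp_on A le \<and> antisymp_on A le
     \<and> (\<forall>f. omega_chain A le f \<longrightarrow> (\<exists>s. is_lub A le f s)) \<and> (\<exists>b. is_bottom A le b)"

text \<open>
  \<open>le Y\<close> is the order on the Kleisli hom-sets \<open>hom C X (T Y)\<close>; the object \<open>Y\<close> is explicit for the
  same reason as in \<open>ext\<close>. An equation \<open>\<Phi> (\<Squnion>\<^sub>i F\<^sub>i) = \<Squnion>\<^sub>i \<Phi> F\<^sub>i\<close> is expressed by saying that \<open>\<Phi> s\<close> is a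
  least upper bound of the \<open>\<Phi> F\<^sub>i\<close> whenever \<open>s\<close> is one of the \<open>\<omega>\<close>-chain \<open>F\<close>; monotonicity of \<open>\<Phi>\<close> is
  the case of chains that are constant after their first element.
\<close>

locale omega_continuous_monad = strong_monad C M
  for C :: "('o, 'a, 'm) bicart_scheme" (structure) and M :: "('o, 'a, 'n) smonad_scheme" +
  fixes le :: "'o \<Rightarrow> 'a \<Rightarrow> 'a \<Rightarrow> bool"
  assumes kleisli_omega_cpo: "omega_cpo_bot (hom C X (Tob M Y)) (le Y)"
    and kleisli_cont_right:
      "omega_chain (hom C X (Tob M Y)) (le Y) F \<Longrightarrow> is_lub (hom C X (Tob M Y)) (le Y) F s \<Longrightarrow>
       g \<in> hom C Y (Tob M Z) \<Longrightarrow>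
       is_lub (hom C X (Tob M Z)) (le Z) (\<lambda>i. ext M Z g \<cdot> F i) (ext M Z g \<cdot> s)"
    and kleisli_cont_left:
      "omega_chain (hom C Y (Tob M Z)) (le Z) G \<Longrightarrow> is_lub (hom C Y (Tob M Z)) (le Z) G t \<Longrightarrow>
       f \<in> hom C X (Tob M Y) \<Longrightarrow>
       is_lub (hom C X (Tob M Z)) (le Z) (\<lambda>i. ext M Z (G i) \<cdot> f) (ext M Z t \<cdot> f)"
    and str_cont:
      "omega_chain (hom C X (Tob M Y)) (le Y) F \<Longrightarrow> is_lub (hom C X (Tob M Y)) (le Y) F s \<Longrightarrow>
       is_lub (hom C (W \<otimes> X) (Tob M (W \<otimes> Y))) (le (W \<otimes> Y))
         (\<lambda>i. str M W Y \<cdot> (idm C W \<otimes>\<^sub>m F i)) (str M W Y \<cdot> (idm C W \<otimes>\<^sub>m s))"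
    and copair_cont:
      "omega_chain (hom C X (Tob M Z)) (le Z) F \<Longrightarrow> is_lub (hom C X (Tob M Z)) (le Z) F s \<Longrightarrow>
       omega_chain (hom C Y (Tob M Z)) (le Z) G \<Longrightarrow> is_lub (hom C Y (Tob M Z)) (le Z) G t \<Longrightarrow>
       is_lub (hom C (X \<oplus> Y) (Tob M Z)) (le Z) (\<lambda>i. \<lblot>F i, G i\<rblot>) \<lblot>s, t\<rblot>"
    and str_bottom:
      "is_bottom (hom C X (Tob M Y)) (le Y) b \<Longrightarrow>
       is_bottom (hom C (W \<otimes> X) (Tob M (W \<otimes> Y))) (le (W \<otimes> Y)) (str M W Y \<cdot> (idm C W \<otimes>\<^sub>m b))"
    and ext_bottom:
      "is_bottom (hom C X (Tob M Y)) (le Y) b \<Longrightarrow> f \<in> hom C Y (Tob M Z) \<Longrightarrow>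
       is_bottom (hom C X (Tob M Z)) (le Z) (ext M Z f \<cdot> b)"

definition is_least_iterate ::
    "('o, 'a, 'm) bicart_scheme \<Rightarrow> ('o, 'a, 'n) smonad_scheme \<Rightarrow> ('o \<Rightarrow> 'a \<Rightarrow> 'a \<Rightarrow> bool)
      \<Rightarrow> 'o \<Rightarrow> 'a \<Rightarrow> 'a \<Rightarrow> bool" where
  "is_least_iterate C M le Y f h \<longleftrightarrow>
     h \<in> hom C (Dom C f) (Tob M Y) \<and> ext M Y \<lblot>eta M Y, h\<rblot>\<^bsub>C\<^esub> \<cdot>\<^bsub>C\<^esub> f = h \<and>
     (\<forall>k \<in> hom C (Dom C f) (Tob M Y). ext M Y \<lblot>eta M Y, k\<rblot>\<^bsub>C\<^esub> \<cdot>\<^bsub>C\<^esub> f = k \<longrightarrow> le Y h k)"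


section \<open>Complete Elgot monads\<close>

text \<open>\<open>dag M Y f : X \<rightarrow> T Y\<close> is the iterate of \<open>f : X \<rightarrow> T (Y + X)\<close>.\<close>

record ('o, 'a) elgot = "('o, 'a) smonad" +
  dag :: "'o \<Rightarrow> 'a \<Rightarrow> 'a"

locale complete_elgot_monad = strong_monad C M
  for C :: "('o, 'a, 'm) bicart_scheme" (structure) and M :: "('o, 'a, 'n) elgot_scheme" +
  assumes dag_hom: "f \<in> hom C X (Tob M (Y \<oplus> X)) \<Longrightarrow> dag M Y f \<in> hom C X (Tob M Y)"
    and unfolding_law:
      "f \<in> hom C X (Tob M (Y \<oplus> X)) \<Longrightarrow> ext M Y \<lblot>eta M Y, dag M Y f\<rblot> \<cdot> f = dag M Y f"
    and naturality_law:
      "f \<in> hom C X (Tob M (Y \<oplus> X)) \<Longrightarrow> g \<in> hom C Y (Tob M Z) \<Longrightarrow>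
       ext M Z g \<cdot> dag M Y f =
       dag M Z (ext M (Z \<oplus> X) \<lblot>Tmap C M (inl C Z X) \<cdot> g, eta M (Z \<oplus> X) \<cdot> inr C Z X\<rblot> \<cdot> f)"
    and dinaturality_law:
      "g \<in> hom C X (Tob M (Y \<oplus> Z)) \<Longrightarrow> h \<in> hom C Z (Tob M (Y \<oplus> X)) \<Longrightarrow>
       dag M Y (ext M (Y \<oplus> X) \<lblot>eta M (Y \<oplus> X) \<cdot> inl C Y X, h\<rblot> \<cdot> g) =
       ext M Y \<lblot>eta M Y, dag M Y (ext M (Y \<oplus> Z) \<lblot>eta M (Y \<oplus> Z) \<cdot> inl C Y Z, g\<rblot> \<cdot> h)\<rblot> \<cdot> g"
    and codiagonal_law:
      "g \<in> hom C X (Tob M ((Y \<oplus> X) \<oplus> X)) \<Longrightarrow>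
       dag M Y (Tmap C M \<lblot>idm C (Y \<oplus> X), inr C Y X\<rblot> \<cdot> g) = dag M Y (dag M (Y \<oplus> X) g)"
    and uniformity_law:
      "f \<in> hom C X (Tob M (Y \<oplus> X)) \<Longrightarrow> g \<in> hom C Z (Tob M (Y \<oplus> Z)) \<Longrightarrow> h \<in> hom C Z X \<Longrightarrow>
       f \<cdot> h = Tmap C M (idm C Y \<oplus>\<^sub>m h) \<cdot> g \<Longrightarrow> dag M Y f \<cdot> h = dag M Y g"
    and strength_law:
      "f \<in> hom C X (Tob M (Y \<oplus> X)) \<Longrightarrow>
       str M Z Y \<cdot> (idm C Z \<otimes>\<^sub>m dag M Y f) =
       dag M (Z \<otimes> Y) (Tmap C M (dist C Z Y X) \<cdot> str M Z (Y \<oplus> X) \<cdot> (idm C Z \<otimes>\<^sub>m f))"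

locale complete_elgot_morphism =
  fixes C :: "('o, 'a, 'm) bicart_scheme" (structure)
    and M :: "('o, 'a, 'n) elgot_scheme" and N :: "('o, 'a, 'k) elgot_scheme"
    and \<xi> :: "'o \<Rightarrow> 'a"
  assumes component_hom: "\<xi> X \<in> hom C (Tob M X) (Tob N X)"
    and natural: "f \<in> hom C X Y \<Longrightarrow> \<xi> Y \<cdot> Tmap C M f = Tmap C N f \<cdot> \<xi> X"
    and preserves_eta: "\<xi> X \<cdot> eta M X = eta N X"
    and preserves_ext: "f \<in> hom C X (Tob M Y) \<Longrightarrow> \<xi> Y \<cdot> ext M Y f = ext N Y (\<xi> Y \<cdot> f) \<cdot> \<xi> X"
    and preserves_str: "\<xi> (X \<otimes> Y) \<cdot> str M X Y = str N X Y \<cdot> (idm C X \<otimes>\<^sub>m \<xi> Y)"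
    and preserves_dag: "g \<in> hom C X (Tob M (Y \<oplus> X)) \<Longrightarrow>
      dag N Y (\<xi> (Y \<oplus> X) \<cdot> g) = \<xi> Y \<cdot> dag M Y g"

definition initial_complete_elgot_monad ::
    "('o, 'a, 'm) bicart_scheme \<Rightarrow> ('o, 'a) elgot \<Rightarrow> bool" where
  "initial_complete_elgot_monad C M \<longleftrightarrow> complete_elgot_monad C M \<and>
     (\<forall>N :: ('o, 'a) elgot. complete_elgot_monad C N \<longrightarrow> (\<exists>!\<xi>. complete_elgot_morphism C M N \<xi>))"


section \<open>The monad \<open>L X = X + 1\<close>\<close>

definition L_monad :: "('o, 'a, 'm) bicart_scheme \<Rightarrow> ('o, 'a) smonad" where
  "L_monad C = \<lparr>
     Tob = \<lambda>X. X \<oplus>\<^bsub>C\<^esub> \<one>\<^bsub>C\<^esub>,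
     eta = \<lambda>X. inl C X \<one>\<^bsub>C\<^esub>,
     ext = \<lambda>Y f. \<lblot>f, inr C Y \<one>\<^bsub>C\<^esub>\<rblot>\<^bsub>C\<^esub>,
     str = \<lambda>X Y. (idm C (X \<otimes>\<^bsub>C\<^esub> Y) \<oplus>\<^sub>m\<^bsub>C\<^esub> bang C (X \<otimes>\<^bsub>C\<^esub> \<one>\<^bsub>C\<^esub>)) \<cdot>\<^bsub>C\<^esub> dist C X Y \<one>\<^bsub>C\<^esub> \<rparr>"

text \<open>
  The summand-partial morphism given by the span \<open>d : D \<rightarrow> X\<close>, \<open>p : D \<rightarrow> Y\<close> corresponds to the
  arrow \<open>X \<rightarrow> Y + 1\<close> that is \<open>p\<close> on the summand \<open>D\<close> and maps its complement (with injection \<open>e\<close>) to \<open>1\<close>.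
\<close>

definition summand_partial :: "('o, 'a, 'm) cat_scheme \<Rightarrow> 'o \<Rightarrow> 'o \<Rightarrow> 'a \<Rightarrow> 'a \<Rightarrow> bool" where
  "summand_partial C X Y d p \<longleftrightarrow>
     coproduct_injection C d \<and> Cod C d = X \<and> p \<in> hom C (Dom C d) Y"

definition corresponds :: "('o, 'a, 'm) bicart_scheme \<Rightarrow> 'o \<Rightarrow> 'a \<Rightarrow> 'a \<Rightarrow> 'a \<Rightarrow> bool" where
  "corresponds C Y f d p \<longleftrightarrow> summand_partial C (Dom C f) Y d p \<and>
     (\<exists>e. is_binary_coproduct C (Dom C f) d e \<and>
        f \<cdot>\<^bsub>C\<^esub> d = inl C Y \<one>\<^bsub>C\<^esub> \<cdot>\<^bsub>C\<^esub> p \<and> f \<cdot>\<^bsub>C\<^esub> e = inr C Y \<one>\<^bsub>C\<^esub> \<cdot>\<^bsub>C\<^esub> bang C (Dom C e))"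

definition span_le :: "('o, 'a, 'm) cat_scheme \<Rightarrow> 'a \<Rightarrow> 'a \<Rightarrow> 'a \<Rightarrow> 'a \<Rightarrow> bool" where
  "span_le C d p d' p' \<longleftrightarrow>
     (\<exists>m \<in> hom C (Dom C d) (Dom C d'). d' \<cdot>\<^bsub>C\<^esub> m = d \<and> p' \<cdot>\<^bsub>C\<^esub> m = p)"

text \<open>Corresponding spans are unique up to isomorphism, so the choice of spans is immaterial.\<close>

definition L_le :: "('o, 'a, 'm) bicart_scheme \<Rightarrow> 'o \<Rightarrow> 'a \<Rightarrow> 'a \<Rightarrow> bool" where
  "L_le C Y f g \<longleftrightarrow> (\<exists>d p d' p'. corresponds C Y f d p \<and> corresponds C Y g d' p' \<and> span_le C d p d' p')"

definition L_elgot :: "('o, 'a, 'm) bicart_scheme \<Rightarrow> ('o, 'a) elgot" where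
  "L_elgot C = smonad.extend (L_monad C)
     (elgot.fields (\<lambda>Y f. THE h. is_least_iterate C (L_monad C) (L_le C) Y f h))"

end

theory Submission
  imports Defs
begin

text \<open>
  Arrows into \<open>Y \<oplus> \<one>\<close> are treated as partial functions on generalized elements: by extensivity, two
  arrows out of \<open>X\<close> agree as soon as they agree on all \<open>w\<close> on which a given \<open>f : X \<rightarrow> Y \<oplus> Z\<close> factors
  through \<open>inl\<close> or through \<open>inr\<close>. In these terms \<open>f\<close> is below \<open>g\<close> iff \<open>f \<cdot> w = inl \<cdot> y\<close> implies
  \<open>g \<cdot> w = inl \<cdot> y\<close>, and the supremum of a chain is glued from the disjoint pieces of \<open>X\<close> on which its
  members become defined; hyperextensivity makes their union a summand.

  In any \<open>\<omega>\<close>-continuous monad the least iterates, being Kleene suprema, satisfy the Elgot laws. The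
  morphism from \<open>\<L>\<close> to a complete Elgot monad \<open>N\<close> has to be \<open>\<lblot>\<eta>, \<bottom>\<rblot>\<close>, where \<open>\<bottom>\<close> is the iterate of
  \<open>\<eta> \<cdot> inr\<close>. It preserves iteration: on the domain of the least iterate this follows by finitely many
  unfoldings; on the complement \<open>E\<close> the computation stays in \<open>E\<close>, so by uniformity it can be
  restricted to a loop over \<open>E\<close> without exits, whose iterate is \<open>\<bottom>\<close>.
\<close>

section \<open>Categories with sums and products\<close>

text \<open>A complete Elgot monad \<open>N\<close> carries no order, so divergence in
  \<open>N\<close> cannot be argued by approximation: it has to come out of the equational laws and
  uniformity. A loop restricted to \<open>E\<close> may also stop in the failure summand of
  \<open>X \<oplus> \<one>\<close>, so it is an arrow
  \<open>k : E \<rightarrow> E \<oplus> \<one>\<close>, whereas uniformity along the map to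
  \<open>\<one>\<close> collapses only endomorphisms directly. Dinaturality and the codiagonal law
  are what turn failure into further looping. On the domain of the least iterate the number of
  unfoldings is finite but varies from piece to piece. This is why suprema come with a covering
  principle: arrows agree if they agree wherever some member of the chain is defined. Stating covers
  as implications whose conclusion is an equation \<open>a = b\<close> lets them be nested and
  restricted without coproduct diagrams.\<close>

lemma hom_iff: "f \<in> hom C X Y \<longleftrightarrow> Dom C f = X \<and> Cod C f = Y"
  by (simp add: hom_def)

section \<open>Arrows and universal properties of coproducts\<close>

context category
begin

lemma dom_idm [simp]: "Dom C (idm C X) = X" and cod_idm [simp]: "Cod C (idm C X) = X"
  using idm_hom[of X] by (auto simp: hom_iff)

lemma dom_cmp [simp]: "Cod C f = Dom C g \<Longrightarrow> Dom C (g \<cdot> f) = Dom C f"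
  and cod_cmp [simp]: "Cod C f = Dom C g \<Longrightarrow> Cod C (g \<cdot> f) = Cod C g"
  using cmp_hom[of f "Dom C f" "Dom C g" g "Cod C g"] by (auto simp: hom_iff)

lemma assoc [simp]: "Cod C f = Dom C g \<Longrightarrow> Cod C g = Dom C h \<Longrightarrow> (h \<cdot> g) \<cdot> f = h \<cdot> (g \<cdot> f)"
  by (rule cmp_assoc) (auto simp: hom_iff)

lemma id_left [simp]: "Cod C f = X \<Longrightarrow> idm C X \<cdot> f = f"
  by (rule idm_left[of f "Dom C f"]) (simp add: hom_iff)

lemma id_right [simp]: "Dom C f = X \<Longrightarrow> f \<cdot> idm C X = f"
  by (rule idm_right[of f _ "Cod C f"]) (simp add: hom_iff)

lemma is_initial_eq:
  assumes "is_initial C W" "Dom C a = W" "Dom C b = W" "Cod C a = Cod C b"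
  shows "a = b"
proof -
  have "\<exists>!f. f \<in> hom C W (Cod C a)" using assms(1) by (simp add: is_initial_def)
  moreover have "a \<in> hom C W (Cod C a)" "b \<in> hom C W (Cod C a)" using assms by (simp_all add: hom_iff)
  ultimately show ?thesis by blast
qed

lemma is_binary_coproduct_ex1:
  assumes "is_binary_coproduct C S d e" "Dom C f = Dom C d" "Dom C g = Dom C e" "Cod C f = Z" "Cod C g = Z"
  shows "\<exists>!h. h \<in> hom C S Z \<and> h \<cdot> d = f \<and> h \<cdot> e = g"
proof -
  have "f \<in> hom C (Dom C d) Z" "g \<in> hom C (Dom C e) Z" using assms(2-) by (simp_all add: hom_iff)
  with assms(1)[unfolded is_binary_coproduct_def] show ?thesis by blast
qed

lemma is_binary_coproduct_cod:
  "is_binary_coproduct C S d e \<Longrightarrow> Cod C d = S" "is_binary_coproduct C S d e \<Longrightarrow> Cod C e = S"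
  by (simp_all add: is_binary_coproduct_def)

lemma is_binary_coproduct_eq:
  assumes "is_binary_coproduct C S d e" "Dom C a = S" "Dom C b = S" "Cod C a = Cod C b"
    and "a \<cdot> d = b \<cdot> d" "a \<cdot> e = b \<cdot> e"
  shows "a = b"
proof -
  have "\<exists>!h. h \<in> hom C S (Cod C b) \<and> h \<cdot> d = b \<cdot> d \<and> h \<cdot> e = b \<cdot> e"
    by (rule is_binary_coproduct_ex1[OF assms(1)])
      (use is_binary_coproduct_cod[OF assms(1)] assms(3) in simp_all)
  moreover have "a \<in> hom C S (Cod C b)" "b \<in> hom C S (Cod C b)" using assms(2-4) by (simp_all add: hom_iff)
  ultimately show ?thesis using assms(5,6) by blast
qed

lemma is_binary_coproduct_copair:
  assumes "is_binary_coproduct C S d e"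
    and "Dom C f = Dom C d" "Dom C g = Dom C e" "Cod C f = Cod C g"
  obtains h where "Dom C h = S" "Cod C h = Cod C f" "h \<cdot> d = f" "h \<cdot> e = g"
  using ex1_implies_ex[OF is_binary_coproduct_ex1[OF assms(1-3) refl assms(4)[symmetric]]]
  by (auto simp: hom_iff)

lemma is_coproduct_cod: "is_coproduct C I S c \<Longrightarrow> i \<in> I \<Longrightarrow> Cod C (c i) = S"
  by (simp add: is_coproduct_def)

lemma is_coproduct_ex1:
  assumes "is_coproduct C I S c"
    and "\<And>i. i \<in> I \<Longrightarrow> Dom C (f i) = Dom C (c i)" "\<And>i. i \<in> I \<Longrightarrow> Cod C (f i) = Z"
  shows "\<exists>!h. h \<in> hom C S Z \<and> (\<forall>i\<in>I. h \<cdot> c i = f i)"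
proof -
  have "\<forall>i\<in>I. f i \<in> hom C (Dom C (c i)) Z" using assms(2,3) by (simp add: hom_iff)
  with assms(1)[unfolded is_coproduct_def] show ?thesis by blast
qed

lemma is_coproduct_copair:
  assumes "is_coproduct C I S c"
    and "\<And>i. i \<in> I \<Longrightarrow> Dom C (f i) = Dom C (c i)" "\<And>i. i \<in> I \<Longrightarrow> Cod C (f i) = Z"
  obtains h where "Dom C h = S" "Cod C h = Z" "\<And>i. i \<in> I \<Longrightarrow> h \<cdot> c i = f i"
proof -
  have "\<exists>h. h \<in> hom C S Z \<and> (\<forall>i\<in>I. h \<cdot> c i = f i)"
    by (rule ex1_implies_ex[OF is_coproduct_ex1]) (fact assms)+
  then show thesis using that by (auto simp: hom_iff)
qed

lemma is_coproduct_eq: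
  assumes "is_coproduct C I S c" "Dom C a = S" "Dom C b = S" "Cod C a = Cod C b"
    and "\<And>i. i \<in> I \<Longrightarrow> a \<cdot> c i = b \<cdot> c i"
  shows "a = b"
proof -
  have "\<exists>!h. h \<in> hom C S (Cod C b) \<and> (\<forall>i\<in>I. h \<cdot> c i = b \<cdot> c i)"
    by (rule is_coproduct_ex1[OF assms(1)]) (use is_coproduct_cod[OF assms(1)] assms(3) in simp_all)
  moreover have "a \<in> hom C S (Cod C b)" "b \<in> hom C S (Cod C b)" using assms(2-4) by (simp_all add: hom_iff)
  ultimately show ?thesis using assms(5) by blast
qed

text \<open>The hyperextensivity axioms speak of families indexed by sets of naturals; the index set
  \<open>{0, 1}\<close> makes them available for binary coproducts.\<close>

lemma is_binary_coproduct_iff: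
  "is_binary_coproduct C S d e \<longleftrightarrow> is_coproduct C {0, 1::nat} S (\<lambda>i. if i = 0 then d else e)"
  (is "?L \<longleftrightarrow> ?R")
proof
  assume L: ?L
  show ?R unfolding is_coproduct_def
  proof (intro conjI allI impI)
    fix Z f
    assume "\<forall>i\<in>{0, 1::nat}. f i \<in> hom C (Dom C (if i = 0 then d else e)) Z"
    then have "f 0 \<in> hom C (Dom C d) Z" "f 1 \<in> hom C (Dom C e) Z" by simp_all
    then have "\<exists>!h. h \<in> hom C S Z \<and> h \<cdot> d = f 0 \<and> h \<cdot> e = f 1"
      by (intro is_binary_coproduct_ex1[OF L]) (simp_all add: hom_iff)
    then show "\<exists>!h. h \<in> hom C S Z \<and> (\<forall>i\<in>{0, 1}. h \<cdot> (if i = 0 then d else e) = f i)"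
      by simp
  qed (use is_binary_coproduct_cod[OF L] in auto)
next
  assume R: ?R
  show ?L unfolding is_binary_coproduct_def
  proof (intro conjI allI ballI)
    fix Z f g
    assume "f \<in> hom C (Dom C d) Z" "g \<in> hom C (Dom C e) Z"
    then have "\<exists>!h. h \<in> hom C S Z \<and> (\<forall>i\<in>{0, 1::nat}. h \<cdot> (if i = 0 then d else e) = (if i = 0 then f else g))"
      by (intro is_coproduct_ex1[OF R]) (simp_all add: hom_iff)
    then show "\<exists>!h. h \<in> hom C S Z \<and> h \<cdot> d = f \<and> h \<cdot> e = g" by simp
  qed (use is_coproduct_cod[OF R, of 0] is_coproduct_cod[OF R, of 1] in auto)
qed

end

section \<open>Chosen sums\<close>

context chosen_binary_coproducts
begin

lemma dom_inl [simp]: "Dom C (inl C X Y) = X" and dom_inr [simp]: "Dom C (inr C X Y) = Y"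
  and cod_inl [simp]: "Cod C (inl C X Y) = X \<oplus> Y" and cod_inr [simp]: "Cod C (inr C X Y) = X \<oplus> Y"
  using coproduct[of X Y] by (auto simp: is_binary_coproduct_def)

lemma copair_props:
  assumes "Cod C f = Cod C g"
  shows "\<lblot>f, g\<rblot> \<in> hom C (Dom C f \<oplus> Dom C g) (Cod C f)
     \<and> \<lblot>f, g\<rblot> \<cdot> inl C (Dom C f) (Dom C g) = f \<and> \<lblot>f, g\<rblot> \<cdot> inr C (Dom C f) (Dom C g) = g"
  unfolding copair_def
  by (rule theI') (use coproduct(1)[of "Dom C f" "Dom C g"] assms in \<open>auto simp: is_binary_coproduct_def hom_iff\<close>)

lemma dom_copair [simp]: "Cod C f = Cod C g \<Longrightarrow> Dom C \<lblot>f, g\<rblot> = Dom C f \<oplus> Dom C g"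
  and cod_copair [simp]: "Cod C f = Cod C g \<Longrightarrow> Cod C \<lblot>f, g\<rblot> = Cod C g"
  using copair_props[of f g] by (auto simp: hom_iff)

lemma copair_inl [simp]:
    "Cod C f = Cod C g \<Longrightarrow> Dom C f = X \<Longrightarrow> Dom C g = Y \<Longrightarrow> \<lblot>f, g\<rblot> \<cdot> inl C X Y = f"
  and copair_inr [simp]:
    "Cod C f = Cod C g \<Longrightarrow> Dom C f = X \<Longrightarrow> Dom C g = Y \<Longrightarrow> \<lblot>f, g\<rblot> \<cdot> inr C X Y = g"
  using copair_props[of f g] by (auto simp: hom_iff)

lemma copair_inl_cmp [simp]:
  assumes "Cod C f = Cod C g" "Dom C f = X" "Dom C g = Y" "Cod C h = X"
  shows "\<lblot>f, g\<rblot> \<cdot> (inl C X Y \<cdot> h) = f \<cdot> h"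
  using assms assoc[of h "inl C X Y" "\<lblot>f, g\<rblot>"] by simp

lemma copair_inr_cmp [simp]:
  assumes "Cod C f = Cod C g" "Dom C f = X" "Dom C g = Y" "Cod C h = Y"
  shows "\<lblot>f, g\<rblot> \<cdot> (inr C X Y \<cdot> h) = g \<cdot> h"
  using assms assoc[of h "inr C X Y" "\<lblot>f, g\<rblot>"] by simp

lemma copair_ext:
  assumes "Dom C a = X \<oplus> Y" "Dom C b = X \<oplus> Y" "Cod C a = Cod C b"
    and "a \<cdot> inl C X Y = b \<cdot> inl C X Y" "a \<cdot> inr C X Y = b \<cdot> inr C X Y"
  shows "a = b"
  using is_binary_coproduct_eq[OF coproduct(1)] assms by blast

lemma cmp_copair [simp]:
  "Cod C f = Cod C g \<Longrightarrow> Cod C g = Dom C h \<Longrightarrow> h \<cdot> \<lblot>f, g\<rblot> = \<lblot>h \<cdot> f, h \<cdot> g\<rblot>"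
  by (rule copair_ext[of _ "Dom C f" "Dom C g"]) auto

lemma copair_inl_inr [simp]: "\<lblot>inl C X Y, inr C X Y\<rblot> = idm C (X \<oplus> Y)"
  by (rule copair_ext[of _ X Y]) auto

lemma dom_sum_map [simp]: "Dom C (f \<oplus>\<^sub>m g) = Dom C f \<oplus> Dom C g"
  and cod_sum_map [simp]: "Cod C (f \<oplus>\<^sub>m g) = Cod C f \<oplus> Cod C g"
  by (simp_all add: sum_map_def)

end

section \<open>Chosen products\<close>

context chosen_finite_products
begin

lemma dom_prl [simp]: "Dom C (prl C X Y) = X \<otimes> Y" and dom_prr [simp]: "Dom C (prr C X Y) = X \<otimes> Y"
  and cod_prl [simp]: "Cod C (prl C X Y) = X" and cod_prr [simp]: "Cod C (prr C X Y) = Y"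
  using product[of X Y] by (auto simp: is_product_def)

lemma bang_hom: "bang C X \<in> hom C X \<one>"
  unfolding bang_def by (rule theI') (use terminal in \<open>simp add: is_terminal_def\<close>)

lemma dom_bang [simp]: "Dom C (bang C X) = X" and cod_bang [simp]: "Cod C (bang C X) = \<one>"
  using bang_hom[of X] by (auto simp: hom_iff)

lemma to_terminal_eq: "Cod C f = \<one> \<Longrightarrow> Cod C g = \<one> \<Longrightarrow> Dom C f = Dom C g \<Longrightarrow> f = g"
  using terminal unfolding is_terminal_def hom_iff by metis

lemma bang_cmp [simp]: "Cod C f = X \<Longrightarrow> bang C X \<cdot> f = bang C (Dom C f)"
  by (rule to_terminal_eq) auto

lemma bang_one [simp]: "bang C \<one> = idm C \<one>"
  by (rule to_terminal_eq) auto

lemma pairing_props: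
  assumes "Dom C f = Dom C g"
  shows "pairing C f g \<in> hom C (Dom C f) (Cod C f \<otimes> Cod C g)
     \<and> prl C (Cod C f) (Cod C g) \<cdot> pairing C f g = f \<and> prr C (Cod C f) (Cod C g) \<cdot> pairing C f g = g"
  unfolding pairing_def
  by (rule theI') (use product[of "Cod C f" "Cod C g"] assms in \<open>auto simp: is_product_def hom_iff\<close>)

lemma dom_pairing [simp]: "Dom C f = Dom C g \<Longrightarrow> Dom C (pairing C f g) = Dom C g"
  and cod_pairing [simp]: "Dom C f = Dom C g \<Longrightarrow> Cod C (pairing C f g) = Cod C f \<otimes> Cod C g"
  using pairing_props[of f g] by (auto simp: hom_iff)

lemma prl_pairing [simp]:
    "Dom C f = Dom C g \<Longrightarrow> Cod C f = X \<Longrightarrow> Cod C g = Y \<Longrightarrow> prl C X Y \<cdot> pairing C f g = f"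
  and prr_pairing [simp]:
    "Dom C f = Dom C g \<Longrightarrow> Cod C f = X \<Longrightarrow> Cod C g = Y \<Longrightarrow> prr C X Y \<cdot> pairing C f g = g"
  using pairing_props[of f g] by (auto simp: hom_iff)

lemma pairing_ext:
  assumes "Cod C a = X \<otimes> Y" "Cod C b = X \<otimes> Y" "Dom C a = Dom C b"
    and "prl C X Y \<cdot> a = prl C X Y \<cdot> b" "prr C X Y \<cdot> a = prr C X Y \<cdot> b"
  shows "a = b"
proof -
  have "\<exists>!h. h \<in> hom C (Dom C a) (X \<otimes> Y) \<and> prl C X Y \<cdot> h = prl C X Y \<cdot> a \<and> prr C X Y \<cdot> h = prr C X Y \<cdot> a"
    using product[of X Y] assms unfolding is_product_def by (simp add: hom_iff)
  then show ?thesis using assms by (metis hom_iff)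
qed

lemma prl_pairing_cmp [simp]:
  assumes "Dom C f = Dom C g" "Cod C f = X" "Cod C g = Y" "Cod C h = Dom C g"
  shows "prl C X Y \<cdot> (pairing C f g \<cdot> h) = f \<cdot> h"
  using assms assoc[of h "pairing C f g" "prl C X Y"] by simp

lemma prr_pairing_cmp [simp]:
  assumes "Dom C f = Dom C g" "Cod C f = X" "Cod C g = Y" "Cod C h = Dom C g"
  shows "prr C X Y \<cdot> (pairing C f g \<cdot> h) = g \<cdot> h"
  using assms assoc[of h "pairing C f g" "prr C X Y"] by simp

lemma pairing_cmp [simp]:
  "Dom C f = Dom C g \<Longrightarrow> Cod C h = Dom C g \<Longrightarrow> pairing C f g \<cdot> h = pairing C (f \<cdot> h) (g \<cdot> h)"
  by (rule pairing_ext[of _ "Cod C f" "Cod C g"]) auto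

lemma pairing_eta [simp]: "Cod C h = X \<otimes> Y \<Longrightarrow> pairing C (prl C X Y \<cdot> h) (prr C X Y \<cdot> h) = h"
  by (rule pairing_ext[of _ X Y]) auto

lemma dom_prod_map [simp]: "Dom C (f \<otimes>\<^sub>m g) = Dom C f \<otimes> Dom C g"
  and cod_prod_map [simp]: "Cod C (f \<otimes>\<^sub>m g) = Cod C f \<otimes> Cod C g"
  by (simp_all add: prod_map_def)

lemma prod_map_cmp_pairing [simp]:
  "Dom C a = Dom C b \<Longrightarrow> Cod C a = Dom C f \<Longrightarrow> Cod C b = Dom C g \<Longrightarrow>
    (f \<otimes>\<^sub>m g) \<cdot> pairing C a b = pairing C (f \<cdot> a) (g \<cdot> b)"
  by (simp add: prod_map_def)

lemma prod_map_cmp [simp]: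
  "Cod C f' = Dom C f \<Longrightarrow> Cod C g' = Dom C g \<Longrightarrow> (f \<otimes>\<^sub>m g) \<cdot> (f' \<otimes>\<^sub>m g') = (f \<cdot> f') \<otimes>\<^sub>m (g \<cdot> g')"
  by (simp add: prod_map_def[of _ f'] prod_map_def[of _ "f \<cdot> f'"])

lemma prr_prod_map [simp]:
  "Cod C f = X \<Longrightarrow> Cod C g = Y \<Longrightarrow> prr C X Y \<cdot> (f \<otimes>\<^sub>m g) = g \<cdot> prr C (Dom C f) (Dom C g)"
  by (simp add: prod_map_def)

end

section \<open>Extensivity\<close>

lemma is_binary_coproduct_sym: "is_binary_coproduct C S i j \<Longrightarrow> is_binary_coproduct C S j i"
  unfolding is_binary_coproduct_def by metis

context category
begin

text \<open>The simplifier associates composites to the right, so a known equation between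
  composites stops matching once \<open>v\<close> is precomposed. This lemma and
  \<open>cmp_eq\<close> restate the equation in the form that still matches.\<close>

lemma cmp_eq_cmp:
  assumes "f \<cdot> g = h \<cdot> k" "Cod C g = Dom C f" "Cod C k = Dom C h" "Dom C g = Dom C k" "Cod C v = Dom C k"
  shows "f \<cdot> (g \<cdot> v) = h \<cdot> (k \<cdot> v)"
  using assms assoc[of v g f] assoc[of v k h] by simp

lemma cmp_eq:
  assumes "f \<cdot> g = h" "Cod C g = Dom C f" "Cod C v = Dom C g"
  shows "f \<cdot> (g \<cdot> v) = h \<cdot> v"
  using assms assoc[of v g f] by simp

lemma is_pullbackE:
  assumes "is_pullback C p q f g" "f \<cdot> u = g \<cdot> v" "Cod C u = Dom C f" "Cod C v = Dom C g" "Dom C u = Dom C v"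
  obtains h where "Dom C h = Dom C v" "Cod C h = Dom C p" "p \<cdot> h = u" "q \<cdot> h = v"
proof -
  have "u \<in> hom C (Dom C v) (Dom C f)" "v \<in> hom C (Dom C v) (Dom C g)" using assms(3-5) by (simp_all add: hom_iff)
  then have "\<exists>h. h \<in> hom C (Dom C v) (Dom C p) \<and> p \<cdot> h = u \<and> q \<cdot> h = v"
    using assms(1,2) unfolding is_pullback_def by blast
  then show thesis using that by (auto simp: hom_iff)
qed

lemma is_pullback_cods:
  assumes "is_pullback C p q f g"
  shows "Dom C q = Dom C p" "Cod C p = Dom C f" "Cod C q = Dom C g" "f \<cdot> p = g \<cdot> q"
  using assms by (simp_all add: is_pullback_def)

text \<open>This brings initial objects under the axioms on countable coproducts, as the case of no
  summands.\<close>

lemma is_initial_iff_coproduct: "is_initial C W \<longleftrightarrow> is_coproduct C ({} :: nat set) W c"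
  by (simp add: is_initial_def is_coproduct_def)

end

section \<open>Case analysis along coproducts\<close>

context hyperextensive
begin

text \<open>Universality of the empty coproduct: pulled back along \<open>f\<close>, it exhibits the
  domain of \<open>f\<close> as an empty coproduct again.\<close>

lemma strict_initial:
  assumes "is_initial C (Cod C f)" shows "is_initial C (Dom C f)"
proof -
  have "is_coproduct C ({} :: nat set) (Cod C f) (\<lambda>_. f)" "f \<in> hom C (Dom C f) (Cod C f)"
    using assms is_initial_iff_coproduct by (auto simp: hom_iff)
  from coproducts_universal[OF this] show ?thesis
    using is_initial_iff_coproduct by blast
qed

text \<open>Universality for two summands. The pullback squares are returned along with the
  coproduct because they are what factors elements through \<open>d\<close> or
  \<open>e\<close>.\<close>

lemma split:
  assumes "is_binary_coproduct C (Cod C f) i j"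
  obtains d p e q where "is_binary_coproduct C (Dom C f) d e" "is_pullback C d p f i" "is_pullback C e q f j"
proof -
  let ?c = "\<lambda>k::nat. if k = 0 then i else j"
  have c: "is_coproduct C {0, 1} (Cod C f) ?c" and f: "f \<in> hom C (Dom C f) (Cod C f)"
    using assms by (auto simp: is_binary_coproduct_iff hom_iff)
  obtain d p where d: "is_pullback C d p f i" using injection_pullbacks[OF c _ f, of 0] by auto
  obtain e q where e: "is_pullback C e q f j" using injection_pullbacks[OF c _ f, of 1] by auto
  have "is_coproduct C {0, 1::nat} (Dom C f) (\<lambda>k. if k = 0 then d else e)"
    by (rule coproducts_universal[OF c f, of _ "\<lambda>k. if k = 0 then p else q"]) (use d e in auto)
  then show thesis using that d e by (simp add: is_binary_coproduct_iff)
qed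

text \<open>Only the pullbacks \<open>d\<close> and \<open>e\<close> obtained from
  \<open>split\<close> are used as instances of \<open>w\<close>. Asking for all \<open>w\<close>
  keeps pullback squares out of later proofs, where the two hypotheses read like the branches of a
  pattern match on \<open>f\<close>.\<close>

lemma binary_cases_eq:
  assumes S: "is_binary_coproduct C (Cod C f) i j"
    and ab: "Dom C a = Dom C f" "Dom C b = Dom C f" "Cod C a = Cod C b"
    and l: "\<And>w y. Cod C w = Dom C f \<Longrightarrow> Cod C y = Dom C i \<Longrightarrow> Dom C y = Dom C w \<Longrightarrow> f \<cdot> w = i \<cdot> y \<Longrightarrow> a \<cdot> w = b \<cdot> w"
    and r: "\<And>w y. Cod C w = Dom C f \<Longrightarrow> Cod C y = Dom C j \<Longrightarrow> Dom C y = Dom C w \<Longrightarrow> f \<cdot> w = j \<cdot> y \<Longrightarrow> a \<cdot> w = b \<cdot> w"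
  shows "a = b"
proof -
  obtain d p e q where d: "is_binary_coproduct C (Dom C f) d e" "is_pullback C d p f i" "is_pullback C e q f j"
    by (rule split[OF S])
  show ?thesis
    by (rule is_binary_coproduct_eq[OF d(1) ab(1) ab(2) ab(3)])
      (simp_all add: l[of d p] r[of e q] is_pullback_cods[OF d(2)] is_pullback_cods[OF d(3)])
qed

lemma countable_cases_eq:
  fixes I :: "nat set"
  assumes S: "is_coproduct C I (Cod C f) c"
    and ab: "Dom C a = Dom C f" "Dom C b = Dom C f" "Cod C a = Cod C b"
    and i: "\<And>i w y. i \<in> I \<Longrightarrow> Cod C w = Dom C f \<Longrightarrow> Cod C y = Dom C (c i) \<Longrightarrow> Dom C y = Dom C w \<Longrightarrow>
      f \<cdot> w = c i \<cdot> y \<Longrightarrow> a \<cdot> w = b \<cdot> w"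
  shows "a = b"
proof -
  have f: "f \<in> hom C (Dom C f) (Cod C f)" by (simp add: hom_iff)
  have "\<forall>i\<in>I. \<exists>d p. is_pullback C d p f (c i)" using injection_pullbacks[OF S _ f] by blast
  then obtain d p where d: "\<forall>i\<in>I. is_pullback C (d i) (p i) f (c i)" by metis
  show ?thesis
  proof (rule is_coproduct_eq[OF coproducts_universal[OF S f d] ab])
    fix k assume k: "k \<in> I"
    note pb = is_pullback_cods[OF d[rule_format, OF k]]
    show "a \<cdot> d k = b \<cdot> d k" by (rule i[OF k pb(2,3,1,4)])
  qed
qed

lemma injection_mono:
  assumes "is_binary_coproduct C S i j" "i \<cdot> a = i \<cdot> b" "Cod C a = Dom C i" "Cod C b = Dom C i" "Dom C a = Dom C b"
  shows "a = b"
proof -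
  have "is_mono C i"
    using injections_mono[of "{0, 1}" S "\<lambda>k. if k = 0 then i else j" 0] assms(1)
    by (simp add: is_binary_coproduct_iff)
  moreover have "a \<in> hom C (Dom C b) (Dom C i)" "b \<in> hom C (Dom C b) (Dom C i)" using assms(3-5) by (simp_all add: hom_iff)
  ultimately show ?thesis using assms(2) unfolding is_mono_def by blast
qed

text \<open>A common element of both injections factors through their pullback, whose vertex is
  initial; by strictness its own domain is initial.\<close>

lemma injections_disjoint:
  assumes "is_binary_coproduct C S i j" "i \<cdot> a = j \<cdot> b" "Cod C a = Dom C i" "Cod C b = Dom C j" "Dom C a = Dom C b"
  shows "is_initial C (Dom C b)"
proof -
  have "disjoint_arrows C i j"
    using coproducts_disjoint[of "{0, 1}" S "\<lambda>k. if k = 0 then i else j" 0 1] assms(1)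
    by (simp add: is_binary_coproduct_iff)
  then obtain p q where p: "is_pullback C p q i j" "is_initial C (Dom C p)"
    unfolding disjoint_arrows_def by blast
  obtain h where "Dom C h = Dom C b" "Cod C h = Dom C p" by (rule is_pullbackE[OF p(1) assms(2-5)])
  then show ?thesis using strict_initial[of h] p by simp
qed

text \<open>This closes impossible cases: parallel arrows out of an initial object coincide, so
  whatever equation \<open>x = y\<close> is wanted there holds.\<close>

lemma injections_disjoint_eq:
  assumes "is_binary_coproduct C S i j" "i \<cdot> a = j \<cdot> b" "Cod C a = Dom C i" "Cod C b = Dom C j" "Dom C a = Dom C b"
    and "Dom C x = Dom C b" "Dom C y = Dom C b" "Cod C x = Cod C y"
  shows "x = y"
  using is_initial_eq[OF injections_disjoint[OF assms(1-5)]] assms by simp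

text \<open>If \<open>S = D + E\<close> and \<open>E = A + B\<close>, regrouping gives
  \<open>S = A + (D + B)\<close>, so the complement of \<open>e \<cdot> c\<close> is the arrow
  \<open>u\<close> out of a coproduct \<open>T\<close> of the domains of \<open>d\<close> and
  \<open>c'\<close>. As there are no chosen sums here, \<open>T\<close> comes from
  \<open>countable_coproducts\<close>.\<close>

lemma coproduct_injection_cmp:
  assumes S: "is_binary_coproduct C S d e" and E: "is_binary_coproduct C (Dom C e) c c'"
  shows "coproduct_injection C (e \<cdot> c)"
proof -
  have cod: "Cod C d = S" "Cod C e = S" "Cod C c = Dom C e" "Cod C c' = Dom C e"
    using S E by (auto simp: is_binary_coproduct_def)
  obtain T s where "is_coproduct C {0, 1::nat} T s \<and> (\<forall>i\<in>{0, 1}. Dom C (s i) = (if i = 0 then Dom C d else Dom C c'))"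
    using countable_coproducts[of "{0, 1}" "\<lambda>i. if i = 0 then Dom C d else Dom C c'"] by blast
  then have T: "is_coproduct C {0, 1::nat} T (\<lambda>i. if i = 0 then s 0 else s 1)"
    and s: "Dom C (s 0) = Dom C d" "Dom C (s 1) = Dom C c'"
    by (auto simp: is_coproduct_def)
  then have T: "is_binary_coproduct C T (s 0) (s 1)" by (simp only: is_binary_coproduct_iff)
  have cods: "Cod C (s 0) = T" "Cod C (s 1) = T" using T by (auto simp: is_binary_coproduct_def)
  obtain u where u: "Dom C u = T" "Cod C u = S" "u \<cdot> s 0 = d" "u \<cdot> s 1 = e \<cdot> c'"
    by (rule is_binary_coproduct_copair[OF T, of d "e \<cdot> c'"]) (use s cod in auto)
  have "is_binary_coproduct C S (e \<cdot> c) u" unfolding is_binary_coproduct_def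
  proof (intro conjI allI ballI)
    fix Z f g assume "f \<in> hom C (Dom C (e \<cdot> c)) Z" "g \<in> hom C (Dom C u) Z"
    then have f: "Dom C f = Dom C c" "Cod C f = Z" and g: "Dom C g = T" "Cod C g = Z"
      using cod u by (auto simp: hom_iff)
    obtain k where k: "Dom C k = Dom C e" "Cod C k = Z" "k \<cdot> c = f" "k \<cdot> c' = g \<cdot> s 1"
      by (rule is_binary_coproduct_copair[OF E, of f "g \<cdot> s 1"]) (use f g s cod cods in auto)
    obtain h where h: "Dom C h = S" "Cod C h = Z" "h \<cdot> d = g \<cdot> s 0" "h \<cdot> e = k"
      by (rule is_binary_coproduct_copair[OF S, of "g \<cdot> s 0" k]) (use f g s cod cods k in auto)
    have hc: "h \<cdot> (e \<cdot> c) = f" using cmp_eq[OF h(4), of c] h k cod by simp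
    have hu: "h \<cdot> u = g"
    proof (rule is_binary_coproduct_eq[OF T])
      show "(h \<cdot> u) \<cdot> s 1 = g \<cdot> s 1"
        using cmp_eq[OF h(4), of c'] h k cod u cods by simp
    qed (use h g u s cods in auto)
    show "\<exists>!h. h \<in> hom C S Z \<and> h \<cdot> (e \<cdot> c) = f \<and> h \<cdot> u = g"
    proof (rule ex1I[of _ h])
      show "h \<in> hom C S Z \<and> h \<cdot> (e \<cdot> c) = f \<and> h \<cdot> u = g" using h hc hu by (simp add: hom_iff)
      fix h' assume h': "h' \<in> hom C S Z \<and> h' \<cdot> (e \<cdot> c) = f \<and> h' \<cdot> u = g"
      then have d': "Dom C h' = S" "Cod C h' = Z" "h' \<cdot> (e \<cdot> c) = f" "h' \<cdot> u = g" by (auto simp: hom_iff)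
      have "h' \<cdot> d = h \<cdot> d" using cmp_eq[OF d'(4), of "s 0"] u d' h cods by simp
      moreover have "h' \<cdot> e = h \<cdot> e"
      proof (rule is_binary_coproduct_eq[OF E])
        show "(h' \<cdot> e) \<cdot> c' = (h \<cdot> e) \<cdot> c'"
          using cmp_eq[OF d'(4), of "s 1"] u d' h hc cod cods k by simp
      qed (use d' h hc cod k in auto)
      ultimately show "h' = h"
        using is_binary_coproduct_eq[OF S] d' h by metis
    qed
  qed (use cod u in auto)
  then show ?thesis using cod by (auto simp: coproduct_injection_def)
qed

end

section \<open>Elements of chosen sums, and distributivity\<close>

locale hyperextensive_bicart = hyperextensive C + chosen_binary_coproducts C + chosen_finite_products C
  for C :: "('o, 'a, 'm) bicart_scheme" (structure)
begin

lemma sum_cases_eq: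
  assumes "Cod C f = Y \<oplus> Z"
    and "Dom C a = Dom C f" "Dom C b = Dom C f" "Cod C a = Cod C b"
    and "\<And>w y. Cod C w = Dom C f \<Longrightarrow> Cod C y = Y \<Longrightarrow> Dom C y = Dom C w \<Longrightarrow> f \<cdot> w = inl C Y Z \<cdot> y \<Longrightarrow> a \<cdot> w = b \<cdot> w"
    and "\<And>w y. Cod C w = Dom C f \<Longrightarrow> Cod C y = Z \<Longrightarrow> Dom C y = Dom C w \<Longrightarrow> f \<cdot> w = inr C Y Z \<cdot> y \<Longrightarrow> a \<cdot> w = b \<cdot> w"
  shows "a = b"
proof (rule binary_cases_eq[of f "inl C Y Z" "inr C Y Z" a b])
  show "is_binary_coproduct C (Cod C f) (inl C Y Z) (inr C Y Z)" using assms(1) coproduct(1) by simp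
qed (use assms(2-) in \<open>simp_all only: dom_inl dom_inr\<close>)

lemma inl_cancel: "inl C Y Z \<cdot> a = inl C Y Z \<cdot> b \<Longrightarrow> Cod C a = Y \<Longrightarrow> Cod C b = Y \<Longrightarrow> Dom C a = Dom C b \<Longrightarrow> a = b"
  by (rule injection_mono[OF coproduct(1)]) auto

lemma inr_cancel: "inr C Y Z \<cdot> a = inr C Y Z \<cdot> b \<Longrightarrow> Cod C a = Z \<Longrightarrow> Cod C b = Z \<Longrightarrow> Dom C a = Dom C b \<Longrightarrow> a = b"
  by (rule injection_mono[OF is_binary_coproduct_sym[OF coproduct(1)]]) auto

lemma inl_inr_eq:
  assumes "inl C Y Z \<cdot> a = inr C Y Z \<cdot> b" "Cod C a = Y" "Cod C b = Z" "Dom C a = Dom C b"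
    and "Dom C x = Dom C b" "Dom C y = Dom C b" "Cod C x = Cod C y"
  shows "x = y"
  by (rule injections_disjoint_eq[OF coproduct(1) assms(1)]) (use assms in auto)

text \<open>Distributivity is an instance of universality:
  \<open>idm C X \<otimes>\<^sub>m i\<close> is the pullback of an injection \<open>i\<close> along
  the projection \<open>prr C X (Y \<oplus> Z)\<close>.\<close>

lemma prod_coproduct: "is_binary_coproduct C (X \<otimes> (Y \<oplus> Z)) (idm C X \<otimes>\<^sub>m inl C Y Z) (idm C X \<otimes>\<^sub>m inr C Y Z)"
proof -
  have pb: "is_pullback C (idm C X \<otimes>\<^sub>m i) (prr C X (Dom C i)) (prr C X (Y \<oplus> Z)) i"
    if i: "Cod C i = Y \<oplus> Z" and mono: "\<And>a b. i \<cdot> a = i \<cdot> b \<Longrightarrow> Cod C a = Dom C i \<Longrightarrow> Cod C b = Dom C i \<Longrightarrow> Dom C a = Dom C b \<Longrightarrow> a = b" for i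
    unfolding is_pullback_def
  proof (intro conjI allI ballI impI)
    fix W u v
    assume uv: "u \<in> hom C W (Dom C (prr C X (Y \<oplus> Z)))" "v \<in> hom C W (Dom C i)" "prr C X (Y \<oplus> Z) \<cdot> u = i \<cdot> v"
    then have d: "Dom C u = W" "Cod C u = X \<otimes> (Y \<oplus> Z)" "Dom C v = W" "Cod C v = Dom C i" by (auto simp: hom_iff)
    show "\<exists>!h. h \<in> hom C W (Dom C (idm C X \<otimes>\<^sub>m i)) \<and> (idm C X \<otimes>\<^sub>m i) \<cdot> h = u \<and> prr C X (Dom C i) \<cdot> h = v"
    proof (rule ex1I[of _ "pairing C (prl C X (Y \<oplus> Z) \<cdot> u) v"])
      show "pairing C (prl C X (Y \<oplus> Z) \<cdot> u) v \<in> hom C W (Dom C (idm C X \<otimes>\<^sub>m i)) \<and>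
        (idm C X \<otimes>\<^sub>m i) \<cdot> pairing C (prl C X (Y \<oplus> Z) \<cdot> u) v = u \<and>
        prr C X (Dom C i) \<cdot> pairing C (prl C X (Y \<oplus> Z) \<cdot> u) v = v"
        using d i by (simp add: hom_iff uv(3)[symmetric])
      fix h
      assume "h \<in> hom C W (Dom C (idm C X \<otimes>\<^sub>m i)) \<and> (idm C X \<otimes>\<^sub>m i) \<cdot> h = u \<and> prr C X (Dom C i) \<cdot> h = v"
      then have h: "Dom C h = W" "Cod C h = X \<otimes> Dom C i" "(idm C X \<otimes>\<^sub>m i) \<cdot> h = u" "prr C X (Dom C i) \<cdot> h = v"
        by (auto simp: hom_iff)
      have "prl C X (Y \<oplus> Z) \<cdot> u = prl C X (Dom C i) \<cdot> h"
        using h d i by (simp add: h(3)[symmetric] prod_map_def)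
      then show "h = pairing C (prl C X (Y \<oplus> Z) \<cdot> u) v"
        using h by (simp add: h(4)[symmetric])
    qed
  qed (use i in auto)
  let ?c = "\<lambda>k::nat. if k = 0 then inl C Y Z else inr C Y Z"
  have c: "is_coproduct C {0, 1} (Y \<oplus> Z) ?c"
    using coproduct(1) by (simp add: is_binary_coproduct_iff)
  have l: "is_pullback C (idm C X \<otimes>\<^sub>m inl C Y Z) (prr C X Y) (prr C X (Y \<oplus> Z)) (inl C Y Z)"
    using pb[of "inl C Y Z", OF cod_inl] inl_cancel by (metis dom_inl)
  have r: "is_pullback C (idm C X \<otimes>\<^sub>m inr C Y Z) (prr C X Z) (prr C X (Y \<oplus> Z)) (inr C Y Z)"
    using pb[of "inr C Y Z", OF cod_inr] inr_cancel by (metis dom_inr)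
  show ?thesis unfolding is_binary_coproduct_iff
    by (rule coproducts_universal[OF c, of "prr C X (Y \<oplus> Z)" _ _ "\<lambda>k. if k = 0 then prr C X Y else prr C X Z"])
      (use l r in \<open>simp_all add: hom_iff\<close>)
qed

text \<open>As \<open>dist\<close> is a definite description, uniqueness is needed besides the
  inverse \<open>h\<close> read off from \<open>prod_coproduct\<close>: any other inverse
  \<open>h'\<close> equals \<open>h' \<cdot> (?k \<cdot> h)\<close>, hence \<open>h\<close>.\<close>

lemma dist_inverse: "is_inverse C \<lblot>idm C X \<otimes>\<^sub>m inl C Y Z, idm C X \<otimes>\<^sub>m inr C Y Z\<rblot> (dist C X Y Z)"
proof -
  let ?k = "\<lblot>idm C X \<otimes>\<^sub>m inl C Y Z, idm C X \<otimes>\<^sub>m inr C Y Z\<rblot>"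
  have k: "Dom C ?k = X \<otimes> Y \<oplus> X \<otimes> Z" "Cod C ?k = X \<otimes> (Y \<oplus> Z)" by auto
  obtain h where h: "Dom C h = X \<otimes> (Y \<oplus> Z)" "Cod C h = X \<otimes> Y \<oplus> X \<otimes> Z"
    "h \<cdot> (idm C X \<otimes>\<^sub>m inl C Y Z) = inl C (X \<otimes> Y) (X \<otimes> Z)" "h \<cdot> (idm C X \<otimes>\<^sub>m inr C Y Z) = inr C (X \<otimes> Y) (X \<otimes> Z)"
    by (rule is_binary_coproduct_copair[OF prod_coproduct, of "inl C (X \<otimes> Y) (X \<otimes> Z)" X Y Z "inr C (X \<otimes> Y) (X \<otimes> Z)"]) auto
  have "?k \<cdot> h = idm C (X \<otimes> (Y \<oplus> Z))"
    by (rule is_binary_coproduct_eq[OF prod_coproduct[of X Y Z]]) (use h in auto)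
  moreover have "h \<cdot> ?k = idm C (X \<otimes> Y \<oplus> X \<otimes> Z)" using h by simp
  ultimately have inv: "is_inverse C ?k h" using h k by (simp add: is_inverse_def hom_iff)
  show ?thesis unfolding dist_def
  proof (rule theI[of _ h])
    fix h' assume "is_inverse C ?k h'"
    then have h': "Dom C h' = X \<otimes> (Y \<oplus> Z)" "Cod C h' = X \<otimes> Y \<oplus> X \<otimes> Z" "h' \<cdot> ?k = idm C (X \<otimes> Y \<oplus> X \<otimes> Z)"
      by (auto simp: is_inverse_def hom_iff)
    have "h' = h' \<cdot> (?k \<cdot> h)" using inv h' k by (simp add: is_inverse_def hom_iff)
    also have "\<dots> = (h' \<cdot> ?k) \<cdot> h" using assoc[of h ?k h'] h h' k by metis
    finally show "h' = h" using h h' by simp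
  qed (rule inv)
qed

lemma dom_dist [simp]: "Dom C (dist C X Y Z) = X \<otimes> (Y \<oplus> Z)"
  and cod_dist [simp]: "Cod C (dist C X Y Z) = X \<otimes> Y \<oplus> X \<otimes> Z"
  using dist_inverse[of X Y Z] by (auto simp: is_inverse_def hom_iff)

lemma dist_prod_map_inl [simp]: "dist C X Y Z \<cdot> (idm C X \<otimes>\<^sub>m inl C Y Z) = inl C (X \<otimes> Y) (X \<otimes> Z)"
  and dist_prod_map_inr [simp]: "dist C X Y Z \<cdot> (idm C X \<otimes>\<^sub>m inr C Y Z) = inr C (X \<otimes> Y) (X \<otimes> Z)"
proof -
  let ?k = "\<lblot>idm C X \<otimes>\<^sub>m inl C Y Z, idm C X \<otimes>\<^sub>m inr C Y Z\<rblot>"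
  have k: "dist C X Y Z \<cdot> ?k = idm C (X \<otimes> Y \<oplus> X \<otimes> Z)"
    using dist_inverse[of X Y Z] by (simp add: is_inverse_def del: cmp_copair)
  show "dist C X Y Z \<cdot> (idm C X \<otimes>\<^sub>m inl C Y Z) = inl C (X \<otimes> Y) (X \<otimes> Z)"
    using cmp_eq[OF k, of "inl C (X \<otimes> Y) (X \<otimes> Z)"] by (simp del: cmp_copair)
  show "dist C X Y Z \<cdot> (idm C X \<otimes>\<^sub>m inr C Y Z) = inr C (X \<otimes> Y) (X \<otimes> Z)"
    using cmp_eq[OF k, of "inr C (X \<otimes> Y) (X \<otimes> Z)"] by (simp del: cmp_copair)
qed

lemma dist_pairing_inl [simp]:
  assumes "Dom C a = Dom C y" "Cod C a = X" "Cod C y = Y"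
  shows "dist C X Y Z \<cdot> pairing C a (inl C Y Z \<cdot> y) = inl C (X \<otimes> Y) (X \<otimes> Z) \<cdot> pairing C a y"
  using cmp_eq[OF dist_prod_map_inl[of X Y Z], of "pairing C a y"] assms by simp

lemma dist_pairing_inr [simp]:
  assumes "Dom C a = Dom C y" "Cod C a = X" "Cod C y = Z"
  shows "dist C X Y Z \<cdot> pairing C a (inr C Y Z \<cdot> y) = inr C (X \<otimes> Y) (X \<otimes> Z) \<cdot> pairing C a y"
  using cmp_eq[OF dist_prod_map_inr[of X Y Z], of "pairing C a y"] assms by simp

lemma pairing_prl_prr [simp]: "pairing C (prl C X Y) (prr C X Y) = idm C (X \<otimes> Y)"
  using pairing_eta[of "idm C (X \<otimes> Y)" X Y] by simp

text \<open>The injections of \<open>prod_coproduct\<close> are spelled out as pairings, the shape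
  on which the simplification rules for \<open>dist\<close> and the strength compute.\<close>

lemma prod_sum_ext:
  assumes "Dom C a = X \<otimes> (Y \<oplus> Z)" "Dom C b = X \<otimes> (Y \<oplus> Z)" "Cod C a = Cod C b"
    and "a \<cdot> pairing C (prl C X Y) (inl C Y Z \<cdot> prr C X Y) = b \<cdot> pairing C (prl C X Y) (inl C Y Z \<cdot> prr C X Y)"
    and "a \<cdot> pairing C (prl C X Z) (inr C Y Z \<cdot> prr C X Z) = b \<cdot> pairing C (prl C X Z) (inr C Y Z \<cdot> prr C X Z)"
  shows "a = b"
  by (rule is_binary_coproduct_eq[OF prod_coproduct assms(1-3)]) (use assms in \<open>simp_all add: prod_map_def\<close>)

section \<open>The monad \<open>X \<oplus> \<one>\<close>\<close>

lemma L_sel [simp]: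
  "Tob (L_monad C) X = X \<oplus> \<one>" "eta (L_monad C) X = inl C X \<one>"
  "ext (L_monad C) Y f = \<lblot>f, inr C Y \<one>\<rblot>"
  by (simp_all add: L_monad_def)

lemma dom_L_str [simp]: "Dom C (str (L_monad C) X Y) = X \<otimes> (Y \<oplus> \<one>)"
  and cod_L_str [simp]: "Cod C (str (L_monad C) X Y) = X \<otimes> Y \<oplus> \<one>"
  by (simp_all add: L_monad_def)

lemma L_str_inl [simp]:
  "Dom C a = Dom C y \<Longrightarrow> Cod C a = X \<Longrightarrow> Cod C y = Y \<Longrightarrow>
    str (L_monad C) X Y \<cdot> pairing C a (inl C Y \<one> \<cdot> y) = inl C (X \<otimes> Y) \<one> \<cdot> pairing C a y"
  by (simp add: L_monad_def sum_map_def)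

lemma L_str_inr [simp]:
  "Dom C a = Dom C y \<Longrightarrow> Cod C a = X \<Longrightarrow> Cod C y = \<one> \<Longrightarrow>
    str (L_monad C) X Y \<cdot> pairing C a (inr C Y \<one> \<cdot> y) = inr C (X \<otimes> Y) \<one> \<cdot> y"
  by (simp add: L_monad_def sum_map_def) (rule arg_cong[where f="\<lambda>z. inr C (X \<otimes> Y) \<one> \<cdot> z"], rule to_terminal_eq, auto)

lemma L_Tmap [simp]: "Dom C f = X \<Longrightarrow> Cod C f = Y \<Longrightarrow> Tmap C (L_monad C) f = \<lblot>inl C Y \<one> \<cdot> f, inr C Y \<one>\<rblot>"
  by (simp add: Tmap_def)

text \<open>Apart from \<open>str_eta\<close>, the strength equations are compared on the two
  summands of a product with a sum, where \<open>L_str_inl\<close> and \<open>L_str_inr\<close>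
  evaluate both sides.\<close>

lemma L_strong_monad: "strong_monad C (L_monad C)"
proof
  fix X X' Y Y' Z f g
  show "eta (L_monad C) X \<in> hom C X (Tob (L_monad C) X)" by (simp add: hom_iff)
  show "f \<in> hom C X (Tob (L_monad C) Y) \<Longrightarrow> ext (L_monad C) Y f \<in> hom C (Tob (L_monad C) X) (Tob (L_monad C) Y)"
    by (simp add: hom_iff)
  show "ext (L_monad C) X (eta (L_monad C) X) = idm C (Tob (L_monad C) X)" by simp
  show "f \<in> hom C X (Tob (L_monad C) Y) \<Longrightarrow> ext (L_monad C) Y f \<cdot> eta (L_monad C) X = f"
    by (simp add: hom_iff)
  show "f \<in> hom C X (Tob (L_monad C) Y) \<Longrightarrow> g \<in> hom C Y (Tob (L_monad C) Z) \<Longrightarrow>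
      ext (L_monad C) Z (ext (L_monad C) Z g \<cdot> f) = ext (L_monad C) Z g \<cdot> ext (L_monad C) Y f"
    by (simp add: hom_iff)
  show "str (L_monad C) X Y \<in> hom C (X \<otimes> Tob (L_monad C) Y) (Tob (L_monad C) (X \<otimes> Y))"
    by (simp add: hom_iff)
  show "f \<in> hom C X X' \<Longrightarrow> g \<in> hom C Y Y' \<Longrightarrow>
      str (L_monad C) X' Y' \<cdot> (f \<otimes>\<^sub>m Tmap C (L_monad C) g) = Tmap C (L_monad C) (f \<otimes>\<^sub>m g) \<cdot> str (L_monad C) X Y"
    by (rule prod_sum_ext[of _ X Y \<one>]) (auto simp: hom_iff prod_map_def)
  show "Tmap C (L_monad C) (prr C \<one> Y) \<cdot> str (L_monad C) \<one> Y = prr C \<one> (Tob (L_monad C) Y)"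
    by (rule prod_sum_ext[of _ \<one> Y \<one>]) auto
  show "Tmap C (L_monad C) (prod_assoc C X Y Z) \<cdot> str (L_monad C) (X \<otimes> Y) Z
      = str (L_monad C) X (Y \<otimes> Z) \<cdot> (idm C X \<otimes>\<^sub>m str (L_monad C) Y Z) \<cdot> prod_assoc C X Y (Tob (L_monad C) Z)"
    by (rule prod_sum_ext[of _ "X \<otimes> Y" Z \<one>]) (auto simp: prod_assoc_def prod_map_def)
  show "str (L_monad C) X Y \<cdot> (idm C X \<otimes>\<^sub>m eta (L_monad C) Y) = eta (L_monad C) (X \<otimes> Y)"
    by (simp add: prod_map_def)
  show "str (L_monad C) X Y \<cdot> (idm C X \<otimes>\<^sub>m ext (L_monad C) Y (idm C (Tob (L_monad C) Y)))
      = ext (L_monad C) (X \<otimes> Y) (str (L_monad C) X Y) \<cdot> str (L_monad C) X (Tob (L_monad C) Y)"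
    by (rule prod_sum_ext[of _ X "Y \<oplus> \<one>" \<one>]) (auto simp: prod_map_def)
qed

section \<open>The extension order on elements\<close>

lemma L_leD:
  assumes "L_le C Y f g" "f \<cdot> w = inl C Y \<one> \<cdot> y" "Cod C w = Dom C f" "Cod C y = Y" "Dom C y = Dom C w"
    "Dom C g = Dom C f" "Cod C f = Y \<oplus> \<one>" "Cod C g = Y \<oplus> \<one>"
  shows "g \<cdot> w = inl C Y \<one> \<cdot> y"
proof -
  obtain d p d' p' where c: "corresponds C Y f d p" "corresponds C Y g d' p'" "span_le C d p d' p'"
    using assms(1) unfolding L_le_def by blast
  obtain e where e: "is_binary_coproduct C (Dom C f) d e" "p \<in> hom C (Dom C d) Y" "f \<cdot> d = inl C Y \<one> \<cdot> p"
      "f \<cdot> e = inr C Y \<one> \<cdot> bang C (Dom C e)"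
    using c(1) unfolding corresponds_def summand_partial_def by blast
  then have d: "is_binary_coproduct C (Dom C f) d e" "Dom C p = Dom C d" "Cod C p = Y" "f \<cdot> d = inl C Y \<one> \<cdot> p"
      "f \<cdot> e = inr C Y \<one> \<cdot> bang C (Dom C e)" by (simp_all add: hom_iff)
  have "Cod C d' = Dom C g" "p' \<in> hom C (Dom C d') Y" "g \<cdot> d' = inl C Y \<one> \<cdot> p'"
    using c(2) unfolding corresponds_def summand_partial_def by blast+
  then have d': "Cod C d' = Dom C g" "Dom C p' = Dom C d'" "Cod C p' = Y" "g \<cdot> d' = inl C Y \<one> \<cdot> p'"
    by (simp_all add: hom_iff)
  obtain m where "m \<in> hom C (Dom C d) (Dom C d')" "d' \<cdot> m = d" "p' \<cdot> m = p"
    using c(3) unfolding span_le_def by blast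
  then have m: "Dom C m = Dom C d" "Cod C m = Dom C d'" "d' \<cdot> m = d" "p' \<cdot> m = p" by (simp_all add: hom_iff)
  have cods: "Cod C d = Dom C f" "Cod C e = Dom C f"
    using is_binary_coproduct_cod[OF d(1)] by auto
  have gd: "g \<cdot> d = inl C Y \<one> \<cdot> p"
    using cmp_eq_cmp[OF d'(4), of m] d' m assms by simp
  \<comment> \<open>\<open>w\<close> is not known to factor through the domain \<open>d\<close> of
    the span of \<open>f\<close>, so it is split along \<open>d\<close> and its complement
    \<open>e\<close>. On the part in \<open>e\<close>, the arrow \<open>f\<close> would have both a
    left and a right value.\<close>
  have S: "is_binary_coproduct C (Cod C w) d e" using d(1) assms(3) by simp
  show ?thesis
  proof (rule binary_cases_eq[OF S])
    fix v t assume v: "Cod C v = Dom C w" "Cod C t = Dom C d" "Dom C t = Dom C v" "w \<cdot> v = d \<cdot> t"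
    have "inl C Y \<one> \<cdot> (p \<cdot> t) = inl C Y \<one> \<cdot> (y \<cdot> v)"
      using cmp_eq_cmp[OF assms(2), of v] cmp_eq_cmp[OF d(4), of t] v d cods assms by simp
    then show "(g \<cdot> w) \<cdot> v = (inl C Y \<one> \<cdot> y) \<cdot> v"
      using cmp_eq_cmp[OF gd, of t] v d cods assms by simp
  next
    fix v t assume v: "Cod C v = Dom C w" "Cod C t = Dom C e" "Dom C t = Dom C v" "w \<cdot> v = e \<cdot> t"
    have "inl C Y \<one> \<cdot> (y \<cdot> v) = inr C Y \<one> \<cdot> bang C (Dom C v)"
      using cmp_eq_cmp[OF assms(2), of v] cmp_eq_cmp[OF d(5), of t] v d cods assms by simp
    then show "(g \<cdot> w) \<cdot> v = (inl C Y \<one> \<cdot> y) \<cdot> v"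
      by (rule inl_inr_eq) (use v(1-3) cods assms in auto)
  qed (use assms in auto)
qed

text \<open>Taking the pullback of \<open>inl\<close> as the domain of the span makes every element
  on which \<open>f\<close> is defined factor through it.\<close>

lemma corresponds_split:
  assumes "Cod C f = Y \<oplus> \<one>"
  obtains d p where "corresponds C Y f d p" "is_pullback C d p f (inl C Y \<one>)"
proof -
  obtain d p e q where d: "is_binary_coproduct C (Dom C f) d e" "is_pullback C d p f (inl C Y \<one>)" "is_pullback C e q f (inr C Y \<one>)"
    by (rule split[of f "inl C Y \<one>" "inr C Y \<one>"]) (use assms coproduct(1) in auto)
  have "q = bang C (Dom C e)"
    by (rule to_terminal_eq) (use is_pullback_cods[OF d(3)] in auto)
  then have "corresponds C Y f d p"
    using d(1) is_pullback_cods[OF d(2)] is_pullback_cods[OF d(3)]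
    unfolding corresponds_def summand_partial_def coproduct_injection_def by (auto simp: hom_iff)
  then show thesis using d that by blast
qed

text \<open>The hypothesis is applied to the domain \<open>d\<close> of \<open>f\<close> itself; the
  pullback property of the domain of \<open>g\<close> then yields the inclusion \<open>m\<close> of
  spans.\<close>

lemma L_leI:
  assumes "Dom C g = Dom C f" "Cod C f = Y \<oplus> \<one>" "Cod C g = Y \<oplus> \<one>"
    and le: "\<And>w y. Cod C w = Dom C f \<Longrightarrow> Cod C y = Y \<Longrightarrow> Dom C y = Dom C w \<Longrightarrow>
      f \<cdot> w = inl C Y \<one> \<cdot> y \<Longrightarrow> g \<cdot> w = inl C Y \<one> \<cdot> y"
  shows "L_le C Y f g"
proof -
  obtain d p where d: "corresponds C Y f d p" "is_pullback C d p f (inl C Y \<one>)"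
    by (rule corresponds_split[OF assms(2)])
  obtain d' p' where d': "corresponds C Y g d' p'" "is_pullback C d' p' g (inl C Y \<one>)"
    by (rule corresponds_split[OF assms(3)])
  note pb = is_pullback_cods[OF d(2)]
  have "g \<cdot> d = inl C Y \<one> \<cdot> p" by (rule le) (use pb in simp_all)
  then obtain m where "Dom C m = Dom C p" "Cod C m = Dom C d'" "d' \<cdot> m = d" "p' \<cdot> m = p"
    by (rule is_pullbackE[OF d'(2)]) (use pb(1-3) assms(1,3) in simp_all)
  then have "span_le C d p d' p'" unfolding span_le_def using pb(1) by (intro bexI[of _ m]) (simp_all add: hom_iff)
  then show ?thesis using d(1) d'(1) unfolding L_le_def by blast
qed

text \<open>The order compares defined values only, so the part where \<open>f\<close> is undefined
  is split again by \<open>g\<close>: a value of \<open>g\<close> is a value of \<open>f\<close> by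
  the second hypothesis, and two undefined results agree because \<open>\<one>\<close> is
  terminal.\<close>

lemma L_le_antisym:
  assumes "L_le C Y f g" "L_le C Y g f" "Dom C g = Dom C f" "Cod C f = Y \<oplus> \<one>" "Cod C g = Y \<oplus> \<one>"
  shows "f = g"
proof (rule sum_cases_eq[OF assms(4)])
  fix w y assume w: "Cod C w = Dom C f" "Cod C y = Y" "Dom C y = Dom C w" "f \<cdot> w = inl C Y \<one> \<cdot> y"
  then show "f \<cdot> w = g \<cdot> w" using L_leD[OF assms(1) w(4)] assms by simp
next
  fix w z assume w: "Cod C w = Dom C f" "Cod C z = \<one>" "Dom C z = Dom C w" "f \<cdot> w = inr C Y \<one> \<cdot> z"
  show "f \<cdot> w = g \<cdot> w"
  proof (rule sum_cases_eq[of "g \<cdot> w" Y \<one>])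
    fix v y assume v: "Cod C v = Dom C (g \<cdot> w)" "Cod C y = Y" "Dom C y = Dom C v" "(g \<cdot> w) \<cdot> v = inl C Y \<one> \<cdot> y"
    have "f \<cdot> (w \<cdot> v) = inl C Y \<one> \<cdot> y"
      by (rule L_leD[OF assms(2)]) (use v w assms in auto)
    then show "(f \<cdot> w) \<cdot> v = (g \<cdot> w) \<cdot> v" using v w(1-3) assms by simp
  next
    fix v y assume v: "Cod C v = Dom C (g \<cdot> w)" "Cod C y = \<one>" "Dom C y = Dom C v" "(g \<cdot> w) \<cdot> v = inr C Y \<one> \<cdot> y"
    have "y = z \<cdot> v" by (rule to_terminal_eq) (use v w assms in auto)
    then show "(f \<cdot> w) \<cdot> v = (g \<cdot> w) \<cdot> v"
      using cmp_eq_cmp[OF w(4), of v] v w assms by simp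
  qed (use w assms in auto)
qed (use assms in auto)

lemma L_le_refl: "Cod C f = Y \<oplus> \<one> \<Longrightarrow> L_le C Y f f"
  by (rule L_leI) auto

lemma L_le_trans:
  assumes "L_le C Y f g" "L_le C Y g h" "Dom C g = Dom C f" "Dom C h = Dom C f"
    "Cod C f = Y \<oplus> \<one>" "Cod C g = Y \<oplus> \<one>" "Cod C h = Y \<oplus> \<one>"
  shows "L_le C Y f h"
proof (rule L_leI)
  fix w y assume w: "Cod C w = Dom C f" "Cod C y = Y" "Dom C y = Dom C w" "f \<cdot> w = inl C Y \<one> \<cdot> y"
  have "g \<cdot> w = inl C Y \<one> \<cdot> y" by (rule L_leD[OF assms(1)]) (use w assms in auto)
  then show "h \<cdot> w = inl C Y \<one> \<cdot> y" by (rule L_leD[OF assms(2)]) (use w assms in auto)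
qed (use assms in auto)

lemma L_bot_le:
  assumes "Cod C f = Y \<oplus> \<one>" "Dom C f = X"
  shows "L_le C Y (inr C Y \<one> \<cdot> bang C X) f"
proof (rule L_leI)
  fix w y assume w: "Cod C w = Dom C (inr C Y \<one> \<cdot> bang C X)" "Cod C y = Y" "Dom C y = Dom C w"
    "(inr C Y \<one> \<cdot> bang C X) \<cdot> w = inl C Y \<one> \<cdot> y"
  then have "inl C Y \<one> \<cdot> y = inr C Y \<one> \<cdot> bang C (Dom C w)" by simp
  then show "f \<cdot> w = inl C Y \<one> \<cdot> y"
    by (rule inl_inr_eq) (use w assms in auto)
qed (use assms in auto)

text \<open>With bottoms given by an explicit formula, the laws \<open>str_bottom\<close> and
  \<open>ext_bottom\<close> for this monad become equations settled by rewriting.\<close>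

lemma L_is_bottom_iff: "is_bottom (hom C X (Y \<oplus> \<one>)) (L_le C Y) b \<longleftrightarrow> b = inr C Y \<one> \<cdot> bang C X"
proof
  assume "b = inr C Y \<one> \<cdot> bang C X"
  then show "is_bottom (hom C X (Y \<oplus> \<one>)) (L_le C Y) b"
    by (auto simp: is_bottom_def hom_iff intro: L_bot_le)
next
  assume b: "is_bottom (hom C X (Y \<oplus> \<one>)) (L_le C Y) b"
  then have d: "Dom C b = X" "Cod C b = Y \<oplus> \<one>" by (auto simp: is_bottom_def hom_iff)
  have "L_le C Y b (inr C Y \<one> \<cdot> bang C X)" using b by (simp add: is_bottom_def hom_iff)
  then show "b = inr C Y \<one> \<cdot> bang C X"
    by (rule L_le_antisym) (use d L_bot_le in auto)
qed

text \<open>The pullback asked for by \<open>disjoint_arrows\<close> exists because \<open>g\<close>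
  is a coproduct injection, so only elements common to \<open>f\<close> and \<open>g\<close> have to
  be examined.\<close>

lemma disjoint_arrowsI:
  assumes g: "coproduct_injection C g" and cod: "Cod C f = Cod C g"
    and ini: "\<And>a b. Cod C a = Dom C f \<Longrightarrow> Cod C b = Dom C g \<Longrightarrow> Dom C b = Dom C a \<Longrightarrow> f \<cdot> a = g \<cdot> b \<Longrightarrow>
      is_initial C (Dom C a)"
  shows "disjoint_arrows C f g"
proof -
  obtain h where "is_binary_coproduct C (Cod C f) g h" using g cod by (auto simp: coproduct_injection_def)
  then obtain d p where "is_pullback C d p f g" by (rule split)
  moreover have "is_initial C (Dom C d)"
    using ini[of d p] is_pullback_cods[OF \<open>is_pullback C d p f g\<close>] by simp
  ultimately show ?thesis unfolding disjoint_arrows_def by blast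
qed

section \<open>Suprema of chains and their covering principle\<close>

lemma L_chain_le:
  assumes "omega_chain (hom C X (Y \<oplus> \<one>)) (L_le C Y) F" "i \<le> j"
  shows "L_le C Y (F i) (F j)"
proof -
  have F: "Dom C (F i) = X" "Cod C (F i) = Y \<oplus> \<one>" "L_le C Y (F i) (F (Suc i))" for i
    using assms(1) by (simp_all add: omega_chain_def hom_iff)
  show ?thesis using assms(2)
  proof (induction rule: dec_induct)
    case base show ?case by (rule L_le_refl) (rule F)
  next
    case (step n) show ?case by (rule L_le_trans[OF step.IH F(3)]) (simp_all add: F)
  qed
qed

text \<open>The least upper bound of a chain is total on \<open>w\<close> exactly if \<open>w\<close> is covered by the domains of the
  members of the chain. This covering principle is stated in terms of equality of arrows.\<close>

lemma L_is_lubI: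
  assumes F: "\<And>i. F i \<in> hom C X (Y \<oplus> \<one>)" and s: "s \<in> hom C X (Y \<oplus> \<one>)"
    and ub: "\<And>i. L_le C Y (F i) s"
    and cover: "\<And>w y a b. Cod C w = X \<Longrightarrow> Cod C y = Y \<Longrightarrow> Dom C y = Dom C w \<Longrightarrow> s \<cdot> w = inl C Y \<one> \<cdot> y \<Longrightarrow>
      Dom C a = Dom C w \<Longrightarrow> Dom C b = Dom C w \<Longrightarrow> Cod C a = Cod C b \<Longrightarrow>
      (\<And>i v y'. Cod C v = Dom C w \<Longrightarrow> Cod C y' = Y \<Longrightarrow> Dom C y' = Dom C v \<Longrightarrow>
        F i \<cdot> (w \<cdot> v) = inl C Y \<one> \<cdot> y' \<Longrightarrow> a \<cdot> v = b \<cdot> v) \<Longrightarrow> a = b"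
  shows "is_lub (hom C X (Y \<oplus> \<one>)) (L_le C Y) F s"
  unfolding is_lub_def
proof (intro conjI allI ballI impI)
  fix u assume u: "u \<in> hom C X (Y \<oplus> \<one>)" "\<forall>i. L_le C Y (F i) u"
  have d: "Dom C (F i) = X" "Cod C (F i) = Y \<oplus> \<one>" "Dom C s = X" "Cod C s = Y \<oplus> \<one>" "Dom C u = X" "Cod C u = Y \<oplus> \<one>" for i
    using F[of i] s u(1) by (simp_all add: hom_iff)
  show "L_le C Y s u"
  proof (rule L_leI)
    fix w y assume w: "Cod C w = Dom C s" "Cod C y = Y" "Dom C y = Dom C w" "s \<cdot> w = inl C Y \<one> \<cdot> y"
    show "u \<cdot> w = inl C Y \<one> \<cdot> y"
    proof (rule cover[OF _ w(2-4)])
      fix i v y' assume v: "Cod C v = Dom C w" "Cod C y' = Y" "Dom C y' = Dom C v" "F i \<cdot> (w \<cdot> v) = inl C Y \<one> \<cdot> y'"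
      have "s \<cdot> (w \<cdot> v) = inl C Y \<one> \<cdot> y'"
        by (rule L_leD[OF ub v(4)]) (use v(1-3) w(1-3) d in simp_all)
      moreover have "u \<cdot> (w \<cdot> v) = inl C Y \<one> \<cdot> y'"
        by (rule L_leD[OF u(2)[rule_format] v(4)]) (use v(1-3) w(1-3) d in simp_all)
      ultimately show "(u \<cdot> w) \<cdot> v = (inl C Y \<one> \<cdot> y) \<cdot> v"
        using cmp_eq_cmp[OF w(4), of v] v(1) w(1-3) d by simp
    qed (use w(1-3) d in simp_all)
  qed (simp_all add: d)
qed (use s ub in simp_all)

text \<open>The domains of the \<open>F i\<close> increase, while the axiom on unions joins only
  disjoint summands, so the domains are replaced by their successive differences. What is obtained
  is the input of \<open>L_is_lubI\<close>; the covering principle is kept for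
  \<open>L_lub_cover\<close>.\<close>

lemma L_lub_exists:
  assumes ch: "omega_chain (hom C X (Y \<oplus> \<one>)) (L_le C Y) F"
  obtains s where "s \<in> hom C X (Y \<oplus> \<one>)" "\<And>i. L_le C Y (F i) s"
    "\<And>w y a b. Cod C w = X \<Longrightarrow> Cod C y = Y \<Longrightarrow> Dom C y = Dom C w \<Longrightarrow> s \<cdot> w = inl C Y \<one> \<cdot> y \<Longrightarrow>
      Dom C a = Dom C w \<Longrightarrow> Dom C b = Dom C w \<Longrightarrow> Cod C a = Cod C b \<Longrightarrow>
      (\<And>i v y'. Cod C v = Dom C w \<Longrightarrow> Cod C y' = Y \<Longrightarrow> Dom C y' = Dom C v \<Longrightarrow>
        F i \<cdot> (w \<cdot> v) = inl C Y \<one> \<cdot> y' \<Longrightarrow> a \<cdot> v = b \<cdot> v) \<Longrightarrow> a = b"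
proof -
  have F: "Dom C (F i) = X" "Cod C (F i) = Y \<oplus> \<one>" for i
    using ch by (simp_all add: omega_chain_def hom_iff)
  have le: "L_le C Y (F i) (F j)" if "i \<le> j" for i j by (rule L_chain_le[OF ch that])
  have "\<forall>i. \<exists>d p e q. is_binary_coproduct C X d e \<and> is_pullback C d p (F i) (inl C Y \<one>) \<and> is_pullback C e q (F i) (inr C Y \<one>)"
  proof
    fix i
    have "is_binary_coproduct C (Cod C (F i)) (inl C Y \<one>) (inr C Y \<one>)" using coproduct(1) F by simp
    then obtain d p e q where "is_binary_coproduct C (Dom C (F i)) d e" "is_pullback C d p (F i) (inl C Y \<one>)" "is_pullback C e q (F i) (inr C Y \<one>)"
      by (rule split)
    then show "\<exists>d p e q. is_binary_coproduct C X d e \<and> is_pullback C d p (F i) (inl C Y \<one>) \<and> is_pullback C e q (F i) (inr C Y \<one>)"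
      using F(1) by auto
  qed
  then obtain d p e q where d: "\<And>i. is_binary_coproduct C X (d i) (e i)"
    "\<And>i. is_pullback C (d i) (p i) (F i) (inl C Y \<one>)" "\<And>i. is_pullback C (e i) (q i) (F i) (inr C Y \<one>)"
    by metis
  have dp: "Dom C (p i) = Dom C (d i)" "Cod C (d i) = X" "Cod C (p i) = Y" "F i \<cdot> d i = inl C Y \<one> \<cdot> p i" for i
    using is_pullback_cods[OF d(2)[of i]] F by simp_all
  have eq: "Dom C (q i) = Dom C (e i)" "Cod C (e i) = X" "Cod C (q i) = \<one>" "F i \<cdot> e i = inr C Y \<one> \<cdot> q i" for i
    using is_pullback_cods[OF d(3)[of i]] F by simp_all
  have "\<forall>i. \<exists>d p e'. is_binary_coproduct C (Dom C (e i)) d e' \<and> is_pullback C d p (F (Suc i) \<cdot> e i) (inl C Y \<one>)"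
  proof
    fix i
    have "is_binary_coproduct C (Cod C (F (Suc i) \<cdot> e i)) (inl C Y \<one>) (inr C Y \<one>)" using coproduct(1) F eq by simp
    then obtain d p e' where "is_binary_coproduct C (Dom C (F (Suc i) \<cdot> e i)) d e'" "is_pullback C d p (F (Suc i) \<cdot> e i) (inl C Y \<one>)"
      by (rule split)
    then show "\<exists>d p e'. is_binary_coproduct C (Dom C (e i)) d e' \<and> is_pullback C d p (F (Suc i) \<cdot> e i) (inl C Y \<one>)"
      using F eq by auto
  qed
  then obtain d' p' e' where d': "\<And>i. is_binary_coproduct C (Dom C (e i)) (d' i) (e' i)"
    "\<And>i. is_pullback C (d' i) (p' i) (F (Suc i) \<cdot> e i) (inl C Y \<one>)"
    by metis
  have dp': "Dom C (p' i) = Dom C (d' i)" "Cod C (d' i) = Dom C (e i)" "Cod C (p' i) = Y" "F (Suc i) \<cdot> (e i \<cdot> d' i) = inl C Y \<one> \<cdot> p' i" for i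
    using is_pullback_cods[OF d'(2)[of i]] F eq by simp_all
  \<comment> \<open>\<open>c 0\<close> is the domain of \<open>F 0\<close>, and
    \<open>c (Suc j)\<close> is the part of the complement \<open>e j\<close> of the domain of
    \<open>F j\<close> on which \<open>F (Suc j)\<close> is defined. \<open>P i\<close> is the value
    of \<open>F i\<close> on the piece \<open>c i\<close>.\<close>
  define c where "c i = (case i of 0 \<Rightarrow> d 0 | Suc j \<Rightarrow> e j \<cdot> d' j)" for i
  define P where "P i = (case i of 0 \<Rightarrow> p 0 | Suc j \<Rightarrow> p' j)" for i
  have c: "Cod C (c i) = X" "Dom C (P i) = Dom C (c i)" "Cod C (P i) = Y" "F i \<cdot> c i = inl C Y \<one> \<cdot> P i"
      "coproduct_injection C (c i)" for i
  proof -
    show "coproduct_injection C (c i)"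
    proof (cases i)
      case 0 show ?thesis unfolding 0 c_def coproduct_injection_def using d(1)[of 0] dp(2)[of 0] by auto
    next
      case (Suc j) show ?thesis unfolding Suc c_def using coproduct_injection_cmp[OF d(1) d'(1)] by simp
    qed
  qed (cases i; simp add: c_def P_def dp dp' eq)+
  \<comment> \<open>Let \<open>j = Suc k\<close>. On a common element of the two pieces
    \<open>F k\<close> is defined, because \<open>i \<le> k\<close>, and undefined, because the
    piece \<open>c j\<close> lies inside \<open>e k\<close>.\<close>
  have ini: "is_initial C (Dom C a)"
    if ij: "i < j" and a: "Cod C a = Dom C (c i)" "Cod C b = Dom C (c j)" "Dom C b = Dom C a" "c i \<cdot> a = c j \<cdot> b" for i j a b
  proof -
    obtain k where k: "j = Suc k" "i \<le> k" using ij by (cases j) auto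
    have "F k \<cdot> (c i \<cdot> a) = inl C Y \<one> \<cdot> (P i \<cdot> a)"
      by (rule L_leD[OF le[OF k(2)]]) (use a(1-3) c cmp_eq_cmp[OF c(4)[of i], of a] F in simp_all)
    moreover have "F k \<cdot> (c j \<cdot> b) = inr C Y \<one> \<cdot> (q k \<cdot> (d' k \<cdot> b))"
    proof -
      have "Cod C b = Dom C (d' k)" using a(2) k dp' eq by (simp add: c_def)
      then show ?thesis using cmp_eq_cmp[OF eq(4)[of k], of "d' k \<cdot> b"] k dp' eq F by (simp add: c_def)
    qed
    ultimately have e: "inl C Y \<one> \<cdot> (P i \<cdot> a) = inr C Y \<one> \<cdot> (q k \<cdot> (d' k \<cdot> b))" using a(4) by simp
    have b: "Cod C b = Dom C (d' k)" using a(2) k dp' eq by (simp add: c_def)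
    have "is_initial C (Dom C (q k \<cdot> (d' k \<cdot> b)))"
      by (rule injections_disjoint[OF coproduct(1) e]) (use a(1-3) b c dp' eq in simp_all)
    then show ?thesis using a(3) b dp' eq by simp
  qed
  have disj: "disjoint_arrows C (c i) (c j)" if "i \<noteq> j" for i j
  proof (rule disjoint_arrowsI[OF c(5)])
    fix a b assume a: "Cod C a = Dom C (c i)" "Cod C b = Dom C (c j)" "Dom C b = Dom C a" "c i \<cdot> a = c j \<cdot> b"
    show "is_initial C (Dom C a)"
      using that ini[where i = i and j = j and a = a and b = b] ini[where i = j and j = i and a = b and b = a] a by (cases "i < j") simp_all
  qed (simp add: c)
  obtain S s where S: "is_coproduct C (UNIV :: nat set) S s" "\<And>i. Dom C (s i) = Dom C (c i)"
    using countable_coproducts[of UNIV "\<lambda>i. Dom C (c i)"] by auto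
  have s: "Cod C (s i) = S" for i using is_coproduct_cod[OF S(1)] by simp
  obtain u where u: "Dom C u = S" "Cod C u = X" "\<And>i. u \<cdot> s i = c i"
    by (rule is_coproduct_copair[OF S(1), of c X]) (simp_all add: S(2) c)
  \<comment> \<open>Here closure of summands under countable disjoint unions enters. It supplies the
    complement \<open>u'\<close>, on which the supremum is declared undefined.\<close>
  have "coproduct_injection C u"
    by (rule disjoint_unions[OF _ _ S(1), of c X]) (use c disj u S(2) in \<open>simp_all add: hom_iff\<close>)
  then obtain u' where u': "is_binary_coproduct C X u u'" unfolding coproduct_injection_def using u by auto
  have cu': "Cod C u' = X" using is_binary_coproduct_cod[OF u'] by simp
  obtain m where m: "Dom C m = S" "Cod C m = Y \<oplus> \<one>" "\<And>i. m \<cdot> s i = inl C Y \<one> \<cdot> P i"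
    by (rule is_coproduct_copair[OF S(1), of "\<lambda>i. inl C Y \<one> \<cdot> P i" "Y \<oplus> \<one>"]) (simp_all add: S(2) c)
  obtain h where h: "Dom C h = X" "Cod C h = Y \<oplus> \<one>" "h \<cdot> u = m" "h \<cdot> u' = inr C Y \<one> \<cdot> bang C (Dom C u')"
    by (rule is_binary_coproduct_copair[OF u', of m "inr C Y \<one> \<cdot> bang C (Dom C u')"]) (simp_all add: m u)
  have hc: "h \<cdot> c i = F i \<cdot> c i" for i
    using cmp_eq[OF h(3), of "s i"] h u s m c by simp
  \<comment> \<open>By construction \<open>h\<close> agrees with \<open>F i\<close> on the single
    piece \<open>c i\<close>. An element of the domain of \<open>F (Suc i)\<close> is split by
    \<open>F i\<close>: where \<open>F i\<close> is defined the induction hypothesis applies, and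
    the rest lies in \<open>e i\<close>, hence in the piece \<open>c (Suc i)\<close>.\<close>
  have ub: "h \<cdot> w = F i \<cdot> w"
    if "Cod C w = X" "Cod C y = Y" "Dom C y = Dom C w" "F i \<cdot> w = inl C Y \<one> \<cdot> y" for i w y
    using that
  proof (induction i arbitrary: w y)
    case 0
    obtain v where v: "Dom C v = Dom C y" "Cod C v = Dom C (d 0)" "d 0 \<cdot> v = w"
      by (rule is_pullbackE[OF d(2)[of 0] 0(4)]) (use 0(1-3) F in simp_all)
    have "c 0 = d 0" by (simp add: c_def)
    then show ?case using cmp_eq_cmp[OF hc[of 0], of v] v F h dp(2) by simp
  next
    case (Suc i)
    show ?case
    proof (rule sum_cases_eq[of "F i \<cdot> w" Y \<one>])
      fix v z assume v: "Cod C v = Dom C (F i \<cdot> w)" "Cod C z = Y" "Dom C z = Dom C v" "(F i \<cdot> w) \<cdot> v = inl C Y \<one> \<cdot> z"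
      then have v': "Cod C v = Dom C w" "F i \<cdot> (w \<cdot> v) = inl C Y \<one> \<cdot> z" using F Suc.prems(1) by simp_all
      have "h \<cdot> (w \<cdot> v) = F i \<cdot> (w \<cdot> v)"
        by (rule Suc.IH[OF _ v(2) _ v'(2)]) (use v v' Suc.prems in simp_all)
      moreover have "F (Suc i) \<cdot> (w \<cdot> v) = inl C Y \<one> \<cdot> z"
        by (rule L_leD[OF le v'(2)]) (use v(2,3) v'(1) Suc.prems(1) F in simp_all)
      ultimately show "(h \<cdot> w) \<cdot> v = (F (Suc i) \<cdot> w) \<cdot> v"
        using v' h F Suc.prems(1) by simp
    next
      fix v z assume v: "Cod C v = Dom C (F i \<cdot> w)" "Cod C z = \<one>" "Dom C z = Dom C v" "(F i \<cdot> w) \<cdot> v = inr C Y \<one> \<cdot> z"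
      then have v': "Cod C v = Dom C w" "F i \<cdot> (w \<cdot> v) = inr C Y \<one> \<cdot> z" using F Suc.prems(1) by simp_all
      obtain t where t: "Dom C t = Dom C z" "Cod C t = Dom C (e i)" "e i \<cdot> t = w \<cdot> v"
        by (rule is_pullbackE[OF d(3) v'(2)]) (use v(2,3) v'(1) F Suc.prems(1) in simp_all)
      have "(F (Suc i) \<cdot> e i) \<cdot> t = inl C Y \<one> \<cdot> (y \<cdot> v)"
        using cmp_eq_cmp[OF Suc.prems(4), of v] F Suc.prems(1-3) v'(1) t eq by simp
      then obtain r where r: "Dom C r = Dom C v" "Cod C r = Dom C (d' i)" "d' i \<cdot> r = t"
        by (rule is_pullbackE[OF d'(2)]) (use v(2,3) v'(1) F Suc.prems(2,3) t eq in simp_all)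
      have "w \<cdot> v = c (Suc i) \<cdot> r" using t(3) r eq dp' by (auto simp: c_def)
      moreover have "Cod C r = Dom C (c (Suc i))" using r eq dp' by (simp add: c_def)
      ultimately show "(h \<cdot> w) \<cdot> v = (F (Suc i) \<cdot> w) \<cdot> v"
        using cmp_eq_cmp[OF hc[of "Suc i"], of r] v'(1) F h c Suc.prems(1) by simp
    qed (use F h Suc.prems(1) in simp_all)
  qed
  show thesis
  proof (rule that[of h])
    show "h \<in> hom C X (Y \<oplus> \<one>)" using h by (simp add: hom_iff)
    show "L_le C Y (F i) h" for i
      by (rule L_leI) (use F h ub in simp_all)
    fix w y a b
    assume w: "Cod C w = X" "Cod C y = Y" "Dom C y = Dom C w" "h \<cdot> w = inl C Y \<one> \<cdot> y"
      and ab: "Dom C a = Dom C w" "Dom C b = Dom C w" "Cod C a = Cod C b"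
      and cov: "\<And>i v y'. Cod C v = Dom C w \<Longrightarrow> Cod C y' = Y \<Longrightarrow> Dom C y' = Dom C v \<Longrightarrow>
        F i \<cdot> (w \<cdot> v) = inl C Y \<one> \<cdot> y' \<Longrightarrow> a \<cdot> v = b \<cdot> v"
    \<comment> \<open>The part of \<open>w\<close> in \<open>u'\<close> is contradictory, since
      \<open>h\<close> is undefined there. The part in \<open>u\<close> is split further by the
      coproduct \<open>S\<close> into countably many pieces, and on the piece \<open>c i\<close> the
      arrow \<open>F i\<close> is defined.\<close>
    have uw: "is_binary_coproduct C (Cod C w) u u'" using u' w(1) by simp
    show "a = b"
    proof (rule binary_cases_eq[OF uw ab])
      fix v z assume v: "Cod C v = Dom C w" "Cod C z = Dom C u" "Dom C z = Dom C v" "w \<cdot> v = u \<cdot> z"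
      have Sz: "is_coproduct C UNIV (Cod C z) s" using S(1) v(2) u(1) by simp
      show "a \<cdot> v = b \<cdot> v"
      proof (rule countable_cases_eq[OF Sz])
        fix i t r assume t: "Cod C t = Dom C z" "Cod C r = Dom C (s i)" "Dom C r = Dom C t" "z \<cdot> t = s i \<cdot> r"
        have "w \<cdot> (v \<cdot> t) = u \<cdot> (z \<cdot> t)" using cmp_eq_cmp[OF v(4), of t] t(1) v(1-3) w(1) u by simp
        also have "\<dots> = c i \<cdot> r" using t(2) s u cmp_eq[OF u(3)[of i], of r] by (simp add: t(4))
        finally have "F i \<cdot> (w \<cdot> (v \<cdot> t)) = inl C Y \<one> \<cdot> (P i \<cdot> r)"
          using cmp_eq_cmp[OF c(4)[of i], of r] c F t(2) S(2) by simp
        then have "a \<cdot> (v \<cdot> t) = b \<cdot> (v \<cdot> t)"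
          by (rule cov[rotated 3]) (use t(1-3) v(1-3) c S(2) in simp_all)
        then show "(a \<cdot> v) \<cdot> t = (b \<cdot> v) \<cdot> t" using t(1) v(1,3) ab by simp
      qed (use v(1-3) ab in simp_all)
    next
      fix v z assume v: "Cod C v = Dom C w" "Cod C z = Dom C u'" "Dom C z = Dom C v" "w \<cdot> v = u' \<cdot> z"
      have "inl C Y \<one> \<cdot> (y \<cdot> v) = inr C Y \<one> \<cdot> bang C (Dom C v)"
        using cmp_eq_cmp[OF w(4), of v] cmp_eq_cmp[OF h(4), of z] v w(1-3) h cu' by simp
      then show "a \<cdot> v = b \<cdot> v"
        by (rule inl_inr_eq) (use v(1) w(2,3) ab in simp_all)
    qed
  qed
qed

text \<open>The continuity laws quantify over every least upper bound \<open>s\<close>. By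
  antisymmetry \<open>s\<close> is the one from \<open>L_lub_exists\<close> and inherits its
  covering principle.\<close>

lemma L_lub_cover:
  assumes "omega_chain (hom C X (Y \<oplus> \<one>)) (L_le C Y) F" "is_lub (hom C X (Y \<oplus> \<one>)) (L_le C Y) F s"
    and "s \<cdot> w = inl C Y \<one> \<cdot> y" "Cod C w = X" "Cod C y = Y" "Dom C y = Dom C w"
      "Dom C a = Dom C w" "Dom C b = Dom C w" "Cod C a = Cod C b"
    and "\<And>i v y'. Cod C v = Dom C w \<Longrightarrow> Cod C y' = Y \<Longrightarrow> Dom C y' = Dom C v \<Longrightarrow>
        F i \<cdot> (w \<cdot> v) = inl C Y \<one> \<cdot> y' \<Longrightarrow> a \<cdot> v = b \<cdot> v"
  shows "a = b"
proof (rule L_lub_exists[OF assms(1)])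
  fix s' assume s': "s' \<in> hom C X (Y \<oplus> \<one>)" "\<And>i. L_le C Y (F i) s'"
    and cov: "\<And>w y a b. Cod C w = X \<Longrightarrow> Cod C y = Y \<Longrightarrow> Dom C y = Dom C w \<Longrightarrow> s' \<cdot> w = inl C Y \<one> \<cdot> y \<Longrightarrow>
      Dom C a = Dom C w \<Longrightarrow> Dom C b = Dom C w \<Longrightarrow> Cod C a = Cod C b \<Longrightarrow>
      (\<And>i v y'. Cod C v = Dom C w \<Longrightarrow> Cod C y' = Y \<Longrightarrow> Dom C y' = Dom C v \<Longrightarrow>
        F i \<cdot> (w \<cdot> v) = inl C Y \<one> \<cdot> y' \<Longrightarrow> a \<cdot> v = b \<cdot> v) \<Longrightarrow> a = b"
  have F: "F i \<in> hom C X (Y \<oplus> \<one>)" for i using assms(1) by (simp add: omega_chain_def)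
  have "is_lub (hom C X (Y \<oplus> \<one>)) (L_le C Y) F s'" by (rule L_is_lubI[OF F s' cov])
  then have "L_le C Y s s'" "L_le C Y s' s" using assms(2) unfolding is_lub_def by blast+
  then have "s = s'"
    by (rule L_le_antisym) (use s'(1) assms(2) in \<open>simp_all add: is_lub_def hom_iff\<close>)
  then show ?thesis using cov assms(3-) by blast
qed

text \<open>Inversion for Kleisli composition. A value of the composite arises from an intermediate
  value \<open>y\<close> of \<open>f\<close>, but \<open>y\<close> exists only locally, on the part
  where \<open>f\<close> is defined; hence the form with a goal \<open>a = b\<close>.\<close>

lemma L_ext_cases:
  assumes g: "Dom C g = Y" "Cod C g = Z \<oplus> \<one>" and f: "Cod C f = Y \<oplus> \<one>" "Cod C w = Dom C f"
    and z: "Cod C z = Z" "Dom C z = Dom C w" "\<lblot>g, inr C Z \<one>\<rblot> \<cdot> (f \<cdot> w) = inl C Z \<one> \<cdot> z"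
    and ab: "Dom C a = Dom C w" "Dom C b = Dom C w" "Cod C a = Cod C b"
    and eq: "\<And>v y. Cod C v = Dom C w \<Longrightarrow> Cod C y = Y \<Longrightarrow> Dom C y = Dom C v \<Longrightarrow>
      f \<cdot> (w \<cdot> v) = inl C Y \<one> \<cdot> y \<Longrightarrow> g \<cdot> y = inl C Z \<one> \<cdot> (z \<cdot> v) \<Longrightarrow> a \<cdot> v = b \<cdot> v"
  shows "a = b"
proof (rule sum_cases_eq[of "f \<cdot> w" Y \<one>])
  fix v y assume v: "Cod C v = Dom C (f \<cdot> w)" "Cod C y = Y" "Dom C y = Dom C v" "(f \<cdot> w) \<cdot> v = inl C Y \<one> \<cdot> y"
  then have v': "Cod C v = Dom C w" "f \<cdot> (w \<cdot> v) = inl C Y \<one> \<cdot> y" using f by simp_all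
  have "\<lblot>g, inr C Z \<one>\<rblot> \<cdot> ((f \<cdot> w) \<cdot> v) = inl C Z \<one> \<cdot> (z \<cdot> v)"
    by (rule cmp_eq_cmp[OF z(3)]) (use v'(1) f g z(1,2) in simp_all)
  then have "g \<cdot> y = inl C Z \<one> \<cdot> (z \<cdot> v)" using v(2,4) g by simp
  then show "a \<cdot> v = b \<cdot> v" by (rule eq[OF v'(1) v(2,3) v'(2)])
next
  fix v y assume v: "Cod C v = Dom C (f \<cdot> w)" "Cod C y = \<one>" "Dom C y = Dom C v" "(f \<cdot> w) \<cdot> v = inr C Y \<one> \<cdot> y"
  then have v': "Cod C v = Dom C w" using f by simp
  have "\<lblot>g, inr C Z \<one>\<rblot> \<cdot> ((f \<cdot> w) \<cdot> v) = inl C Z \<one> \<cdot> (z \<cdot> v)"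
    by (rule cmp_eq_cmp[OF z(3)]) (use v'(1) f g z(1,2) in simp_all)
  then have "inl C Z \<one> \<cdot> (z \<cdot> v) = inr C Z \<one> \<cdot> y" using v(2,4) g by simp
  then show "a \<cdot> v = b \<cdot> v" by (rule inl_inr_eq) (use v(2,3) v' z(1,2) ab in simp_all)
qed (use f ab in simp_all)

text \<open>Inversion for the strength. Because \<open>inl\<close> is monic, the value
  \<open>z\<close> is locally the pair of the context \<open>c\<close> and a value \<open>y\<close>
  of \<open>f\<close>.\<close>

lemma L_str_cases:
  assumes c: "Cod C c = X" "Dom C c = Dom C f" and f: "Cod C f = Y \<oplus> \<one>"
    and z: "Cod C z = X \<otimes> Y" "Dom C z = Dom C f" "str (L_monad C) X Y \<cdot> pairing C c f = inl C (X \<otimes> Y) \<one> \<cdot> z"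
    and ab: "Dom C a = Dom C f" "Dom C b = Dom C f" "Cod C a = Cod C b"
    and eq: "\<And>v y. Cod C v = Dom C f \<Longrightarrow> Cod C y = Y \<Longrightarrow> Dom C y = Dom C v \<Longrightarrow>
      f \<cdot> v = inl C Y \<one> \<cdot> y \<Longrightarrow> z \<cdot> v = pairing C (c \<cdot> v) y \<Longrightarrow> a \<cdot> v = b \<cdot> v"
  shows "a = b"
proof (rule sum_cases_eq[OF f ab])
  fix v y assume v: "Cod C v = Dom C f" "Cod C y = Y" "Dom C y = Dom C v" "f \<cdot> v = inl C Y \<one> \<cdot> y"
  have "str (L_monad C) X Y \<cdot> (pairing C c f \<cdot> v) = inl C (X \<otimes> Y) \<one> \<cdot> (z \<cdot> v)"
    by (rule cmp_eq_cmp[OF z(3)]) (use v(1) f c z(1,2) in simp_all)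
  then have "inl C (X \<otimes> Y) \<one> \<cdot> (z \<cdot> v) = inl C (X \<otimes> Y) \<one> \<cdot> pairing C (c \<cdot> v) y" using v c f by simp
  then have "z \<cdot> v = pairing C (c \<cdot> v) y" by (rule inl_cancel) (use v(1-3) z(1,2) c in simp_all)
  then show "a \<cdot> v = b \<cdot> v" by (rule eq[OF v])
next
  fix v y assume v: "Cod C v = Dom C f" "Cod C y = \<one>" "Dom C y = Dom C v" "f \<cdot> v = inr C Y \<one> \<cdot> y"
  have "str (L_monad C) X Y \<cdot> (pairing C c f \<cdot> v) = inl C (X \<otimes> Y) \<one> \<cdot> (z \<cdot> v)"
    by (rule cmp_eq_cmp[OF z(3)]) (use v(1) f c z(1,2) in simp_all)
  then have "inl C (X \<otimes> Y) \<one> \<cdot> (z \<cdot> v) = inr C (X \<otimes> Y) \<one> \<cdot> y" using v c f by simp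
  then show "a \<cdot> v = b \<cdot> v" by (rule inl_inr_eq) (use v(1-3) z(1,2) c ab in simp_all)
qed

section \<open>The laws of an \<open>\<omega>\<close>-continuous monad for
  \<open>L_monad\<close>\<close>

lemma L_omega_cpo_bot: "omega_cpo_bot (hom C X (Y \<oplus> \<one>)) (L_le C Y)"
  unfolding omega_cpo_bot_def
proof (intro conjI allI impI)
  show "reflp_on (hom C X (Y \<oplus> \<one>)) (L_le C Y)"
    by (rule reflp_onI) (simp add: hom_iff L_le_refl)
  show "transp_on (hom C X (Y \<oplus> \<one>)) (L_le C Y)"
  proof (rule transp_onI)
    fix f g h assume "f \<in> hom C X (Y \<oplus> \<one>)" "g \<in> hom C X (Y \<oplus> \<one>)" "h \<in> hom C X (Y \<oplus> \<one>)" "L_le C Y f g" "L_le C Y g h"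
    then show "L_le C Y f h" by (intro L_le_trans[of Y f g h]) (simp_all add: hom_iff)
  qed
  show "antisymp_on (hom C X (Y \<oplus> \<one>)) (L_le C Y)"
  proof (rule antisymp_onI)
    fix f g assume "f \<in> hom C X (Y \<oplus> \<one>)" "g \<in> hom C X (Y \<oplus> \<one>)" "L_le C Y f g" "L_le C Y g f"
    then show "f = g" by (intro L_le_antisym[of Y f g]) (simp_all add: hom_iff)
  qed
  show "\<exists>b. is_bottom (hom C X (Y \<oplus> \<one>)) (L_le C Y) b"
    by (simp add: L_is_bottom_iff)
  fix F assume F: "omega_chain (hom C X (Y \<oplus> \<one>)) (L_le C Y) F"
  then have Fh: "F i \<in> hom C X (Y \<oplus> \<one>)" for i by (simp add: omega_chain_def)
  show "\<exists>s. is_lub (hom C X (Y \<oplus> \<one>)) (L_le C Y) F s"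
  proof (rule L_lub_exists[OF F])
    fix s assume s: "s \<in> hom C X (Y \<oplus> \<one>)" "\<And>i. L_le C Y (F i) s"
      and cov: "\<And>w y a b. Cod C w = X \<Longrightarrow> Cod C y = Y \<Longrightarrow> Dom C y = Dom C w \<Longrightarrow> s \<cdot> w = inl C Y \<one> \<cdot> y \<Longrightarrow>
        Dom C a = Dom C w \<Longrightarrow> Dom C b = Dom C w \<Longrightarrow> Cod C a = Cod C b \<Longrightarrow>
        (\<And>i v y'. Cod C v = Dom C w \<Longrightarrow> Cod C y' = Y \<Longrightarrow> Dom C y' = Dom C v \<Longrightarrow>
          F i \<cdot> (w \<cdot> v) = inl C Y \<one> \<cdot> y' \<Longrightarrow> a \<cdot> v = b \<cdot> v) \<Longrightarrow> a = b"
    show ?thesis by (rule exI, rule L_is_lubI[OF Fh s cov])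
  qed
qed

lemma L_ext_cont_right:
  assumes F: "omega_chain (hom C X (Y \<oplus> \<one>)) (L_le C Y) F" and s: "is_lub (hom C X (Y \<oplus> \<one>)) (L_le C Y) F s"
    and g: "Dom C g = Y" "Cod C g = Z \<oplus> \<one>"
  shows "is_lub (hom C X (Z \<oplus> \<one>)) (L_le C Z) (\<lambda>i. \<lblot>g, inr C Z \<one>\<rblot> \<cdot> F i) (\<lblot>g, inr C Z \<one>\<rblot> \<cdot> s)"
proof (rule L_is_lubI)
  have Fd: "Dom C (F i) = X" "Cod C (F i) = Y \<oplus> \<one>" for i using F by (simp_all add: omega_chain_def hom_iff)
  have sd: "Dom C s = X" "Cod C s = Y \<oplus> \<one>" "L_le C Y (F i) s" for i using s by (simp_all add: is_lub_def hom_iff)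
  note d = Fd sd(1,2) g
  show "\<lblot>g, inr C Z \<one>\<rblot> \<cdot> F i \<in> hom C X (Z \<oplus> \<one>)" for i by (simp add: hom_iff d)
  show "\<lblot>g, inr C Z \<one>\<rblot> \<cdot> s \<in> hom C X (Z \<oplus> \<one>)" by (simp add: hom_iff d)
  show "L_le C Z (\<lblot>g, inr C Z \<one>\<rblot> \<cdot> F i) (\<lblot>g, inr C Z \<one>\<rblot> \<cdot> s)" for i
  proof (rule L_leI)
    fix w z assume w: "Cod C w = Dom C (\<lblot>g, inr C Z \<one>\<rblot> \<cdot> F i)" "Cod C z = Z" "Dom C z = Dom C w"
      "(\<lblot>g, inr C Z \<one>\<rblot> \<cdot> F i) \<cdot> w = inl C Z \<one> \<cdot> z"
    then have w': "Cod C w = X" "\<lblot>g, inr C Z \<one>\<rblot> \<cdot> (F i \<cdot> w) = inl C Z \<one> \<cdot> z" using d by simp_all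
    show "(\<lblot>g, inr C Z \<one>\<rblot> \<cdot> s) \<cdot> w = inl C Z \<one> \<cdot> z"
    proof (rule L_ext_cases[OF g Fd(2) _ w(2,3) w'(2)])
      fix v y assume v: "Cod C v = Dom C w" "Cod C y = Y" "Dom C y = Dom C v"
        "F i \<cdot> (w \<cdot> v) = inl C Y \<one> \<cdot> y" "g \<cdot> y = inl C Z \<one> \<cdot> (z \<cdot> v)"
      have "s \<cdot> (w \<cdot> v) = inl C Y \<one> \<cdot> y"
        by (rule L_leD[OF sd(3) v(4)]) (use v(1-3) w' d in simp_all)
      then show "((\<lblot>g, inr C Z \<one>\<rblot> \<cdot> s) \<cdot> w) \<cdot> v = (inl C Z \<one> \<cdot> z) \<cdot> v"
        using v w(2,3) w'(1) d by simp
    qed (use w(2,3) w'(1) d in simp_all)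
  qed (simp_all add: d)
  fix w z a b
  assume w: "Cod C w = X" "Cod C z = Z" "Dom C z = Dom C w" "(\<lblot>g, inr C Z \<one>\<rblot> \<cdot> s) \<cdot> w = inl C Z \<one> \<cdot> z"
    and ab: "Dom C a = Dom C w" "Dom C b = Dom C w" "Cod C a = Cod C b"
    and cov: "\<And>i v y'. Cod C v = Dom C w \<Longrightarrow> Cod C y' = Z \<Longrightarrow> Dom C y' = Dom C v \<Longrightarrow>
        (\<lblot>g, inr C Z \<one>\<rblot> \<cdot> F i) \<cdot> (w \<cdot> v) = inl C Z \<one> \<cdot> y' \<Longrightarrow> a \<cdot> v = b \<cdot> v"
  have w': "\<lblot>g, inr C Z \<one>\<rblot> \<cdot> (s \<cdot> w) = inl C Z \<one> \<cdot> z" using w d by simp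
  show "a = b"
  proof (rule L_ext_cases[OF g sd(2) _ w(2,3) w' ab])
    fix v y assume v: "Cod C v = Dom C w" "Cod C y = Y" "Dom C y = Dom C v"
      "s \<cdot> (w \<cdot> v) = inl C Y \<one> \<cdot> y" "g \<cdot> y = inl C Z \<one> \<cdot> (z \<cdot> v)"
    show "a \<cdot> v = b \<cdot> v"
    proof (rule L_lub_cover[OF F s v(4)])
      fix i r y' assume r: "Cod C r = Dom C (w \<cdot> v)" "Cod C y' = Y" "Dom C y' = Dom C r"
        "F i \<cdot> ((w \<cdot> v) \<cdot> r) = inl C Y \<one> \<cdot> y'"
      then have r': "Cod C r = Dom C v" using v(1) by simp
      have "s \<cdot> ((w \<cdot> v) \<cdot> r) = inl C Y \<one> \<cdot> y'"
        by (rule L_leD[OF sd(3) r(4)]) (use r(2,3) r' v(1-3) w(1) d in simp_all)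
      moreover have "s \<cdot> ((w \<cdot> v) \<cdot> r) = inl C Y \<one> \<cdot> (y \<cdot> r)"
        by (rule cmp_eq_cmp[OF v(4)]) (use r' v(1-3) w(1) d in simp_all)
      \<comment> \<open>Covering offers some value \<open>y'\<close> of \<open>F i\<close>. As
        \<open>s\<close> extends \<open>F i\<close> and \<open>inl\<close> is monic, it is the
        restriction of the value \<open>y\<close> of \<open>s\<close>, for which the result of
        \<open>g\<close> is already known.\<close>
      ultimately have "y' = y \<cdot> r"
        by - (rule inl_cancel[of Y \<one>], use r(2,3) r' v(2,3) in simp_all)
      then have "g \<cdot> y' = inl C Z \<one> \<cdot> (z \<cdot> (v \<cdot> r))"
        using cmp_eq_cmp[OF v(5), of r] r' v(1-3) w(2,3) d by simp
      moreover have "F i \<cdot> (w \<cdot> (v \<cdot> r)) = inl C Y \<one> \<cdot> y'" using r(4) r' v(1) by simp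
      ultimately have "(\<lblot>g, inr C Z \<one>\<rblot> \<cdot> F i) \<cdot> (w \<cdot> (v \<cdot> r)) = inl C Z \<one> \<cdot> (z \<cdot> (v \<cdot> r))"
        using r(2) r' v(1) w(1) d by simp
      then have "a \<cdot> (v \<cdot> r) = b \<cdot> (v \<cdot> r)"
        by (rule cov[rotated 3]) (use r' v(1) w(2,3) in simp_all)
      then show "(a \<cdot> v) \<cdot> r = (b \<cdot> v) \<cdot> r" using r' v(1) ab by simp
    qed (use v(1-3) w(1) ab in simp_all)
  qed (use w(1) d in simp_all)
qed

text \<open>The chain acts on the intermediate value \<open>y\<close> of \<open>f\<close>, so the
  covering principle of \<open>t\<close> is used at the element \<open>y\<close> rather than at
  \<open>w\<close>.\<close>

lemma L_ext_cont_left: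
  assumes G: "omega_chain (hom C Y (Z \<oplus> \<one>)) (L_le C Z) G" and t: "is_lub (hom C Y (Z \<oplus> \<one>)) (L_le C Z) G t"
    and f: "Dom C f = X" "Cod C f = Y \<oplus> \<one>"
  shows "is_lub (hom C X (Z \<oplus> \<one>)) (L_le C Z) (\<lambda>i. \<lblot>G i, inr C Z \<one>\<rblot> \<cdot> f) (\<lblot>t, inr C Z \<one>\<rblot> \<cdot> f)"
proof (rule L_is_lubI)
  have Gd: "Dom C (G i) = Y" "Cod C (G i) = Z \<oplus> \<one>" for i using G by (simp_all add: omega_chain_def hom_iff)
  have td: "Dom C t = Y" "Cod C t = Z \<oplus> \<one>" "L_le C Z (G i) t" for i using t by (simp_all add: is_lub_def hom_iff)
  note d = Gd td(1,2) f
  show "\<lblot>G i, inr C Z \<one>\<rblot> \<cdot> f \<in> hom C X (Z \<oplus> \<one>)" for i by (simp add: hom_iff d)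
  show "\<lblot>t, inr C Z \<one>\<rblot> \<cdot> f \<in> hom C X (Z \<oplus> \<one>)" by (simp add: hom_iff d)
  show "L_le C Z (\<lblot>G i, inr C Z \<one>\<rblot> \<cdot> f) (\<lblot>t, inr C Z \<one>\<rblot> \<cdot> f)" for i
  proof (rule L_leI)
    fix w z assume w: "Cod C w = Dom C (\<lblot>G i, inr C Z \<one>\<rblot> \<cdot> f)" "Cod C z = Z" "Dom C z = Dom C w"
      "(\<lblot>G i, inr C Z \<one>\<rblot> \<cdot> f) \<cdot> w = inl C Z \<one> \<cdot> z"
    then have w': "Cod C w = X" "\<lblot>G i, inr C Z \<one>\<rblot> \<cdot> (f \<cdot> w) = inl C Z \<one> \<cdot> z" using d by simp_all
    show "(\<lblot>t, inr C Z \<one>\<rblot> \<cdot> f) \<cdot> w = inl C Z \<one> \<cdot> z"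
    proof (rule L_ext_cases[OF Gd f(2) _ w(2,3) w'(2)])
      fix v y assume v: "Cod C v = Dom C w" "Cod C y = Y" "Dom C y = Dom C v"
        "f \<cdot> (w \<cdot> v) = inl C Y \<one> \<cdot> y" "G i \<cdot> y = inl C Z \<one> \<cdot> (z \<cdot> v)"
      have "t \<cdot> y = inl C Z \<one> \<cdot> (z \<cdot> v)"
        by (rule L_leD[OF td(3) v(5)]) (use v(1-3) w(2,3) d in simp_all)
      then show "((\<lblot>t, inr C Z \<one>\<rblot> \<cdot> f) \<cdot> w) \<cdot> v = (inl C Z \<one> \<cdot> z) \<cdot> v"
        using v(1-4) w(2,3) w'(1) d by simp
    qed (use w(2,3) w'(1) d in simp_all)
  qed (simp_all add: d)
  fix w z a b
  assume w: "Cod C w = X" "Cod C z = Z" "Dom C z = Dom C w" "(\<lblot>t, inr C Z \<one>\<rblot> \<cdot> f) \<cdot> w = inl C Z \<one> \<cdot> z"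
    and ab: "Dom C a = Dom C w" "Dom C b = Dom C w" "Cod C a = Cod C b"
    and cov: "\<And>i v y'. Cod C v = Dom C w \<Longrightarrow> Cod C y' = Z \<Longrightarrow> Dom C y' = Dom C v \<Longrightarrow>
        (\<lblot>G i, inr C Z \<one>\<rblot> \<cdot> f) \<cdot> (w \<cdot> v) = inl C Z \<one> \<cdot> y' \<Longrightarrow> a \<cdot> v = b \<cdot> v"
  have w': "\<lblot>t, inr C Z \<one>\<rblot> \<cdot> (f \<cdot> w) = inl C Z \<one> \<cdot> z" using w d by simp
  show "a = b"
  proof (rule L_ext_cases[OF td(1,2) f(2) _ w(2,3) w' ab])
    fix v y assume v: "Cod C v = Dom C w" "Cod C y = Y" "Dom C y = Dom C v"
      "f \<cdot> (w \<cdot> v) = inl C Y \<one> \<cdot> y" "t \<cdot> y = inl C Z \<one> \<cdot> (z \<cdot> v)"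
    show "a \<cdot> v = b \<cdot> v"
    proof (rule L_lub_cover[OF G t v(5)])
      fix i r z' assume r: "Cod C r = Dom C y" "Cod C z' = Z" "Dom C z' = Dom C r" "G i \<cdot> (y \<cdot> r) = inl C Z \<one> \<cdot> z'"
      have r': "Cod C r = Dom C v" using r(1) v(3) by simp
      have "f \<cdot> (w \<cdot> (v \<cdot> r)) = inl C Y \<one> \<cdot> (y \<cdot> r)"
        using cmp_eq_cmp[OF v(4), of r] r' v(1-3) w(1) d by simp
      then have "(\<lblot>G i, inr C Z \<one>\<rblot> \<cdot> f) \<cdot> (w \<cdot> (v \<cdot> r)) = inl C Z \<one> \<cdot> z'"
        using r(1,4) r' v(1,2) w(1) d by simp
      then have "a \<cdot> (v \<cdot> r) = b \<cdot> (v \<cdot> r)"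
        by (rule cov[rotated 3]) (use r(2,3) r' v(1) in simp_all)
      then show "(a \<cdot> v) \<cdot> r = (b \<cdot> v) \<cdot> r" using r' v(1) ab by simp
    qed (use v(1-3) w(1-3) ab in simp_all)
  qed (use w(1) d in simp_all)
qed

lemma L_str_cont:
  assumes F: "omega_chain (hom C X (Y \<oplus> \<one>)) (L_le C Y) F" and s: "is_lub (hom C X (Y \<oplus> \<one>)) (L_le C Y) F s"
  shows "is_lub (hom C (W \<otimes> X) (W \<otimes> Y \<oplus> \<one>)) (L_le C (W \<otimes> Y))
         (\<lambda>i. str (L_monad C) W Y \<cdot> (idm C W \<otimes>\<^sub>m F i)) (str (L_monad C) W Y \<cdot> (idm C W \<otimes>\<^sub>m s))"
proof (rule L_is_lubI)
  have Fd: "Dom C (F i) = X" "Cod C (F i) = Y \<oplus> \<one>" for i using F by (simp_all add: omega_chain_def hom_iff)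
  have sd: "Dom C s = X" "Cod C s = Y \<oplus> \<one>" "L_le C Y (F i) s" for i using s by (simp_all add: is_lub_def hom_iff)
  note d = Fd sd(1,2)
  let ?st = "str (L_monad C) W Y"
  \<comment> \<open>An element \<open>w\<close> of the product is replaced by its two components;
    the chain acts on the second one only, so \<open>L_str_cases\<close> and
    \<open>L_lub_cover\<close> apply there.\<close>
  have st: "?st \<cdot> ((idm C W \<otimes>\<^sub>m f) \<cdot> w) = ?st \<cdot> pairing C (prl C W X \<cdot> w) (f \<cdot> (prr C W X \<cdot> w))"
    if "Dom C f = X" "Cod C f = Y \<oplus> \<one>" "Cod C w = W \<otimes> X" for f w
    using that by (simp add: prod_map_def)
  show "?st \<cdot> (idm C W \<otimes>\<^sub>m F i) \<in> hom C (W \<otimes> X) (W \<otimes> Y \<oplus> \<one>)" for i by (simp add: hom_iff d)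
  show "?st \<cdot> (idm C W \<otimes>\<^sub>m s) \<in> hom C (W \<otimes> X) (W \<otimes> Y \<oplus> \<one>)" by (simp add: hom_iff d)
  show "L_le C (W \<otimes> Y) (?st \<cdot> (idm C W \<otimes>\<^sub>m F i)) (?st \<cdot> (idm C W \<otimes>\<^sub>m s))" for i
  proof (rule L_leI)
    fix w z assume w: "Cod C w = Dom C (?st \<cdot> (idm C W \<otimes>\<^sub>m F i))" "Cod C z = W \<otimes> Y" "Dom C z = Dom C w"
      "(?st \<cdot> (idm C W \<otimes>\<^sub>m F i)) \<cdot> w = inl C (W \<otimes> Y) \<one> \<cdot> z"
    have w1: "Cod C w = W \<otimes> X" using w(1) d by simp
    have w': "?st \<cdot> pairing C (prl C W X \<cdot> w) (F i \<cdot> (prr C W X \<cdot> w)) = inl C (W \<otimes> Y) \<one> \<cdot> z"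
      using w(4) st[OF Fd w1] w1 d by simp
    show "(?st \<cdot> (idm C W \<otimes>\<^sub>m s)) \<cdot> w = inl C (W \<otimes> Y) \<one> \<cdot> z"
    proof (rule L_str_cases[OF _ _ _ w(2) _ w'])
      fix v y assume v: "Cod C v = Dom C (F i \<cdot> (prr C W X \<cdot> w))" "Cod C y = Y" "Dom C y = Dom C v"
        "(F i \<cdot> (prr C W X \<cdot> w)) \<cdot> v = inl C Y \<one> \<cdot> y" "z \<cdot> v = pairing C ((prl C W X \<cdot> w) \<cdot> v) y"
      have v': "Cod C v = Dom C w" using v(1) w1 d by simp
      have "s \<cdot> (prr C W X \<cdot> (w \<cdot> v)) = inl C Y \<one> \<cdot> y"
        by (rule L_leD[OF sd(3)]) (use v(2-4) v' w1 d in simp_all)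
      then show "((?st \<cdot> (idm C W \<otimes>\<^sub>m s)) \<cdot> w) \<cdot> v = (inl C (W \<otimes> Y) \<one> \<cdot> z) \<cdot> v"
        using st[OF sd(1,2), of "w \<cdot> v"] v(2,3,5) v' w1 w(2,3) d by simp
    qed (use w(2,3) w1 d in simp_all)
  qed (simp_all add: d)
  fix w z a b
  assume w: "Cod C w = W \<otimes> X" "Cod C z = W \<otimes> Y" "Dom C z = Dom C w" "(?st \<cdot> (idm C W \<otimes>\<^sub>m s)) \<cdot> w = inl C (W \<otimes> Y) \<one> \<cdot> z"
    and ab: "Dom C a = Dom C w" "Dom C b = Dom C w" "Cod C a = Cod C b"
    and cov: "\<And>i v y'. Cod C v = Dom C w \<Longrightarrow> Cod C y' = W \<otimes> Y \<Longrightarrow> Dom C y' = Dom C v \<Longrightarrow>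
        (?st \<cdot> (idm C W \<otimes>\<^sub>m F i)) \<cdot> (w \<cdot> v) = inl C (W \<otimes> Y) \<one> \<cdot> y' \<Longrightarrow> a \<cdot> v = b \<cdot> v"
  have w': "?st \<cdot> pairing C (prl C W X \<cdot> w) (s \<cdot> (prr C W X \<cdot> w)) = inl C (W \<otimes> Y) \<one> \<cdot> z"
    using w(4) st[OF sd(1,2) w(1)] w(1) d by simp
  show "a = b"
  proof (rule L_str_cases[OF _ _ _ w(2) _ w'])
    fix v y assume v: "Cod C v = Dom C (s \<cdot> (prr C W X \<cdot> w))" "Cod C y = Y" "Dom C y = Dom C v"
        "(s \<cdot> (prr C W X \<cdot> w)) \<cdot> v = inl C Y \<one> \<cdot> y"
    have v': "Cod C v = Dom C w" using v(1) w(1) d by simp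
    have v4: "s \<cdot> (prr C W X \<cdot> (w \<cdot> v)) = inl C Y \<one> \<cdot> y" using v(4) v' w(1) d by simp
    show "a \<cdot> v = b \<cdot> v"
    proof (rule L_lub_cover[OF F s v4])
      fix i r y' assume r: "Cod C r = Dom C (prr C W X \<cdot> (w \<cdot> v))" "Cod C y' = Y" "Dom C y' = Dom C r"
        "F i \<cdot> ((prr C W X \<cdot> (w \<cdot> v)) \<cdot> r) = inl C Y \<one> \<cdot> y'"
      have r': "Cod C r = Dom C v" using r(1) v' w(1) by simp
      have "F i \<cdot> (prr C W X \<cdot> (w \<cdot> (v \<cdot> r))) = inl C Y \<one> \<cdot> y'" using r(4) r' v' w(1) by simp
      then have "(?st \<cdot> (idm C W \<otimes>\<^sub>m F i)) \<cdot> (w \<cdot> (v \<cdot> r)) = inl C (W \<otimes> Y) \<one> \<cdot> pairing C (prl C W X \<cdot> (w \<cdot> (v \<cdot> r))) y'"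
        using st[OF Fd, of "w \<cdot> (v \<cdot> r)" i] r(2,3) r' v' w(1) d by simp
      then have "a \<cdot> (v \<cdot> r) = b \<cdot> (v \<cdot> r)"
        by (rule cov[rotated 3]) (use r(2,3) r' v' w(1) in simp_all)
      then show "(a \<cdot> v) \<cdot> r = (b \<cdot> v) \<cdot> r" using r' v' ab by simp
    qed (use v(2,3) v' w(1-3) ab in simp_all)
  qed (use w(1-3) ab d in simp_all)
qed

lemma L_copair_cont:
  assumes F: "omega_chain (hom C X (Z \<oplus> \<one>)) (L_le C Z) F" and s: "is_lub (hom C X (Z \<oplus> \<one>)) (L_le C Z) F s"
    and G: "omega_chain (hom C Y (Z \<oplus> \<one>)) (L_le C Z) G" and t: "is_lub (hom C Y (Z \<oplus> \<one>)) (L_le C Z) G t"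
  shows "is_lub (hom C (X \<oplus> Y) (Z \<oplus> \<one>)) (L_le C Z) (\<lambda>i. \<lblot>F i, G i\<rblot>) \<lblot>s, t\<rblot>"
proof (rule L_is_lubI)
  have Fd: "Dom C (F i) = X" "Cod C (F i) = Z \<oplus> \<one>" for i using F by (simp_all add: omega_chain_def hom_iff)
  have sd: "Dom C s = X" "Cod C s = Z \<oplus> \<one>" "L_le C Z (F i) s" for i using s by (simp_all add: is_lub_def hom_iff)
  have Gd: "Dom C (G i) = Y" "Cod C (G i) = Z \<oplus> \<one>" for i using G by (simp_all add: omega_chain_def hom_iff)
  have td: "Dom C t = Y" "Cod C t = Z \<oplus> \<one>" "L_le C Z (G i) t" for i using t by (simp_all add: is_lub_def hom_iff)
  note d = Fd sd(1,2) Gd td(1,2)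
  show "\<lblot>F i, G i\<rblot> \<in> hom C (X \<oplus> Y) (Z \<oplus> \<one>)" for i by (simp add: hom_iff d)
  show "\<lblot>s, t\<rblot> \<in> hom C (X \<oplus> Y) (Z \<oplus> \<one>)" by (simp add: hom_iff d)
  show "L_le C Z \<lblot>F i, G i\<rblot> \<lblot>s, t\<rblot>" for i
  proof (rule L_leI)
    fix w z assume w: "Cod C w = Dom C \<lblot>F i, G i\<rblot>" "Cod C z = Z" "Dom C z = Dom C w"
      "\<lblot>F i, G i\<rblot> \<cdot> w = inl C Z \<one> \<cdot> z"
    then have w1: "Cod C w = X \<oplus> Y" using d by simp
    show "\<lblot>s, t\<rblot> \<cdot> w = inl C Z \<one> \<cdot> z"
    proof (rule sum_cases_eq[OF w1])
      fix v x assume v: "Cod C v = Dom C w" "Cod C x = X" "Dom C x = Dom C v" "w \<cdot> v = inl C X Y \<cdot> x"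
      have "F i \<cdot> x = inl C Z \<one> \<cdot> (z \<cdot> v)"
        using cmp_eq_cmp[OF w(4), of v] v w(2,3) w1 d by simp
      then have "s \<cdot> x = inl C Z \<one> \<cdot> (z \<cdot> v)"
        by (rule L_leD[OF sd(3)]) (use v(1-3) w(2,3) d in simp_all)
      then show "(\<lblot>s, t\<rblot> \<cdot> w) \<cdot> v = (inl C Z \<one> \<cdot> z) \<cdot> v" using v w(2,3) w1 d by simp
    next
      fix v x assume v: "Cod C v = Dom C w" "Cod C x = Y" "Dom C x = Dom C v" "w \<cdot> v = inr C X Y \<cdot> x"
      have "G i \<cdot> x = inl C Z \<one> \<cdot> (z \<cdot> v)"
        using cmp_eq_cmp[OF w(4), of v] v w(2,3) w1 d by simp
      then have "t \<cdot> x = inl C Z \<one> \<cdot> (z \<cdot> v)"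
        by (rule L_leD[OF td(3)]) (use v(1-3) w(2,3) d in simp_all)
      then show "(\<lblot>s, t\<rblot> \<cdot> w) \<cdot> v = (inl C Z \<one> \<cdot> z) \<cdot> v" using v w(2,3) w1 d by simp
    qed (use w(2,3) w1 d in simp_all)
  qed (simp_all add: d)
  fix w z a b
  assume w: "Cod C w = X \<oplus> Y" "Cod C z = Z" "Dom C z = Dom C w" "\<lblot>s, t\<rblot> \<cdot> w = inl C Z \<one> \<cdot> z"
    and ab: "Dom C a = Dom C w" "Dom C b = Dom C w" "Cod C a = Cod C b"
    and cov: "\<And>i v y'. Cod C v = Dom C w \<Longrightarrow> Cod C y' = Z \<Longrightarrow> Dom C y' = Dom C v \<Longrightarrow>
        \<lblot>F i, G i\<rblot> \<cdot> (w \<cdot> v) = inl C Z \<one> \<cdot> y' \<Longrightarrow> a \<cdot> v = b \<cdot> v"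
  show "a = b"
  proof (rule sum_cases_eq[OF w(1) ab])
    fix v x assume v: "Cod C v = Dom C w" "Cod C x = X" "Dom C x = Dom C v" "w \<cdot> v = inl C X Y \<cdot> x"
    have sx: "s \<cdot> x = inl C Z \<one> \<cdot> (z \<cdot> v)"
      using cmp_eq_cmp[OF w(4), of v] v w(1-3) d by simp
    show "a \<cdot> v = b \<cdot> v"
    proof (rule L_lub_cover[OF F s sx])
      fix i r y' assume r: "Cod C r = Dom C x" "Cod C y' = Z" "Dom C y' = Dom C r" "F i \<cdot> (x \<cdot> r) = inl C Z \<one> \<cdot> y'"
      have "w \<cdot> (v \<cdot> r) = inl C X Y \<cdot> (x \<cdot> r)"
        using cmp_eq_cmp[OF v(4), of r] r(1) v(1-3) by simp
      then have "\<lblot>F i, G i\<rblot> \<cdot> (w \<cdot> (v \<cdot> r)) = inl C Z \<one> \<cdot> y'" using r(1,4) v(2) d by simp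
      then have "a \<cdot> (v \<cdot> r) = b \<cdot> (v \<cdot> r)"
        by (rule cov[rotated 3]) (use r(1-3) v(1-3) in simp_all)
      then show "(a \<cdot> v) \<cdot> r = (b \<cdot> v) \<cdot> r" using r(1) v(1,3) ab by simp
    qed (use v(1-3) w(1-3) ab in simp_all)
  next
    fix v x assume v: "Cod C v = Dom C w" "Cod C x = Y" "Dom C x = Dom C v" "w \<cdot> v = inr C X Y \<cdot> x"
    have tx: "t \<cdot> x = inl C Z \<one> \<cdot> (z \<cdot> v)"
      using cmp_eq_cmp[OF w(4), of v] v w(1-3) d by simp
    show "a \<cdot> v = b \<cdot> v"
    proof (rule L_lub_cover[OF G t tx])
      fix i r y' assume r: "Cod C r = Dom C x" "Cod C y' = Z" "Dom C y' = Dom C r" "G i \<cdot> (x \<cdot> r) = inl C Z \<one> \<cdot> y'"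
      have "w \<cdot> (v \<cdot> r) = inr C X Y \<cdot> (x \<cdot> r)"
        using cmp_eq_cmp[OF v(4), of r] r(1) v(1-3) by simp
      then have "\<lblot>F i, G i\<rblot> \<cdot> (w \<cdot> (v \<cdot> r)) = inl C Z \<one> \<cdot> y'" using r(1,4) v(2) d by simp
      then have "a \<cdot> (v \<cdot> r) = b \<cdot> (v \<cdot> r)"
        by (rule cov[rotated 3]) (use r(1-3) v(1-3) in simp_all)
      then show "(a \<cdot> v) \<cdot> r = (b \<cdot> v) \<cdot> r" using r(1) v(1,3) ab by simp
    qed (use v(1-3) w(1-3) ab in simp_all)
  qed
qed

lemma L_omega_continuous: "omega_continuous_monad C (L_monad C) (L_le C)"
proof (rule omega_continuous_monad.intro[OF L_strong_monad], unfold_locales)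
  fix X Y Z W F G s t f g b
  show "omega_cpo_bot (hom C X (Tob (L_monad C) Y)) (L_le C Y)"
    using L_omega_cpo_bot by simp
  show "omega_chain (hom C X (Tob (L_monad C) Y)) (L_le C Y) F \<Longrightarrow> is_lub (hom C X (Tob (L_monad C) Y)) (L_le C Y) F s \<Longrightarrow>
       g \<in> hom C Y (Tob (L_monad C) Z) \<Longrightarrow>
       is_lub (hom C X (Tob (L_monad C) Z)) (L_le C Z) (\<lambda>i. ext (L_monad C) Z g \<cdot> F i) (ext (L_monad C) Z g \<cdot> s)"
    using L_ext_cont_right by (simp add: hom_iff del: cmp_copair)
  show "omega_chain (hom C Y (Tob (L_monad C) Z)) (L_le C Z) G \<Longrightarrow> is_lub (hom C Y (Tob (L_monad C) Z)) (L_le C Z) G t \<Longrightarrow>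
       f \<in> hom C X (Tob (L_monad C) Y) \<Longrightarrow>
       is_lub (hom C X (Tob (L_monad C) Z)) (L_le C Z) (\<lambda>i. ext (L_monad C) Z (G i) \<cdot> f) (ext (L_monad C) Z t \<cdot> f)"
    using L_ext_cont_left by (simp add: hom_iff del: cmp_copair)
  show "omega_chain (hom C X (Tob (L_monad C) Y)) (L_le C Y) F \<Longrightarrow> is_lub (hom C X (Tob (L_monad C) Y)) (L_le C Y) F s \<Longrightarrow>
       is_lub (hom C (W \<otimes> X) (Tob (L_monad C) (W \<otimes> Y))) (L_le C (W \<otimes> Y))
         (\<lambda>i. str (L_monad C) W Y \<cdot> (idm C W \<otimes>\<^sub>m F i)) (str (L_monad C) W Y \<cdot> (idm C W \<otimes>\<^sub>m s))"
    using L_str_cont by simp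
  show "omega_chain (hom C X (Tob (L_monad C) Z)) (L_le C Z) F \<Longrightarrow> is_lub (hom C X (Tob (L_monad C) Z)) (L_le C Z) F s \<Longrightarrow>
       omega_chain (hom C Y (Tob (L_monad C) Z)) (L_le C Z) G \<Longrightarrow> is_lub (hom C Y (Tob (L_monad C) Z)) (L_le C Z) G t \<Longrightarrow>
       is_lub (hom C (X \<oplus> Y) (Tob (L_monad C) Z)) (L_le C Z) (\<lambda>i. \<lblot>F i, G i\<rblot>) \<lblot>s, t\<rblot>"
    using L_copair_cont by simp
  show "is_bottom (hom C X (Tob (L_monad C) Y)) (L_le C Y) b \<Longrightarrow>
       is_bottom (hom C (W \<otimes> X) (Tob (L_monad C) (W \<otimes> Y))) (L_le C (W \<otimes> Y)) (str (L_monad C) W Y \<cdot> (idm C W \<otimes>\<^sub>m b))"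
    by (simp add: L_is_bottom_iff prod_map_def)
  show "is_bottom (hom C X (Tob (L_monad C) Y)) (L_le C Y) b \<Longrightarrow> f \<in> hom C Y (Tob (L_monad C) Z) \<Longrightarrow>
       is_bottom (hom C X (Tob (L_monad C) Z)) (L_le C Z) (ext (L_monad C) Z f \<cdot> b)"
    by (simp add: L_is_bottom_iff hom_iff)
qed

end

section \<open>Least iterates in \<open>\<omega>\<close>-continuous monads\<close>

locale kleisli = hyperextensive_bicart C + strong_monad C M
  for C :: "('o, 'a, 'm) bicart_scheme" (structure) and M :: "('o, 'a, 'n) smonad_scheme"
begin

lemma dom_eta [simp]: "Dom C (eta M X) = X" and cod_eta [simp]: "Cod C (eta M X) = Tob M X"
  using eta_hom[of X] by (simp_all add: hom_iff)

lemma dom_ext [simp]: "Cod C f = Tob M Y \<Longrightarrow> Dom C (ext M Y f) = Tob M (Dom C f)"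
  and cod_ext [simp]: "Cod C f = Tob M Y \<Longrightarrow> Cod C (ext M Y f) = Tob M Y"
  using ext_hom[of f "Dom C f" Y] by (simp_all add: hom_iff)

lemma dom_str [simp]: "Dom C (str M X Y) = X \<otimes> Tob M Y" and cod_str [simp]: "Cod C (str M X Y) = Tob M (X \<otimes> Y)"
  using str_hom[of X Y] by (simp_all add: hom_iff)

lemma ext_eta_id [simp]: "ext M X (eta M X) = idm C (Tob M X)"
  by (rule ext_eta)

lemma ext_cmp_eta [simp]: "Cod C f = Tob M Y \<Longrightarrow> Dom C f = X \<Longrightarrow> ext M Y f \<cdot> eta M X = f"
  by (rule ext_unit) (simp add: hom_iff)

lemma ext_cmp_eta_cmp [simp]:
  "Cod C f = Tob M Y \<Longrightarrow> Dom C f = X \<Longrightarrow> Cod C h = X \<Longrightarrow> ext M Y f \<cdot> (eta M X \<cdot> h) = f \<cdot> h"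
  by (rule cmp_eq) simp_all

text \<open>Oriented so that nested extensions collapse into one; both sides of an Elgot law then
  reduce to extensions of copairs that can be compared directly.\<close>

lemma ext_cmp_ext [simp]:
  "Cod C f = Tob M Y \<Longrightarrow> Dom C g = Y \<Longrightarrow> Cod C g = Tob M Z \<Longrightarrow> ext M Z g \<cdot> ext M Y f = ext M Z (ext M Z g \<cdot> f)"
  by (rule ext_ext[symmetric]) (auto simp: hom_iff)

lemma ext_cmp_ext_cmp [simp]:
  "Cod C f = Tob M Y \<Longrightarrow> Dom C g = Y \<Longrightarrow> Cod C g = Tob M Z \<Longrightarrow> Cod C h = Tob M (Dom C f) \<Longrightarrow>
    ext M Z g \<cdot> (ext M Y f \<cdot> h) = ext M Z (ext M Z g \<cdot> f) \<cdot> h"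
  by (rule cmp_eq) simp_all

lemma Tmap_eq [simp]: "Cod C f = Y \<Longrightarrow> Tmap C M f = ext M Y (eta M Y \<cdot> f)"
  by (simp add: Tmap_def)

lemma str_pairing_eta [simp]:
  assumes "Dom C a = Dom C b" "Cod C a = X" "Cod C b = Y"
  shows "str M X Y \<cdot> pairing C a (eta M Y \<cdot> b) = eta M (X \<otimes> Y) \<cdot> pairing C a b"
  using cmp_eq[OF str_eta[of X Y], of "pairing C a b"] assms by simp

text \<open>\<open>ext M Z k\<close> is the multiplication after \<open>Tmap C M k\<close>, so
  \<open>str_mult\<close> and naturality of the strength combine.\<close>

lemma str_ext:
  assumes k: "Dom C k = Y" "Cod C k = Tob M Z"
  shows "str M X Z \<cdot> (idm C X \<otimes>\<^sub>m ext M Z k) = ext M (X \<otimes> Z) (str M X Z \<cdot> (idm C X \<otimes>\<^sub>m k)) \<cdot> str M X Y"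
proof -
  have "idm C X \<otimes>\<^sub>m ext M Z k = (idm C X \<otimes>\<^sub>m ext M Z (idm C (Tob M Z))) \<cdot> (idm C X \<otimes>\<^sub>m Tmap C M k)"
    using k by simp
  also have "str M X Z \<cdot> \<dots> = (str M X Z \<cdot> (idm C X \<otimes>\<^sub>m ext M Z (idm C (Tob M Z)))) \<cdot> (idm C X \<otimes>\<^sub>m Tmap C M k)"
    using k by (intro assoc[symmetric]) simp_all
  also have "\<dots> = ext M (X \<otimes> Z) (str M X Z) \<cdot> (str M X (Tob M Z) \<cdot> (idm C X \<otimes>\<^sub>m Tmap C M k))"
    unfolding str_mult using k by (intro assoc) simp_all
  also have "str M X (Tob M Z) \<cdot> (idm C X \<otimes>\<^sub>m Tmap C M k) = Tmap C M (idm C X \<otimes>\<^sub>m k) \<cdot> str M X Y"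
    by (rule str_natural) (simp_all add: hom_iff k)
  also have "ext M (X \<otimes> Z) (str M X Z) \<cdot> \<dots> = ext M (X \<otimes> Z) (str M X Z \<cdot> (idm C X \<otimes>\<^sub>m k)) \<cdot> str M X Y"
    using k by simp
  finally show ?thesis .
qed

text \<open>\<open>str_unit\<close> is the case \<open>X = \<one>\<close>; naturality of the
  strength along \<open>bang C X\<close> reaches every other \<open>X\<close>.\<close>

lemma Tmap_prr_str: "ext M Y (eta M Y \<cdot> prr C X Y) \<cdot> str M X Y = prr C X (Tob M Y)"
proof -
  have nat: "str M \<one> Y \<cdot> (bang C X \<otimes>\<^sub>m Tmap C M (idm C Y)) = Tmap C M (bang C X \<otimes>\<^sub>m idm C Y) \<cdot> str M X Y"
    by (rule str_natural) (simp_all add: hom_iff)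
  have "ext M Y (eta M Y \<cdot> prr C X Y) \<cdot> str M X Y
      = Tmap C M (prr C \<one> Y) \<cdot> (Tmap C M (bang C X \<otimes>\<^sub>m idm C Y) \<cdot> str M X Y)" by simp
  also have "\<dots> = Tmap C M (prr C \<one> Y) \<cdot> (str M \<one> Y \<cdot> (bang C X \<otimes>\<^sub>m Tmap C M (idm C Y)))" by (simp only: nat)
  also have "\<dots> = prr C \<one> (Tob M Y) \<cdot> (bang C X \<otimes>\<^sub>m Tmap C M (idm C Y))"
    by (rule cmp_eq[OF str_unit]) simp_all
  finally show ?thesis by simp
qed

end

section \<open>Monotonicity and bottoms in an \<open>\<omega>\<close>-continuous monad\<close>

locale omega_kleisli = hyperextensive_bicart C + omega_continuous_monad C M le
  for C :: "('o, 'a, 'm) bicart_scheme" (structure) and M :: "('o, 'a, 'n) smonad_scheme" and le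
begin

sublocale kleisli C M ..

lemma order_props:
  "reflp_on (hom C X (Tob M Y)) (le Y)" "transp_on (hom C X (Tob M Y)) (le Y)" "antisymp_on (hom C X (Tob M Y)) (le Y)"
  using kleisli_omega_cpo[of X Y] unfolding omega_cpo_bot_def by blast+

lemma le_refl: "f \<in> hom C X (Tob M Y) \<Longrightarrow> le Y f f"
  and le_trans: "f \<in> hom C X (Tob M Y) \<Longrightarrow> g \<in> hom C X (Tob M Y) \<Longrightarrow> h \<in> hom C X (Tob M Y) \<Longrightarrow>
    le Y f g \<Longrightarrow> le Y g h \<Longrightarrow> le Y f h"
  and le_antisym: "f \<in> hom C X (Tob M Y) \<Longrightarrow> g \<in> hom C X (Tob M Y) \<Longrightarrow> le Y f g \<Longrightarrow> le Y g f \<Longrightarrow> f = g"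
  using reflp_onD[OF order_props(1)] transp_onD[OF order_props(2)] antisymp_onD[OF order_props(3)] by blast+

lemma lub_exists: "omega_chain (hom C X (Tob M Y)) (le Y) F \<Longrightarrow> \<exists>s. is_lub (hom C X (Tob M Y)) (le Y) F s"
  and bottom_exists: "\<exists>b. is_bottom (hom C X (Tob M Y)) (le Y) b"
  using kleisli_omega_cpo[of X Y] unfolding omega_cpo_bot_def by blast+

lemma lub_unique:
  "is_lub (hom C X (Tob M Y)) (le Y) F s \<Longrightarrow> is_lub (hom C X (Tob M Y)) (le Y) F t \<Longrightarrow> s = t"
  unfolding is_lub_def by (rule le_antisym[of s X Y t]) blast+

lemma bottom_unique:
  "is_bottom (hom C X (Tob M Y)) (le Y) a \<Longrightarrow> is_bottom (hom C X (Tob M Y)) (le Y) b \<Longrightarrow> a = b"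
  unfolding is_bottom_def by (rule le_antisym[of a X Y b]) blast+

text \<open>Encodes \<open>f \<le> g\<close> as the chain \<open>f, g, g, ...\<close>. Monotonicity
  of an operation is then its continuity on this chain, read at index 0.\<close>

lemma le_chain:
  assumes "f \<in> hom C X (Tob M Y)" "g \<in> hom C X (Tob M Y)" "le Y f g"
  shows "omega_chain (hom C X (Tob M Y)) (le Y) (case_nat f (\<lambda>_. g))"
    and "is_lub (hom C X (Tob M Y)) (le Y) (case_nat f (\<lambda>_. g)) g"
proof -
  show "omega_chain (hom C X (Tob M Y)) (le Y) (case_nat f (\<lambda>_. g))"
    using assms le_refl[OF assms(2)] by (auto simp: omega_chain_def split: nat.split)
  show "is_lub (hom C X (Tob M Y)) (le Y) (case_nat f (\<lambda>_. g)) g"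
    unfolding is_lub_def
  proof (intro conjI allI ballI impI)
    fix u assume "\<forall>i. le Y (case_nat f (\<lambda>_. g) i) u"
    from this[rule_format, of 1] show "le Y g u" by simp
  next
    fix i show "le Y (case_nat f (\<lambda>_. g) i) g" using assms(3) le_refl[OF assms(2)] by (cases i) simp_all
  qed (rule assms)
qed

lemma lub_upper: "is_lub A l F s \<Longrightarrow> l (F i) s"
  by (simp add: is_lub_def)

lemma ext_mono_left:
  assumes "g \<in> hom C Y (Tob M Z)" "g' \<in> hom C Y (Tob M Z)" "le Z g g'" "f \<in> hom C X (Tob M Y)"
  shows "le Z (ext M Z g \<cdot> f) (ext M Z g' \<cdot> f)"
  using lub_upper[OF kleisli_cont_left[OF le_chain[OF assms(1-3)] assms(4)], of 0] by simp

lemma copair_mono: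
  assumes "f \<in> hom C X (Tob M Z)" "f' \<in> hom C X (Tob M Z)" "le Z f f'"
    and "g \<in> hom C Y (Tob M Z)" "g' \<in> hom C Y (Tob M Z)" "le Z g g'"
  shows "le Z \<lblot>f, g\<rblot> \<lblot>f', g'\<rblot>"
  using lub_upper[OF copair_cont[OF le_chain[OF assms(1-3)] le_chain[OF assms(4-6)]], of 0] by simp

text \<open>\<open>F i \<cdot> h\<close> is the Kleisli composite of \<open>F i\<close> with
  \<open>eta M X \<cdot> h\<close>, so continuity in the left argument applies.\<close>

lemma cmp_cont:
  assumes "omega_chain (hom C X (Tob M Y)) (le Y) F" "is_lub (hom C X (Tob M Y)) (le Y) F s" "Dom C h = W" "Cod C h = X"
  shows "is_lub (hom C W (Tob M Y)) (le Y) (\<lambda>i. F i \<cdot> h) (s \<cdot> h)"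
proof -
  have d: "Dom C (F i) = X" "Cod C (F i) = Tob M Y" "Dom C s = X" "Cod C s = Tob M Y" for i
    using assms(1,2) by (simp_all add: omega_chain_def is_lub_def hom_iff)
  show ?thesis
    using kleisli_cont_left[OF assms(1,2), of "eta M X \<cdot> h" W] assms(3,4) d by (simp add: hom_iff)
qed

lemma cmp_mono:
  assumes "f \<in> hom C X (Tob M Y)" "f' \<in> hom C X (Tob M Y)" "le Y f f'" "Dom C h = W" "Cod C h = X"
  shows "le Y (f \<cdot> h) (f' \<cdot> h)"
  using lub_upper[OF cmp_cont[OF le_chain[OF assms(1-3)] assms(4,5)], of 0] by simp

text \<open>Chosen only at \<open>\<one>\<close>: the bottoms at all other objects will be its
  composites with \<open>bang\<close>, which makes them visibly stable under precomposition.\<close>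

definition bottom :: "'o \<Rightarrow> 'a" where
  "bottom Y = (THE b. is_bottom (hom C \<one> (Tob M Y)) (le Y) b)"

lemma bot_bottom: "is_bottom (hom C \<one> (Tob M Y)) (le Y) (bottom Y)"
proof -
  obtain b where b: "is_bottom (hom C \<one> (Tob M Y)) (le Y) b" using bottom_exists by blast
  show ?thesis unfolding bottom_def by (rule theI[of _ b]) (fact b, rule bottom_unique[OF _ b])
qed

lemma dom_bot [simp]: "Dom C (bottom Y) = \<one>" and cod_bot [simp]: "Cod C (bottom Y) = Tob M Y"
  using bot_bottom[of Y] by (simp_all add: is_bottom_def hom_iff)

text \<open>Precomposition preserves bottoms: the bottom at \<open>X\<close> is, by compatibility with the strength,
  the bottom at \<open>X \<otimes> \<one>\<close> transported along \<open>X \<cong> X \<otimes> \<one>\<close>, hence it factors through \<open>\<one>\<close>.\<close>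

lemma bot_bang_bottom: "is_bottom (hom C X (Tob M Y)) (le Y) (bottom Y \<cdot> bang C X)"
  unfolding is_bottom_def
proof (intro conjI ballI)
  show "bottom Y \<cdot> bang C X \<in> hom C X (Tob M Y)" by (simp add: hom_iff)
  fix u assume u: "u \<in> hom C X (Tob M Y)"
  have "is_bottom (hom C (X \<otimes> \<one>) (Tob M Y)) (le Y)
      (ext M Y (eta M Y \<cdot> prr C X Y) \<cdot> (str M X Y \<cdot> (idm C X \<otimes>\<^sub>m bottom Y)))"
    by (rule ext_bottom[OF str_bottom[OF bot_bottom]]) (simp add: hom_iff)
  moreover have "ext M Y (eta M Y \<cdot> prr C X Y) \<cdot> (str M X Y \<cdot> (idm C X \<otimes>\<^sub>m bottom Y)) = bottom Y \<cdot> prr C X \<one>"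
    using cmp_eq[OF Tmap_prr_str[of Y X], of "idm C X \<otimes>\<^sub>m bottom Y"] by simp
  ultimately have "is_bottom (hom C (X \<otimes> \<one>) (Tob M Y)) (le Y) (bottom Y \<cdot> prr C X \<one>)" by simp
  then have "le Y (bottom Y \<cdot> prr C X \<one>) (u \<cdot> prl C X \<one>)"
    using u by (simp add: is_bottom_def hom_iff)
  then have "le Y ((bottom Y \<cdot> prr C X \<one>) \<cdot> pairing C (idm C X) (bang C X)) ((u \<cdot> prl C X \<one>) \<cdot> pairing C (idm C X) (bang C X))"
    by (rule cmp_mono[rotated 2]) (use u in \<open>simp_all add: hom_iff\<close>)
  then show "le Y (bottom Y \<cdot> bang C X) u" using u by (simp add: hom_iff)
qed

lemma bottom_eq: "is_bottom (hom C X (Tob M Y)) (le Y) b \<Longrightarrow> b = bottom Y \<cdot> bang C X"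
  by (rule bottom_unique[OF _ bot_bang_bottom])

lemma ext_bot [simp]:
  assumes "Dom C f = Y" "Cod C f = Tob M Z" shows "ext M Z f \<cdot> bottom Y = bottom Z"
  using bottom_eq[OF ext_bottom[OF bot_bottom, of f Y Z]] assms by (simp add: hom_iff)

lemma ext_bot_cmp [simp]:
  assumes "Dom C f = Y" "Cod C f = Tob M Z" "Cod C h = \<one>" shows "ext M Z f \<cdot> (bottom Y \<cdot> h) = bottom Z \<cdot> h"
  using cmp_eq[OF ext_bot[OF assms(1,2)], of h] assms by simp

lemma str_bot: "str M X Y \<cdot> (idm C X \<otimes>\<^sub>m (bottom Y \<cdot> bang C W)) = bottom (X \<otimes> Y) \<cdot> bang C (X \<otimes> W)"
  by (rule bottom_eq[OF str_bottom[OF bot_bang_bottom]])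

section \<open>Kleene approximations and least iterates\<close>

primrec kleene :: "'o \<Rightarrow> 'a \<Rightarrow> nat \<Rightarrow> 'a" where
  "kleene Y f 0 = bottom Y \<cdot> bang C (Dom C f)"
| "kleene Y f (Suc n) = ext M Y \<lblot>eta M Y, kleene Y f n\<rblot> \<cdot> f"

lemma kleene_hom [simp]:
  assumes "Dom C f = X" "Cod C f = Tob M (Y \<oplus> X)"
  shows "Dom C (kleene Y f n) = X" "Cod C (kleene Y f n) = Tob M Y"
  by (induction n) (simp_all add: assms)

lemma step_mono:
  assumes "f \<in> hom C X (Tob M (Y \<oplus> X))" "h \<in> hom C X (Tob M Y)" "k \<in> hom C X (Tob M Y)" "le Y h k"
  shows "le Y (ext M Y \<lblot>eta M Y, h\<rblot> \<cdot> f) (ext M Y \<lblot>eta M Y, k\<rblot> \<cdot> f)"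
proof (rule ext_mono_left)
  have e: "eta M Y \<in> hom C Y (Tob M Y)" by (rule eta_hom)
  show "le Y \<lblot>eta M Y, h\<rblot> \<lblot>eta M Y, k\<rblot>"
    by (rule copair_mono[OF e e le_refl[OF e] assms(2-4)])
qed (use assms in \<open>auto simp: hom_iff\<close>)

lemma kleene_chain:
  assumes "f \<in> hom C X (Tob M (Y \<oplus> X))"
  shows "omega_chain (hom C X (Tob M Y)) (le Y) (kleene Y f)"
proof -
  have k: "kleene Y f n \<in> hom C X (Tob M Y)" for n using assms by (simp add: hom_iff)
  have "le Y (kleene Y f n) (kleene Y f (Suc n))" for n
  proof (induction n)
    case 0
    have "Dom C f = X" using assms by (simp add: hom_iff)
    then show ?case using bot_bang_bottom[of X Y] k[of 1] by (simp add: is_bottom_def)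
  next
    case (Suc n)
    show ?case using step_mono[OF assms k k Suc] by simp
  qed
  then show ?thesis using k by (simp add: omega_chain_def)
qed

text \<open>Stated for prefixed points because the codiagonal law, through
  \<open>dag_le_prefixed\<close>, compares an iterate with an arrow not yet known to be a
  fixpoint.\<close>

lemma kleene_le:
  assumes f: "f \<in> hom C X (Tob M (Y \<oplus> X))" and k: "k \<in> hom C X (Tob M Y)"
    and le: "le Y (ext M Y \<lblot>eta M Y, k\<rblot> \<cdot> f) k"
  shows "le Y (kleene Y f n) k"
proof (induction n)
  case 0
  then show ?case using bot_bang_bottom[of X Y] f k by (simp add: is_bottom_def hom_iff)
next
  case (Suc n)
  have "le Y (ext M Y \<lblot>eta M Y, kleene Y f n\<rblot> \<cdot> f) (ext M Y \<lblot>eta M Y, k\<rblot> \<cdot> f)"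
    by (rule step_mono[OF f _ k Suc]) (use f in \<open>simp add: hom_iff\<close>)
  then have "le Y (ext M Y \<lblot>eta M Y, kleene Y f n\<rblot> \<cdot> f) k"
    by (rule le_trans[rotated 3, OF _ le]) (use f k in \<open>simp_all add: hom_iff\<close>)
  then show ?case by simp
qed

text \<open>By continuity one more step sends \<open>s\<close> to the supremum of the shifted chain,
  and dropping the first member of a chain does not change its supremum.\<close>

lemma kleene_lub_fixpoint:
  assumes f: "f \<in> hom C X (Tob M (Y \<oplus> X))" and s: "is_lub (hom C X (Tob M Y)) (le Y) (kleene Y f) s"
  shows "ext M Y \<lblot>eta M Y, s\<rblot> \<cdot> f = s"
proof -
  have e: "eta M Y \<in> hom C Y (Tob M Y)" by (rule eta_hom)
  have ec: "omega_chain (hom C Y (Tob M Y)) (le Y) (\<lambda>_. eta M Y)" "is_lub (hom C Y (Tob M Y)) (le Y) (\<lambda>_. eta M Y) (eta M Y)"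
    using e le_refl[OF e] by (auto simp: omega_chain_def is_lub_def)
  have k: "le Y (kleene Y f n) (kleene Y f (Suc n))" "kleene Y f n \<in> hom C X (Tob M Y)" for n
    using kleene_chain[OF f] unfolding omega_chain_def by blast+
  have ch: "omega_chain (hom C (Y \<oplus> X) (Tob M Y)) (le Y) (\<lambda>n. \<lblot>eta M Y, kleene Y f n\<rblot>)"
    unfolding omega_chain_def
  proof (intro conjI allI)
    show "le Y \<lblot>eta M Y, kleene Y f n\<rblot> \<lblot>eta M Y, kleene Y f (Suc n)\<rblot>" for n
      by (rule copair_mono[OF e e le_refl[OF e] k(2) k(2) k(1)])
    show "\<lblot>eta M Y, kleene Y f n\<rblot> \<in> hom C (Y \<oplus> X) (Tob M Y)" for n
      using k(2)[of n] by (simp add: hom_iff)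
  qed
  have l: "is_lub (hom C X (Tob M Y)) (le Y) (\<lambda>n. kleene Y f (Suc n)) (ext M Y \<lblot>eta M Y, s\<rblot> \<cdot> f)"
    using kleisli_cont_left[OF ch copair_cont[OF ec kleene_chain[OF f] s] f] by simp
  have "is_lub (hom C X (Tob M Y)) (le Y) (\<lambda>n. kleene Y f (Suc n)) s"
    unfolding is_lub_def
  proof (intro conjI allI ballI impI)
    show "s \<in> hom C X (Tob M Y)" "le Y (kleene Y f (Suc n)) s" for n using s unfolding is_lub_def by blast+
    fix u assume u: "u \<in> hom C X (Tob M Y)" "\<forall>n. le Y (kleene Y f (Suc n)) u"
    have "le Y (kleene Y f n) u" for n
      by (rule le_trans[OF k(2) k(2) u(1) k(1) u(2)[rule_format]])
    then show "le Y s u" using s u(1) unfolding is_lub_def by blast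
  qed
  then show ?thesis using lub_unique[OF l] by simp
qed

lemma least_iterate_unique:
  assumes "f \<in> hom C X (Tob M (Y \<oplus> X))" "is_least_iterate C M le Y f h" "is_least_iterate C M le Y f k"
  shows "h = k"
proof (rule le_antisym)
  show "h \<in> hom C (Dom C f) (Tob M Y)" "k \<in> hom C (Dom C f) (Tob M Y)" "le Y h k" "le Y k h"
    using assms(2,3) unfolding is_least_iterate_def by blast+
qed

lemma kleene_lub_least_iterate:
  assumes f: "f \<in> hom C X (Tob M (Y \<oplus> X))" and s: "is_lub (hom C X (Tob M Y)) (le Y) (kleene Y f) s"
  shows "is_least_iterate C M le Y f s"
  unfolding is_least_iterate_def
proof (intro conjI ballI impI)
  have d: "Dom C f = X" using f by (simp add: hom_iff)
  show "s \<in> hom C (Dom C f) (Tob M Y)" using s d by (simp add: is_lub_def)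
  show "ext M Y \<lblot>eta M Y, s\<rblot> \<cdot> f = s" by (rule kleene_lub_fixpoint[OF f s])
  fix k assume k: "k \<in> hom C (Dom C f) (Tob M Y)" "ext M Y \<lblot>eta M Y, k\<rblot> \<cdot> f = k"
  have "le Y (kleene Y f n) k" for n
    by (rule kleene_le[OF f]) (use k d le_refl[OF k(1)] in simp_all)
  then show "le Y s k" using s k(1) d by (simp add: is_lub_def)
qed

lemma least_iterate_ex1:
  assumes f: "f \<in> hom C X (Tob M (Y \<oplus> X))"
  shows "\<exists>!h. is_least_iterate C M le Y f h"
proof -
  obtain s where "is_lub (hom C X (Tob M Y)) (le Y) (kleene Y f) s"
    using lub_exists[OF kleene_chain[OF f]] by blast
  then show ?thesis using kleene_lub_least_iterate[OF f] least_iterate_unique[OF f] by blast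
qed

lemma least_iterate_kleene_lub:
  assumes f: "f \<in> hom C X (Tob M (Y \<oplus> X))" and h: "is_least_iterate C M le Y f h"
  shows "is_lub (hom C X (Tob M Y)) (le Y) (kleene Y f) h"
proof -
  obtain s where s: "is_lub (hom C X (Tob M Y)) (le Y) (kleene Y f) s"
    using lub_exists[OF kleene_chain[OF f]] by blast
  then show ?thesis using least_iterate_unique[OF f h kleene_lub_least_iterate[OF f s]] by simp
qed

end

section \<open>The Elgot laws for least iterates\<close>

locale omega_elgot = omega_kleisli C M le
  for C :: "('o, 'a, 'm) bicart_scheme" (structure) and M :: "('o, 'a, 'n) elgot_scheme" and le +
  assumes dag_least: "f \<in> hom C X (Tob M (Y \<oplus> X)) \<Longrightarrow> is_least_iterate C M le Y f (dag M Y f)"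
begin

lemma dag_kleene_lub:
  assumes "f \<in> hom C X (Tob M (Y \<oplus> X))"
  shows "is_lub (hom C X (Tob M Y)) (le Y) (kleene Y f) (dag M Y f)"
  by (rule least_iterate_kleene_lub[OF assms dag_least[OF assms]])

lemma dag_eqI:
  assumes "f \<in> hom C X (Tob M (Y \<oplus> X))" "is_lub (hom C X (Tob M Y)) (le Y) (kleene Y f) s"
  shows "s = dag M Y f"
  by (rule lub_unique[OF assms(2) dag_kleene_lub[OF assms(1)]])

lemma dom_dag [simp]: "Dom C f = X \<Longrightarrow> Cod C f = Tob M (Y \<oplus> X) \<Longrightarrow> Dom C (dag M Y f) = X"
  and cod_dag [simp]: "Dom C f = X \<Longrightarrow> Cod C f = Tob M (Y \<oplus> X) \<Longrightarrow> Cod C (dag M Y f) = Tob M Y"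
  using dag_least[of f X Y] by (simp_all add: is_least_iterate_def hom_iff)

lemma dag_fix: "Dom C f = X \<Longrightarrow> Cod C f = Tob M (Y \<oplus> X) \<Longrightarrow> ext M Y \<lblot>eta M Y, dag M Y f\<rblot> \<cdot> f = dag M Y f"
  using dag_least[of f X Y] by (simp add: is_least_iterate_def hom_iff)

lemma dag_le:
  assumes "Dom C f = X" "Cod C f = Tob M (Y \<oplus> X)" "Dom C k = X" "Cod C k = Tob M Y"
    and "ext M Y \<lblot>eta M Y, k\<rblot> \<cdot> f = k"
  shows "le Y (dag M Y f) k"
  using dag_least[of f X Y] assms by (simp add: is_least_iterate_def hom_iff)

lemma dag_le_prefixed:
  assumes "Dom C f = X" "Cod C f = Tob M (Y \<oplus> X)" "Dom C k = X" "Cod C k = Tob M Y"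
    and "le Y (ext M Y \<lblot>eta M Y, k\<rblot> \<cdot> f) k"
  shows "le Y (dag M Y f) k"
proof -
  have f: "f \<in> hom C X (Tob M (Y \<oplus> X))" and k: "k \<in> hom C X (Tob M Y)" using assms(1-4) by (simp_all add: hom_iff)
  have "le Y (kleene Y f n) k" for n by (rule kleene_le[OF f k assms(5)])
  then show ?thesis using dag_kleene_lub[OF f] k by (simp add: is_lub_def)
qed

text \<open>The approximations of the two sides correspond index by index, starting from
  \<open>ext_bot\<close>, and continuity carries this over to the suprema.\<close>

lemma dag_naturality:
  assumes f: "Dom C f = X" "Cod C f = Tob M (Y \<oplus> X)" and g: "Dom C g = Y" "Cod C g = Tob M Z"
  shows "ext M Z g \<cdot> dag M Y f =
       dag M Z (ext M (Z \<oplus> X) \<lblot>Tmap C M (inl C Z X) \<cdot> g, eta M (Z \<oplus> X) \<cdot> inr C Z X\<rblot> \<cdot> f)" (is "_ = dag M Z ?f")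
proof (rule dag_eqI)
  show "?f \<in> hom C X (Tob M (Z \<oplus> X))" using f g by (simp add: hom_iff)
  have "kleene Z ?f n = ext M Z g \<cdot> kleene Y f n" for n
  proof (induction n)
    case 0
    then show ?case using f g by simp
  next
    case (Suc n)
    then show ?case using f g by simp
  qed
  then have k: "kleene Z ?f = (\<lambda>n. ext M Z g \<cdot> kleene Y f n)" by (rule ext)
  have f': "f \<in> hom C X (Tob M (Y \<oplus> X))" "g \<in> hom C Y (Tob M Z)" using f g by (simp_all add: hom_iff)
  show "is_lub (hom C X (Tob M Z)) (le Z) (kleene Z ?f) (ext M Z g \<cdot> dag M Y f)"
    unfolding k by (rule kleisli_cont_right[OF kleene_chain[OF f'(1)] dag_kleene_lub[OF f'(1)] f'(2)])
qed

text \<open>Again an index-by-index correspondence; it starts because bottoms factor through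
  \<open>\<one>\<close> and so are preserved by precomposition with \<open>h\<close>.\<close>

lemma dag_uniformity:
  assumes f: "Dom C f = X" "Cod C f = Tob M (Y \<oplus> X)" and g: "Dom C g = Z" "Cod C g = Tob M (Y \<oplus> Z)"
    and h: "Dom C h = Z" "Cod C h = X" and eq: "f \<cdot> h = Tmap C M (idm C Y \<oplus>\<^sub>m h) \<cdot> g"
  shows "dag M Y f \<cdot> h = dag M Y g"
proof (rule dag_eqI)
  show "g \<in> hom C Z (Tob M (Y \<oplus> Z))" using g by (simp add: hom_iff)
  have eq': "f \<cdot> h = ext M (Y \<oplus> X) \<lblot>eta M (Y \<oplus> X) \<cdot> inl C Y X, eta M (Y \<oplus> X) \<cdot> (inr C Y X \<cdot> h)\<rblot> \<cdot> g"
    using eq h by (simp add: sum_map_def)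
  have "kleene Y g n = kleene Y f n \<cdot> h" for n
  proof (induction n)
    case 0
    then show ?case using f g h by simp
  next
    case (Suc n)
    have "kleene Y f (Suc n) \<cdot> h = ext M Y \<lblot>eta M Y, kleene Y f n\<rblot> \<cdot> (f \<cdot> h)" using f h by simp
    then show ?case using f(1,2) g h Suc by (simp add: eq')
  qed
  then have k: "kleene Y g = (\<lambda>n. kleene Y f n \<cdot> h)" by (rule ext)
  have f': "f \<in> hom C X (Tob M (Y \<oplus> X))" using f by (simp add: hom_iff)
  show "is_lub (hom C Z (Tob M Y)) (le Y) (kleene Y g) (dag M Y f \<cdot> h)"
    unfolding k by (rule cmp_cont[OF kleene_chain[OF f'] dag_kleene_lub[OF f'] h])
qed

text \<open>Two comparisons of the simple iterate \<open>a\<close> with the nested iterate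
  \<open>b\<close>. Unfolding the inner iterate \<open>d\<close> once makes \<open>b\<close> a
  solution of the simple equation, so \<open>a \<le> b\<close>; conversely \<open>a\<close> is a
  prefixed point for \<open>d\<close>.\<close>

lemma dag_codiagonal:
  assumes g: "Dom C g = X" "Cod C g = Tob M ((Y \<oplus> X) \<oplus> X)"
  shows "dag M Y (Tmap C M \<lblot>idm C (Y \<oplus> X), inr C Y X\<rblot> \<cdot> g) = dag M Y (dag M (Y \<oplus> X) g)" (is "dag M Y ?f = dag M Y ?d")
proof (rule le_antisym)
  define a b d where "a = dag M Y ?f" "b = dag M Y ?d" "d = ?d"
  note defs = this
  have f: "Dom C ?f = X" "Cod C ?f = Tob M (Y \<oplus> X)" using g by simp_all
  have d: "Dom C d = X" "Cod C d = Tob M (Y \<oplus> X)" using g by (simp_all add: defs)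
  have a: "Dom C a = X" "Cod C a = Tob M Y" unfolding defs using f by (simp_all only: dom_dag cod_dag)
  have b: "Dom C b = X" "Cod C b = Tob M Y" unfolding defs using d by (simp_all only: dom_dag cod_dag defs)
  have dfix: "ext M (Y \<oplus> X) \<lblot>eta M (Y \<oplus> X), d\<rblot> \<cdot> g = d" unfolding defs by (rule dag_fix) (use g in simp_all)
  have afix: "ext M Y \<lblot>\<lblot>eta M Y, a\<rblot>, a\<rblot> \<cdot> g = a"
  proof -
    have "ext M Y \<lblot>eta M Y, a\<rblot> \<cdot> ?f = a" using dag_fix[OF f] by (simp only: defs)
    then show ?thesis using a g by simp
  qed
  have bfix: "ext M Y \<lblot>eta M Y, b\<rblot> \<cdot> d = b" using dag_fix[OF d] by (simp add: defs)
  have "ext M Y \<lblot>eta M Y, b\<rblot> \<cdot> (ext M (Y \<oplus> X) \<lblot>eta M (Y \<oplus> X), d\<rblot> \<cdot> g) = b" by (simp only: dfix bfix)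
  then have "ext M Y \<lblot>\<lblot>eta M Y, b\<rblot>, b\<rblot> \<cdot> g = b" using b d g bfix by simp
  then have "le Y a b" unfolding defs(1)
    by (intro dag_le[OF f]) (use b g in simp_all)
  then show "le Y (dag M Y ?f) (dag M Y ?d)" by (simp only: defs)
  \<comment> \<open>By naturality the left side is itself an iterate, with \<open>a\<close>
    substituted for the outer loop variable in \<open>g\<close>. By \<open>afix\<close>,
    \<open>a\<close> solves that equation, so the least solution is below it.\<close>
  have "le Y (ext M Y \<lblot>eta M Y, a\<rblot> \<cdot> d) a"
  proof -
    have "ext M Y \<lblot>eta M Y, a\<rblot> \<cdot> d = dag M Y (ext M (Y \<oplus> X) \<lblot>Tmap C M (inl C Y X) \<cdot> \<lblot>eta M Y, a\<rblot>, eta M (Y \<oplus> X) \<cdot> inr C Y X\<rblot> \<cdot> g)"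
      unfolding defs(3) by (rule dag_naturality) (use a g in simp_all)
    also have "le Y \<dots> a" by (rule dag_le) (use a g afix in simp_all)
    finally show ?thesis .
  qed
  then have "le Y b a" unfolding defs(2) defs(3)[symmetric]
    by (intro dag_le_prefixed[OF d a])
  then show "le Y (dag M Y ?d) (dag M Y ?f)" by (simp only: defs)
  show "dag M Y ?f \<in> hom C X (Tob M Y)" "dag M Y ?d \<in> hom C X (Tob M Y)"
    using a b by (simp_all only: defs hom_iff)
qed

text \<open>The rolling argument: \<open>?c\<close> solves the equation of \<open>?p\<close> and
  \<open>?d\<close> that of \<open>?q\<close>, so \<open>a \<le> ?c\<close> and
  \<open>b \<le> ?d\<close>. Substituting the second inequality into \<open>g\<close> gives
  \<open>?c \<le> a\<close>, since \<open>a\<close> is a fixpoint.\<close>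

lemma dag_dinaturality:
  assumes g: "Dom C g = X" "Cod C g = Tob M (Y \<oplus> Z)" and h: "Dom C h = Z" "Cod C h = Tob M (Y \<oplus> X)"
  shows "dag M Y (ext M (Y \<oplus> X) \<lblot>eta M (Y \<oplus> X) \<cdot> inl C Y X, h\<rblot> \<cdot> g) =
       ext M Y \<lblot>eta M Y, dag M Y (ext M (Y \<oplus> Z) \<lblot>eta M (Y \<oplus> Z) \<cdot> inl C Y Z, g\<rblot> \<cdot> h)\<rblot> \<cdot> g"
    (is "dag M Y ?p = ext M Y \<lblot>eta M Y, dag M Y ?q\<rblot> \<cdot> g")
proof -
  \<comment> \<open>Kept general in \<open>g\<close>, \<open>h\<close>, \<open>X\<close> and
    \<open>Z\<close> because it is used a second time with the two arrows interchanged.\<close>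
  have step: "ext M Y \<lblot>eta M Y, ext M Y \<lblot>eta M Y, k\<rblot> \<cdot> g\<rblot> \<cdot> (ext M (Y \<oplus> X) \<lblot>eta M (Y \<oplus> X) \<cdot> inl C Y X, h\<rblot> \<cdot> g)
      = ext M Y \<lblot>eta M Y, ext M Y \<lblot>eta M Y, k\<rblot> \<cdot> (ext M (Y \<oplus> Z) \<lblot>eta M (Y \<oplus> Z) \<cdot> inl C Y Z, g\<rblot> \<cdot> h)\<rblot> \<cdot> g"
    if "Dom C k = Z" "Cod C k = Tob M Y" "Dom C g = X" "Cod C g = Tob M (Y \<oplus> Z)" "Dom C h = Z" "Cod C h = Tob M (Y \<oplus> X)"
    for k g h X Z using that by simp
  define a b where "a = dag M Y ?p" "b = dag M Y ?q"
  note defs = this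
  have p: "Dom C ?p = X" "Cod C ?p = Tob M (Y \<oplus> X)" and q: "Dom C ?q = Z" "Cod C ?q = Tob M (Y \<oplus> Z)"
    using g h by simp_all
  have a: "Dom C a = X" "Cod C a = Tob M Y" and b: "Dom C b = Z" "Cod C b = Tob M Y"
    unfolding defs using p q by (simp_all only: dom_dag cod_dag)
  let ?c = "ext M Y \<lblot>eta M Y, b\<rblot> \<cdot> g" and ?d = "ext M Y \<lblot>eta M Y, a\<rblot> \<cdot> h"
  have c: "Dom C ?c = X" "Cod C ?c = Tob M Y" and d: "Dom C ?d = Z" "Cod C ?d = Tob M Y"
    using a b g h by simp_all
  have "le Y a ?c"
    unfolding defs(1)
  proof (rule dag_le[OF p c])
    show "ext M Y \<lblot>eta M Y, ?c\<rblot> \<cdot> ?p = ?c"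
      using step[OF b g h] dag_fix[OF q] by (simp only: defs)
  qed
  moreover have "le Y b ?d"
    unfolding defs(2)
  proof (rule dag_le[OF q d])
    show "ext M Y \<lblot>eta M Y, ?d\<rblot> \<cdot> ?q = ?d"
      using step[OF a h g] dag_fix[OF p] by (simp only: defs)
  qed
  then have "le Y ?c (ext M Y \<lblot>eta M Y, ?d\<rblot> \<cdot> g)"
    by (rule ext_mono_left[OF _ _ copair_mono[OF eta_hom eta_hom le_refl[OF eta_hom]], rotated 4])
      (use a b g h in \<open>simp_all add: hom_iff\<close>)
  moreover have "ext M Y \<lblot>eta M Y, ?d\<rblot> \<cdot> g = a"
    using dag_fix[OF p] a g h unfolding defs(1)[symmetric] by simp
  ultimately show ?thesis unfolding defs[symmetric]
    by (intro le_antisym[of a X Y ?c]) (use a c in \<open>simp_all add: hom_iff del: dom_cmp cod_cmp\<close>)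
qed

lemma dag_strength:
  assumes f: "Dom C f = X" "Cod C f = Tob M (Y \<oplus> X)"
  shows "str M Z Y \<cdot> (idm C Z \<otimes>\<^sub>m dag M Y f) =
       dag M (Z \<otimes> Y) (Tmap C M (dist C Z Y X) \<cdot> str M Z (Y \<oplus> X) \<cdot> (idm C Z \<otimes>\<^sub>m f))" (is "_ = dag M (Z \<otimes> Y) ?f")
proof (rule dag_eqI)
  show "?f \<in> hom C (Z \<otimes> X) (Tob M (Z \<otimes> Y \<oplus> Z \<otimes> X))" using f by (simp add: hom_iff)
  have "kleene (Z \<otimes> Y) ?f n = str M Z Y \<cdot> (idm C Z \<otimes>\<^sub>m kleene Y f n)" for n
  proof (induction n)
    case 0
    then show ?case using f by (simp add: str_bot)
  next
    case (Suc n)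
    let ?k = "kleene Y f n"
    have k: "Dom C ?k = X" "Cod C ?k = Tob M Y" using f by simp_all
    \<comment> \<open>Removes \<open>dist\<close> from the next approximation, leaving the strength
      applied to a single copair, the shape that \<open>str_ext\<close> produces.\<close>
    have d: "\<lblot>eta M (Z \<otimes> Y), str M Z Y \<cdot> (idm C Z \<otimes>\<^sub>m ?k)\<rblot> \<cdot> dist C Z Y X = str M Z Y \<cdot> (idm C Z \<otimes>\<^sub>m \<lblot>eta M Y, ?k\<rblot>)"
      by (rule prod_sum_ext[of _ Z Y X]) (use k in \<open>simp_all add: prod_map_def\<close>)
    have "str M Z Y \<cdot> (idm C Z \<otimes>\<^sub>m kleene Y f (Suc n))
        = str M Z Y \<cdot> ((idm C Z \<otimes>\<^sub>m ext M Y \<lblot>eta M Y, ?k\<rblot>) \<cdot> (idm C Z \<otimes>\<^sub>m f))"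
      using k f by simp
    also have "\<dots> = (str M Z Y \<cdot> (idm C Z \<otimes>\<^sub>m ext M Y \<lblot>eta M Y, ?k\<rblot>)) \<cdot> (idm C Z \<otimes>\<^sub>m f)"
      using k f by (intro assoc[symmetric]) simp_all
    also have "str M Z Y \<cdot> (idm C Z \<otimes>\<^sub>m ext M Y \<lblot>eta M Y, ?k\<rblot>)
        = ext M (Z \<otimes> Y) (str M Z Y \<cdot> (idm C Z \<otimes>\<^sub>m \<lblot>eta M Y, ?k\<rblot>)) \<cdot> str M Z (Y \<oplus> X)"
      using k by (intro str_ext) simp_all
    finally show ?case
      using k f unfolding kleene.simps Suc d[symmetric] by simp
  qed
  then have k: "kleene (Z \<otimes> Y) ?f = (\<lambda>n. str M Z Y \<cdot> (idm C Z \<otimes>\<^sub>m kleene Y f n))" by (rule ext)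
  have f': "f \<in> hom C X (Tob M (Y \<oplus> X))" using f by (simp add: hom_iff)
  show "is_lub (hom C (Z \<otimes> X) (Tob M (Z \<otimes> Y))) (le (Z \<otimes> Y)) (kleene (Z \<otimes> Y) ?f) (str M Z Y \<cdot> (idm C Z \<otimes>\<^sub>m dag M Y f))"
    unfolding k by (rule str_cont[OF kleene_chain[OF f'] dag_kleene_lub[OF f']])
qed

lemma complete_elgot_monad: "complete_elgot_monad C M"
proof (rule complete_elgot_monad.intro[OF strong_monad_axioms], unfold_locales)
  fix X Y Z f g h
  show "f \<in> hom C X (Tob M (Y \<oplus> X)) \<Longrightarrow> dag M Y f \<in> hom C X (Tob M Y)"
    by (simp add: hom_iff)
  show "f \<in> hom C X (Tob M (Y \<oplus> X)) \<Longrightarrow> ext M Y \<lblot>eta M Y, dag M Y f\<rblot> \<cdot> f = dag M Y f"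
    by (rule dag_fix) (simp_all add: hom_iff)
  show "f \<in> hom C X (Tob M (Y \<oplus> X)) \<Longrightarrow> g \<in> hom C Y (Tob M Z) \<Longrightarrow>
       ext M Z g \<cdot> dag M Y f =
       dag M Z (ext M (Z \<oplus> X) \<lblot>Tmap C M (inl C Z X) \<cdot> g, eta M (Z \<oplus> X) \<cdot> inr C Z X\<rblot> \<cdot> f)"
    by (rule dag_naturality) (simp_all add: hom_iff)
  show "g \<in> hom C X (Tob M (Y \<oplus> Z)) \<Longrightarrow> h \<in> hom C Z (Tob M (Y \<oplus> X)) \<Longrightarrow>
       dag M Y (ext M (Y \<oplus> X) \<lblot>eta M (Y \<oplus> X) \<cdot> inl C Y X, h\<rblot> \<cdot> g) =
       ext M Y \<lblot>eta M Y, dag M Y (ext M (Y \<oplus> Z) \<lblot>eta M (Y \<oplus> Z) \<cdot> inl C Y Z, g\<rblot> \<cdot> h)\<rblot> \<cdot> g"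
    by (rule dag_dinaturality) (simp_all add: hom_iff)
  show "g \<in> hom C X (Tob M ((Y \<oplus> X) \<oplus> X)) \<Longrightarrow>
       dag M Y (Tmap C M \<lblot>idm C (Y \<oplus> X), inr C Y X\<rblot> \<cdot> g) = dag M Y (dag M (Y \<oplus> X) g)"
    by (rule dag_codiagonal) (simp_all add: hom_iff)
  show "f \<in> hom C X (Tob M (Y \<oplus> X)) \<Longrightarrow> g \<in> hom C Z (Tob M (Y \<oplus> Z)) \<Longrightarrow> h \<in> hom C Z X \<Longrightarrow>
       f \<cdot> h = Tmap C M (idm C Y \<oplus>\<^sub>m h) \<cdot> g \<Longrightarrow> dag M Y f \<cdot> h = dag M Y g"
    by (rule dag_uniformity) (simp_all add: hom_iff)
  show "f \<in> hom C X (Tob M (Y \<oplus> X)) \<Longrightarrow>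
       str M Z Y \<cdot> (idm C Z \<otimes>\<^sub>m dag M Y f) =
       dag M (Z \<otimes> Y) (Tmap C M (dist C Z Y X) \<cdot> str M Z (Y \<oplus> X) \<cdot> (idm C Z \<otimes>\<^sub>m f))"
    by (rule dag_strength) (simp_all add: hom_iff)
qed

end

section \<open>Initiality\<close>

lemma (in chosen_binary_coproducts) cmp_copair_cmp:
  assumes "Cod C f = Cod C g" "Cod C g = Dom C h" "Cod C k = Dom C f \<oplus> Dom C g"
  shows "h \<cdot> (\<lblot>f, g\<rblot> \<cdot> k) = \<lblot>h \<cdot> f, h \<cdot> g\<rblot> \<cdot> k"
  using cmp_eq[OF cmp_copair[OF assms(1,2)], of k] assms by simp

section \<open>Divergence in an arbitrary complete Elgot monad\<close>

locale elgot_kleisli = hyperextensive_bicart C + complete_elgot_monad C N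
  for C :: "('o, 'a, 'm) bicart_scheme" (structure) and N :: "('o, 'a, 'n) elgot_scheme"
begin

sublocale kleisli C N ..

lemma dom_dag [simp]: "Dom C f = X \<Longrightarrow> Cod C f = Tob N (Y \<oplus> X) \<Longrightarrow> Dom C (dag N Y f) = X"
  and cod_dag [simp]: "Dom C f = X \<Longrightarrow> Cod C f = Tob N (Y \<oplus> X) \<Longrightarrow> Cod C (dag N Y f) = Tob N Y"
  using dag_hom[of f X Y] by (simp_all add: hom_iff)

definition diverge :: "'o \<Rightarrow> 'a" where
  "diverge Y = dag N Y (eta N (Y \<oplus> \<one>) \<cdot> inr C Y \<one>)"

lemma dom_diverge [simp]: "Dom C (diverge Y) = \<one>" and cod_diverge [simp]: "Cod C (diverge Y) = Tob N Y"
  by (simp_all add: diverge_def)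

text \<open>\<open>bang C X\<close> maps the loop \<open>t\<close> to the identity loop on
  \<open>\<one>\<close>, whose iterate is \<open>diverge Y\<close>; uniformity identifies the
  two.\<close>

lemma dag_eta_inr:
  assumes "Dom C t = X" "Cod C t = X"
  shows "dag N Y (eta N (Y \<oplus> X) \<cdot> (inr C Y X \<cdot> t)) = diverge Y \<cdot> bang C X"
  unfolding diverge_def
proof (rule uniformity_law[symmetric])
  show "(eta N (Y \<oplus> \<one>) \<cdot> inr C Y \<one>) \<cdot> bang C X =
      Tmap C N (idm C Y \<oplus>\<^sub>m bang C X) \<cdot> eta N (Y \<oplus> X) \<cdot> inr C Y X \<cdot> t"
    using assms by (simp add: sum_map_def)
qed (use assms in \<open>simp_all add: hom_iff\<close>)

text \<open>The loop behind \<open>diverge\<close> never exits, so the change of exits in the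
  naturality law only replaces \<open>Y\<close> by \<open>Z\<close> in its body.\<close>

lemma ext_diverge [simp]:
  assumes "Dom C f = Y" "Cod C f = Tob N Z"
  shows "ext N Z f \<cdot> diverge Y = diverge Z"
  using naturality_law[of "eta N (Y \<oplus> \<one>) \<cdot> inr C Y \<one>" \<one> Y f Z] assms
  by (simp add: hom_iff diverge_def)

lemma ext_diverge_cmp [simp]:
  assumes "Dom C f = Y" "Cod C f = Tob N Z" "Cod C h = \<one>"
  shows "ext N Z f \<cdot> (diverge Y \<cdot> h) = diverge Z \<cdot> h"
  using cmp_eq[OF ext_diverge[OF assms(1,2)], of h] assms by simp

text \<open>The strength law produces the identity loop over \<open>X \<otimes> \<one>\<close>,
  which \<open>dag_eta_inr\<close> collapses.\<close>

lemma str_pairing_diverge [simp]: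
  assumes "Dom C a = Dom C b" "Cod C a = X" "Cod C b = \<one>"
  shows "str N X Y \<cdot> pairing C a (diverge Y \<cdot> b) = diverge (X \<otimes> Y) \<cdot> b"
proof -
  have "str N X Y \<cdot> (idm C X \<otimes>\<^sub>m diverge Y)
      = dag N (X \<otimes> Y) (eta N (X \<otimes> Y \<oplus> X \<otimes> \<one>) \<cdot> (inr C (X \<otimes> Y) (X \<otimes> \<one>) \<cdot> idm C (X \<otimes> \<one>)))"
    using strength_law[of "eta N (Y \<oplus> \<one>) \<cdot> inr C Y \<one>" \<one> Y X] by (simp add: hom_iff diverge_def prod_map_def)
  also have "\<dots> = diverge (X \<otimes> Y) \<cdot> bang C (X \<otimes> \<one>)" by (rule dag_eta_inr) simp_all
  finally have "str N X Y \<cdot> ((idm C X \<otimes>\<^sub>m diverge Y) \<cdot> pairing C a b) = (diverge (X \<otimes> Y) \<cdot> bang C (X \<otimes> \<one>)) \<cdot> pairing C a b"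
    by (rule cmp_eq) (use assms in simp_all)
  moreover have "bang C (Dom C b) = b" by (rule to_terminal_eq) (use assms in simp_all)
  ultimately show ?thesis using assms by simp
qed

text \<open>A computation without exits diverges: the iteration over the summand \<open>E\<close> is, by dinaturality,
  related to one over \<open>E \<oplus> \<one>\<close>, which by the codiagonal law iterates the total map \<open>\<lblot>k, inr\<rblot>\<close>.\<close>

lemma dag_no_exit:
  assumes k: "Dom C k = E" "Cod C k = E \<oplus> \<one>"
  shows "dag N Y (\<lblot>eta N (Y \<oplus> E) \<cdot> inr C Y E, diverge (Y \<oplus> E)\<rblot> \<cdot> k) = diverge Y \<cdot> bang C E"
proof -
  define Z where "Z = E \<oplus> \<one>"
  have k: "Dom C k = E" "Cod C k = Z" and i: "Dom C (inr C E \<one>) = \<one>" "Cod C (inr C E \<one>) = Z"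
    using k by (simp_all add: Z_def)
  \<comment> \<open>The loop in question is \<open>h \<cdot> k\<close>. Here \<open>g\<close> is
    \<open>k\<close> read as a jump to a loop variable in \<open>Z\<close>, so dinaturality for
    \<open>g\<close> and \<open>h\<close> moves the loop from \<open>E\<close> to \<open>Z\<close>,
    where its body is \<open>H\<close>.\<close>
  define g where "g = eta N (Y \<oplus> Z) \<cdot> (inr C Y Z \<cdot> k)"
  define h where "h = \<lblot>eta N (Y \<oplus> E) \<cdot> inr C Y E, diverge (Y \<oplus> E)\<rblot>"
  define H where "H = \<lblot>g, diverge (Y \<oplus> Z)\<rblot>"
  \<comment> \<open>\<open>G\<close> has two loop variables of type \<open>Z\<close>: on
    \<open>E\<close> it jumps along \<open>k\<close> to the first, on \<open>\<one>\<close> it stays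
    in the second. Iterating the second alone gives \<open>g\<close> on \<open>E\<close> and
    divergence on \<open>\<one>\<close>, that is \<open>H\<close>; merging both gives the total map
    \<open>\<lblot>k, inr C E \<one>\<rblot>\<close>.\<close>
  define G where "G = \<lblot>eta N ((Y \<oplus> Z) \<oplus> Z) \<cdot> (inl C (Y \<oplus> Z) Z \<cdot> (inr C Y Z \<cdot> k)),
      eta N ((Y \<oplus> Z) \<oplus> Z) \<cdot> (inr C (Y \<oplus> Z) Z \<cdot> inr C E \<one>)\<rblot>"
  have g: "Dom C g = E" "Cod C g = Tob N (Y \<oplus> Z)" and h: "Dom C h = Z" "Cod C h = Tob N (Y \<oplus> E)"
    and H: "Dom C H = Z" "Cod C H = Tob N (Y \<oplus> Z)" and G: "Dom C G = Z" "Cod C G = Tob N ((Y \<oplus> Z) \<oplus> Z)"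
    using k i by (simp_all add: g_def h_def H_def G_def Z_def)
  have Gl: "G \<cdot> inl C E \<one> = eta N ((Y \<oplus> Z) \<oplus> Z) \<cdot> (inl C (Y \<oplus> Z) Z \<cdot> (inr C Y Z \<cdot> k))"
    and Gr: "G \<cdot> inr C E \<one> = eta N ((Y \<oplus> Z) \<oplus> Z) \<cdot> (inr C (Y \<oplus> Z) Z \<cdot> inr C E \<one>)"
    using k i unfolding G_def by (simp_all add: Z_def)
  have dG: "Dom C (dag N (Y \<oplus> Z) G) = E \<oplus> \<one>" "Cod C (dag N (Y \<oplus> Z) G) = Tob N (Y \<oplus> Z)"
    using G by (simp_all add: Z_def)
  have "dag N (Y \<oplus> Z) G = H"
  proof (rule copair_ext[of _ E \<one>])
    have "ext N (Y \<oplus> Z) \<lblot>eta N (Y \<oplus> Z), dag N (Y \<oplus> Z) G\<rblot> \<cdot> G = dag N (Y \<oplus> Z) G"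
      by (rule unfolding_law[of _ Z]) (simp add: hom_iff G)
    from cmp_eq[OF this, of "inl C E \<one>"]
    show "dag N (Y \<oplus> Z) G \<cdot> inl C E \<one> = H \<cdot> inl C E \<one>"
      using G g k Gl by (simp add: H_def) (simp add: g_def Z_def)
    have "dag N (Y \<oplus> Z) G \<cdot> inr C E \<one> = diverge (Y \<oplus> Z)"
      unfolding diverge_def
    proof (rule uniformity_law)
      show "G \<cdot> inr C E \<one> =
          Tmap C N (idm C (Y \<oplus> Z) \<oplus>\<^sub>m inr C E \<one>) \<cdot> eta N ((Y \<oplus> Z) \<oplus> \<one>) \<cdot> inr C (Y \<oplus> Z) \<one>"
        using i unfolding Gr by (simp add: sum_map_def)
    qed (use G i in \<open>simp_all add: hom_iff\<close>)
    then show "dag N (Y \<oplus> Z) G \<cdot> inr C E \<one> = H \<cdot> inr C E \<one>" using g by (simp add: H_def)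
  qed (use dG H in \<open>simp_all add: Z_def\<close>)
  then have "dag N Y H = dag N Y (Tmap C N \<lblot>idm C (Y \<oplus> Z), inr C Y Z\<rblot> \<cdot> G)"
    using codiagonal_law[of G Z Y] G by (simp add: hom_iff)
  also have "Tmap C N \<lblot>idm C (Y \<oplus> Z), inr C Y Z\<rblot> \<cdot> G = eta N (Y \<oplus> Z) \<cdot> (inr C Y Z \<cdot> \<lblot>k, inr C E \<one>\<rblot>)"
    unfolding G_def using k i by simp
  also have "dag N Y \<dots> = diverge Y \<cdot> bang C Z"
    by (rule dag_eta_inr) (use k i in \<open>simp_all add: Z_def\<close>)
  finally have dH: "dag N Y H = diverge Y \<cdot> bang C Z" .
  have "dag N Y (h \<cdot> k) = dag N Y (ext N (Y \<oplus> E) \<lblot>eta N (Y \<oplus> E) \<cdot> inl C Y E, h\<rblot> \<cdot> g)"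
    using k h unfolding g_def by simp
  also have "\<dots> = ext N Y \<lblot>eta N Y, dag N Y (ext N (Y \<oplus> Z) \<lblot>eta N (Y \<oplus> Z) \<cdot> inl C Y Z, g\<rblot> \<cdot> h)\<rblot> \<cdot> g"
    by (rule dinaturality_law) (use g h in \<open>simp_all add: hom_iff\<close>)
  also have "ext N (Y \<oplus> Z) \<lblot>eta N (Y \<oplus> Z) \<cdot> inl C Y Z, g\<rblot> \<cdot> h = H"
    unfolding H_def h_def using g by simp
  also have "ext N Y \<lblot>eta N Y, dag N Y H\<rblot> \<cdot> g = diverge Y \<cdot> bang C E"
    unfolding dH g_def using k by simp
  finally show ?thesis unfolding h_def .
qed

end

section \<open>The Elgot structure on \<open>X \<oplus> \<one>\<close>\<close>

context hyperextensive_bicart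
begin

lemma L_elgot_sel [simp]:
  "Tob (L_elgot C) = Tob (L_monad C)" "eta (L_elgot C) = eta (L_monad C)"
  "ext (L_elgot C) = ext (L_monad C)" "str (L_elgot C) = str (L_monad C)"
  by (simp_all add: L_elgot_def smonad.defs elgot.defs)

lemma L_elgot_dag: "dag (L_elgot C) Y f = (THE h. is_least_iterate C (L_monad C) (L_le C) Y f h)"
  by (simp add: L_elgot_def smonad.defs elgot.defs)

lemma L_elgot_dag_least:
  assumes "f \<in> hom C X (Tob (L_monad C) (Y \<oplus> X))"
  shows "is_least_iterate C (L_monad C) (L_le C) Y f (dag (L_elgot C) Y f)"
proof -
  interpret omega_kleisli C "L_monad C" "L_le C"
    by (intro omega_kleisli.intro hyperextensive_bicart_axioms L_omega_continuous)
  show ?thesis unfolding L_elgot_dag by (rule theI'[OF least_iterate_ex1[OF assms]])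
qed

text \<open>\<open>L_monad C\<close> and \<open>L_elgot C\<close> have different record types, so
  the result is carried over by unfolding the locale predicates down to the shared fields.\<close>

lemma L_elgot_omega_continuous: "omega_continuous_monad C (L_elgot C) (L_le C)"
  using L_omega_continuous
  unfolding omega_continuous_monad_def omega_continuous_monad_axioms_def strong_monad_def Tmap_def L_elgot_sel .

lemma L_omega_elgot: "omega_elgot C (L_elgot C) (L_le C)"
  using L_elgot_dag_least
  by (intro omega_elgot.intro omega_kleisli.intro hyperextensive_bicart_axioms L_elgot_omega_continuous
      omega_elgot_axioms.intro) (simp add: is_least_iterate_def)

end

section \<open>The unique morphism out of \<open>L_elgot\<close>\<close>

locale L_initial = elgot_kleisli C N
  for C :: "('o, 'a, 'm) bicart_scheme" (structure) and N :: "('o, 'a, 'n) elgot_scheme"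
begin

sublocale L: omega_elgot C "L_elgot C" "L_le C"
  by (rule L_omega_elgot)

definition from_L :: "'o \<Rightarrow> 'a" where
  "from_L X = \<lblot>eta N X, diverge X\<rblot>"

lemma dom_from_L [simp]: "Dom C (from_L X) = X \<oplus> \<one>" and cod_from_L [simp]: "Cod C (from_L X) = Tob N X"
  by (simp_all add: from_L_def)

text \<open>By induction on \<open>n\<close>, unfolding the iterate in \<open>N\<close> once per
  step: a step either exits in \<open>Y\<close> with the final value or continues at an element of
  \<open>X\<close> covered by the induction hypothesis. For \<open>n = 0\<close> the approximation
  is bottom and has no values.\<close>

lemma from_L_kleene:
  assumes g: "Dom C g = X" "Cod C g = (Y \<oplus> X) \<oplus> \<one>"
    and "Cod C w = X" "Cod C y = Y" "Dom C y = Dom C w" "L.kleene Y g n \<cdot> w = inl C Y \<one> \<cdot> y"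
  shows "dag N Y (from_L (Y \<oplus> X) \<cdot> g) \<cdot> w = eta N Y \<cdot> y"
  using assms(3-)
proof (induction n arbitrary: w y)
  case (0 w y)
  have "L.bottom Y = inr C Y \<one>"
    using L.bot_bottom[of Y] by (simp add: L_is_bottom_iff)
  then have "inl C Y \<one> \<cdot> y = inr C Y \<one> \<cdot> bang C (Dom C w)" using 0 g by simp
  then show ?case by (rule inl_inr_eq) (use 0(1-3) g in simp_all)
next
  case (Suc n w y)
  let ?k = "L.kleene Y g n" and ?D = "dag N Y (from_L (Y \<oplus> X) \<cdot> g)"
  have k: "Dom C ?k = X" "Cod C ?k = Y \<oplus> \<one>" using L.kleene_hom[of g X Y n] g by simp_all
  have D: "Dom C ?D = X" "Cod C ?D = Tob N Y" using g by simp_all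
  have Dfix: "ext N Y \<lblot>eta N Y, ?D\<rblot> \<cdot> (from_L (Y \<oplus> X) \<cdot> g) = ?D"
    by (rule unfolding_law[of _ X]) (use g in \<open>simp add: hom_iff\<close>)
  have step: "\<lblot>\<lblot>inl C Y \<one>, ?k\<rblot>, inr C Y \<one>\<rblot> \<cdot> (g \<cdot> w) = inl C Y \<one> \<cdot> y"
    using Suc.prems k g by simp
  show ?case
  proof (rule L_ext_cases[OF _ _ g(2) _ Suc.prems(2,3) step])
    fix v t assume v: "Cod C v = Dom C w" "Cod C t = Y \<oplus> X" "Dom C t = Dom C v"
      "g \<cdot> (w \<cdot> v) = inl C (Y \<oplus> X) \<one> \<cdot> t" "\<lblot>inl C Y \<one>, ?k\<rblot> \<cdot> t = inl C Y \<one> \<cdot> (y \<cdot> v)"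
    have from_L: "from_L (Y \<oplus> X) \<cdot> (inl C (Y \<oplus> X) \<one> \<cdot> t) = eta N (Y \<oplus> X) \<cdot> t"
      using v(2) by (simp add: from_L_def)
    have "?D \<cdot> (w \<cdot> v) = ext N Y \<lblot>eta N Y, ?D\<rblot> \<cdot> (from_L (Y \<oplus> X) \<cdot> (g \<cdot> (w \<cdot> v)))"
      using cmp_eq[OF Dfix, of "w \<cdot> v"] v(1-3) Suc.prems(1) g D by simp
    also have "\<dots> = \<lblot>eta N Y, ?D\<rblot> \<cdot> t"
      unfolding v(4) from_L using v(2) D by simp
    finally have Dw: "?D \<cdot> (w \<cdot> v) = \<lblot>eta N Y, ?D\<rblot> \<cdot> t" .
    have "\<lblot>eta N Y, ?D\<rblot> \<cdot> t = eta N Y \<cdot> (y \<cdot> v)"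
    proof (rule sum_cases_eq[OF v(2)])
      fix u a assume u: "Cod C u = Dom C t" "Cod C a = Y" "Dom C a = Dom C u" "t \<cdot> u = inl C Y X \<cdot> a"
      have "inl C Y \<one> \<cdot> a = inl C Y \<one> \<cdot> (y \<cdot> (v \<cdot> u))"
        using cmp_eq_cmp[OF v(5), of u] u v(1-3) Suc.prems(2,3) k by simp
      then have "a = y \<cdot> (v \<cdot> u)" by (rule inl_cancel) (use u(1-3) v(1-3) Suc.prems(2,3) in simp_all)
      then show "(\<lblot>eta N Y, ?D\<rblot> \<cdot> t) \<cdot> u = (eta N Y \<cdot> (y \<cdot> v)) \<cdot> u"
        using u v(1-3) D Suc.prems(2,3) by simp
    next
      fix u a assume u: "Cod C u = Dom C t" "Cod C a = X" "Dom C a = Dom C u" "t \<cdot> u = inr C Y X \<cdot> a"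
      have "?k \<cdot> a = inl C Y \<one> \<cdot> (y \<cdot> (v \<cdot> u))"
        using cmp_eq_cmp[OF v(5), of u] u v(1-3) Suc.prems(2,3) k by simp
      then have "?D \<cdot> a = eta N Y \<cdot> (y \<cdot> (v \<cdot> u))"
        by (rule Suc.IH[rotated 3]) (use u(1-3) v(1-3) Suc.prems(2,3) in simp_all)
      then show "(\<lblot>eta N Y, ?D\<rblot> \<cdot> t) \<cdot> u = (eta N Y \<cdot> (y \<cdot> v)) \<cdot> u"
        using u v(1-3) D Suc.prems(2,3) by simp
    qed (use v(1-3) D Suc.prems(2,3) in simp_all)
    then show "(?D \<cdot> w) \<cdot> v = (eta N Y \<cdot> y) \<cdot> v"
      using Dw v(1) D Suc.prems(1-3) by simp
  qed (use Suc.prems(1-3) g D k in simp_all)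
qed

lemma from_L_dag:
  assumes g: "Dom C g = X" "Cod C g = (Y \<oplus> X) \<oplus> \<one>"
  shows "dag N Y (from_L (Y \<oplus> X) \<cdot> g) = from_L Y \<cdot> dag (L_elgot C) Y g"
proof -
  let ?h = "dag (L_elgot C) Y g" and ?G = "from_L (Y \<oplus> X) \<cdot> g"
  have g': "g \<in> hom C X (Tob (L_elgot C) (Y \<oplus> X))" using g by (simp add: hom_iff)
  have h: "Dom C ?h = X" "Cod C ?h = Y \<oplus> \<one>" using L.dom_dag[of g X Y] L.cod_dag[of g X Y] g by simp_all
  have G: "Dom C ?G = X" "Cod C ?G = Tob N (Y \<oplus> X)" using g by simp_all
  have D: "Dom C (dag N Y ?G) = X" "Cod C (dag N Y ?G) = Tob N Y" using g by simp_all
  have hfix: "\<lblot>\<lblot>inl C Y \<one>, ?h\<rblot>, inr C Y \<one>\<rblot> \<cdot> g = ?h"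
    using L.dag_fix[of g X Y] g by simp
  have ch: "omega_chain (hom C X (Y \<oplus> \<one>)) (L_le C Y) (L.kleene Y g)"
    and lub: "is_lub (hom C X (Y \<oplus> \<one>)) (L_le C Y) (L.kleene Y g) ?h"
    using L.kleene_chain[OF g'] L.dag_kleene_lub[OF g'] by simp_all
  obtain d p e q where d: "is_binary_coproduct C (Dom C ?h) d e" "is_pullback C d p ?h (inl C Y \<one>)" "is_pullback C e q ?h (inr C Y \<one>)"
    by (rule split[of ?h "inl C Y \<one>" "inr C Y \<one>"]) (use h coproduct(1) in simp_all)
  have dp: "Dom C p = Dom C d" "Cod C d = X" "Cod C p = Y" "?h \<cdot> d = inl C Y \<one> \<cdot> p"
    using is_pullback_cods[OF d(2)] h by simp_all
  have eq: "Dom C q = Dom C e" "Cod C e = X" "Cod C q = \<one>" "?h \<cdot> e = inr C Y \<one> \<cdot> q"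
    using is_pullback_cods[OF d(3)] h by simp_all
  define E where "E = Dom C e"
  \<comment> \<open>\<open>r\<close> is the partial inverse of \<open>e\<close>: undefined on
    \<open>d\<close>, and returning the element of \<open>E\<close> on \<open>e\<close>.\<close>
  obtain r where r: "Dom C r = X" "Cod C r = E \<oplus> \<one>" "r \<cdot> d = inr C E \<one> \<cdot> bang C (Dom C d)" "r \<cdot> e = inl C E \<one>"
    by (rule is_binary_coproduct_copair[OF d(1), of "inr C E \<one> \<cdot> bang C (Dom C d)" "inl C E \<one>"])
      (simp_all add: h E_def)
  \<comment> \<open>The body of the loop on \<open>E\<close>, with exits to \<open>Y\<close> and
    jumps outside \<open>E\<close> sent to failure; \<open>ge\<close> shows that neither
    occurs.\<close>
  define k where "k = \<lblot>\<lblot>inr C E \<one> \<cdot> bang C Y, r\<rblot>, inr C E \<one>\<rblot> \<cdot> (g \<cdot> e)"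
  have k: "Dom C k = E" "Cod C k = E \<oplus> \<one>" using g eq r by (simp_all add: k_def E_def)
  \<comment> \<open>On \<open>E\<close> the least iterate \<open>?h\<close> is undefined, so by
    \<open>hfix\<close> a result \<open>a\<close> of \<open>g\<close> must satisfy that
    \<open>\<lblot>inl C Y \<one>, ?h\<rblot> \<cdot> a\<close> is undefined. This excludes exits to
    \<open>Y\<close>, and a jump to \<open>b\<close> in \<open>X\<close> has
    \<open>?h \<cdot> b\<close> undefined, so \<open>b\<close> factors through the pullback
    \<open>e\<close>.\<close>
  have ge: "g \<cdot> e = \<lblot>inl C (Y \<oplus> X) \<one> \<cdot> (inr C Y X \<cdot> e), inr C (Y \<oplus> X) \<one>\<rblot> \<cdot> k"
  proof (rule sum_cases_eq[of "g \<cdot> e" "Y \<oplus> X" \<one>])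
    fix w a assume w: "Cod C w = Dom C (g \<cdot> e)" "Cod C a = Y \<oplus> X" "Dom C a = Dom C w" "(g \<cdot> e) \<cdot> w = inl C (Y \<oplus> X) \<one> \<cdot> a"
    have w1: "Cod C w = E" using w(1) g eq by (simp add: E_def)
    have w4: "g \<cdot> (e \<cdot> w) = inl C (Y \<oplus> X) \<one> \<cdot> a" using w(4) w1 g eq by (simp add: E_def)
    have "?h \<cdot> (e \<cdot> w) = inr C Y \<one> \<cdot> (q \<cdot> w)"
      by (rule cmp_eq_cmp[OF eq(4)]) (use h w1 eq(1-3) in \<open>simp_all add: E_def\<close>)
    moreover have "?h \<cdot> (e \<cdot> w) = \<lblot>inl C Y \<one>, ?h\<rblot> \<cdot> a"
      using cmp_eq[OF hfix, of "e \<cdot> w"] g h eq(2) w1 w(2) by (simp add: E_def w4)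
    ultimately have ha: "\<lblot>inl C Y \<one>, ?h\<rblot> \<cdot> a = inr C Y \<one> \<cdot> (q \<cdot> w)" by simp
    have kw: "k \<cdot> w = \<lblot>inr C E \<one> \<cdot> bang C Y, r\<rblot> \<cdot> a"
      using w1 w(2) g eq(2) r(1,2) unfolding k_def by (simp add: E_def w4)
    have "inl C (Y \<oplus> X) \<one> \<cdot> a = \<lblot>inl C (Y \<oplus> X) \<one> \<cdot> (inr C Y X \<cdot> e), inr C (Y \<oplus> X) \<one>\<rblot> \<cdot> (\<lblot>inr C E \<one> \<cdot> bang C Y, r\<rblot> \<cdot> a)"
    proof (rule sum_cases_eq[OF w(2)])
      fix u b assume u: "Cod C u = Dom C a" "Cod C b = Y" "Dom C b = Dom C u" "a \<cdot> u = inl C Y X \<cdot> b"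
      have "inl C Y \<one> \<cdot> b = inr C Y \<one> \<cdot> (q \<cdot> (w \<cdot> u))"
        using cmp_eq_cmp[OF ha, of u] u w(2,3) w1 h eq(1,3) by (simp add: E_def)
      then show "(inl C (Y \<oplus> X) \<one> \<cdot> a) \<cdot> u = (\<lblot>inl C (Y \<oplus> X) \<one> \<cdot> (inr C Y X \<cdot> e), inr C (Y \<oplus> X) \<one>\<rblot> \<cdot> (\<lblot>inr C E \<one> \<cdot> bang C Y, r\<rblot> \<cdot> a)) \<cdot> u"
        by (rule inl_inr_eq) (use u(1-3) w(2,3) w1 eq(1-3) r(1,2) in \<open>simp_all add: E_def\<close>)
    next
      fix u b assume u: "Cod C u = Dom C a" "Cod C b = X" "Dom C b = Dom C u" "a \<cdot> u = inr C Y X \<cdot> b"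
      have "?h \<cdot> b = inr C Y \<one> \<cdot> (q \<cdot> (w \<cdot> u))"
        using cmp_eq_cmp[OF ha, of u] u w(2,3) w1 h eq(1,3) by (simp add: E_def)
      then obtain b' where b': "Dom C b' = Dom C u" "Cod C b' = E" "e \<cdot> b' = b"
        by (rule is_pullbackE[OF d(3)]) (use u(1-3) w(2,3) w1 h eq(1-3) in \<open>simp_all add: E_def\<close>)
      have "r \<cdot> b = inl C E \<one> \<cdot> b'" using cmp_eq[OF r(4), of b'] b' eq(2) r(1) by (simp add: E_def)
      then show "(inl C (Y \<oplus> X) \<one> \<cdot> a) \<cdot> u = (\<lblot>inl C (Y \<oplus> X) \<one> \<cdot> (inr C Y X \<cdot> e), inr C (Y \<oplus> X) \<one>\<rblot> \<cdot> (\<lblot>inr C E \<one> \<cdot> bang C Y, r\<rblot> \<cdot> a)) \<cdot> u"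
        using u w(2,3) b' eq(2) r(1,2) by (simp add: E_def)
    qed (use w(2) eq(2) r(1,2) in \<open>simp_all add: E_def\<close>)
    then show "(g \<cdot> e) \<cdot> w = (\<lblot>inl C (Y \<oplus> X) \<one> \<cdot> (inr C Y X \<cdot> e), inr C (Y \<oplus> X) \<one>\<rblot> \<cdot> k) \<cdot> w"
      using w(4) w1 k eq(2) kw by (simp add: E_def)
  next
    fix w a assume w: "Cod C w = Dom C (g \<cdot> e)" "Cod C a = \<one>" "Dom C a = Dom C w" "(g \<cdot> e) \<cdot> w = inr C (Y \<oplus> X) \<one> \<cdot> a"
    have w1: "Cod C w = E" using w(1) g eq by (simp add: E_def)
    have w4: "g \<cdot> (e \<cdot> w) = inr C (Y \<oplus> X) \<one> \<cdot> a" using w(4) w1 g eq by (simp add: E_def)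
    have "k \<cdot> w = inr C E \<one> \<cdot> a"
      using w1 w(2) g eq(2) r(1,2) unfolding k_def by (simp add: E_def w4)
    then show "(g \<cdot> e) \<cdot> w = (\<lblot>inl C (Y \<oplus> X) \<one> \<cdot> (inr C Y X \<cdot> e), inr C (Y \<oplus> X) \<one>\<rblot> \<cdot> k) \<cdot> w"
      using w(2,4) w1 k eq(2) by (simp add: E_def)
  qed (use g k eq(2) in \<open>simp_all add: E_def\<close>)
  show ?thesis
  proof (rule is_binary_coproduct_eq[OF d(1)])
    \<comment> \<open>The approximation index \<open>i\<close>, and with it the number of
      unfoldings, depends on the piece \<open>v\<close> of the domain; hence covering rather than
      one induction.\<close>
    have "dag N Y ?G \<cdot> d = eta N Y \<cdot> p"
    proof (rule L_lub_cover[OF ch lub dp(4)])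
      fix i v y assume v: "Cod C v = Dom C d" "Cod C y = Y" "Dom C y = Dom C v" "L.kleene Y g i \<cdot> (d \<cdot> v) = inl C Y \<one> \<cdot> y"
      have "dag N Y ?G \<cdot> (d \<cdot> v) = eta N Y \<cdot> y"
        by (rule from_L_kleene[OF g _ _ _ v(4)]) (use v(1-3) dp(2) in simp_all)
      moreover have "?h \<cdot> (d \<cdot> v) = inl C Y \<one> \<cdot> y"
        using v(4) by (rule L_leD[OF L.lub_upper[OF lub]])
          (use v(1-3) dp(2) h L.kleene_hom[of g X Y i] g in simp_all)
      then have "inl C Y \<one> \<cdot> (p \<cdot> v) = inl C Y \<one> \<cdot> y"
        using cmp_eq_cmp[OF dp(4), of v] v(1) dp(1-3) h by simp
      then have "p \<cdot> v = y" by (rule inl_cancel) (use v(1-3) dp(1,3) in simp_all)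
      ultimately show "(dag N Y ?G \<cdot> d) \<cdot> v = (eta N Y \<cdot> p) \<cdot> v" using v(1) dp(1-3) D by simp
    qed (use dp(1-3) D in simp_all)
    also have "\<dots> = from_L Y \<cdot> (?h \<cdot> d)" unfolding dp(4) using dp(3) by (simp add: from_L_def)
    finally show "dag N Y ?G \<cdot> d = (from_L Y \<cdot> ?h) \<cdot> d" using h dp(2) by simp
    \<comment> \<open>\<open>ge\<close> becomes the square required by uniformity: \<open>e\<close>
      maps the exit-free loop over \<open>E\<close> with body \<open>k\<close> to the loop
      \<open>?G\<close>.\<close>
    have "?G \<cdot> e = from_L (Y \<oplus> X) \<cdot> (g \<cdot> e)" using g eq(2) by simp
    also have "\<dots> = Tmap C N (idm C Y \<oplus>\<^sub>m e) \<cdot> (\<lblot>eta N (Y \<oplus> E) \<cdot> inr C Y E, diverge (Y \<oplus> E)\<rblot> \<cdot> k)"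
      unfolding ge using k eq(2) by (simp add: from_L_def sum_map_def E_def cmp_copair_cmp)
    finally have "dag N Y ?G \<cdot> e = dag N Y (\<lblot>eta N (Y \<oplus> E) \<cdot> inr C Y E, diverge (Y \<oplus> E)\<rblot> \<cdot> k)"
      by (rule uniformity_law[rotated 3]) (use G k eq(2) in \<open>simp_all add: hom_iff E_def\<close>)
    also have "\<dots> = diverge Y \<cdot> bang C E" by (rule dag_no_exit[OF k])
    also have "bang C E = q" by (rule to_terminal_eq) (use eq(1,3) in \<open>simp_all add: E_def\<close>)
    also have "diverge Y \<cdot> q = from_L Y \<cdot> (?h \<cdot> e)" unfolding eq(4) using eq(3) by (simp add: from_L_def)
    finally show "dag N Y ?G \<cdot> e = (from_L Y \<cdot> ?h) \<cdot> e" using h eq(2) by simp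
  qed (use h D in simp_all)
qed

lemma from_L_morphism: "complete_elgot_morphism C (L_elgot C) N from_L"
proof
  fix X Y f g
  show "from_L X \<in> hom C (Tob (L_elgot C) X) (Tob N X)" by (simp add: hom_iff)
  show "f \<in> hom C X Y \<Longrightarrow> from_L Y \<cdot> Tmap C (L_elgot C) f = Tmap C N f \<cdot> from_L X"
    by (simp add: hom_iff from_L_def Tmap_def)
  show "from_L X \<cdot> eta (L_elgot C) X = eta N X" by (simp add: from_L_def)
  show "f \<in> hom C X (Tob (L_elgot C) Y) \<Longrightarrow>
      from_L Y \<cdot> ext (L_elgot C) Y f = ext N Y (from_L Y \<cdot> f) \<cdot> from_L X"
    by (simp add: hom_iff from_L_def)
  show "from_L (X \<otimes> Y) \<cdot> str (L_elgot C) X Y = str N X Y \<cdot> (idm C X \<otimes>\<^sub>m from_L Y)"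
    by (rule prod_sum_ext[of _ X Y \<one>]) (simp_all add: from_L_def prod_map_def)
  show "g \<in> hom C X (Tob (L_elgot C) (Y \<oplus> X)) \<Longrightarrow>
      dag N Y (from_L (Y \<oplus> X) \<cdot> g) = from_L Y \<cdot> dag (L_elgot C) Y g"
    by (rule from_L_dag) (simp_all add: hom_iff)
qed

text \<open>The arrow \<open>inr\<close> solves the equation, so it lies above the least iterate;
  being the bottom, it also lies below.\<close>

lemma L_dag_inr: "dag (L_elgot C) X (inl C (X \<oplus> \<one>) \<one> \<cdot> inr C X \<one>) = inr C X \<one>" (is "?d = _")
proof (rule L_le_antisym)
  show "L_le C X ?d (inr C X \<one>)" by (rule L.dag_le[of _ \<one>]) simp_all
  show d: "Dom C (inr C X \<one>) = Dom C ?d" "Cod C ?d = X \<oplus> \<one>"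
    using L.dom_dag[of "inl C (X \<oplus> \<one>) \<one> \<cdot> inr C X \<one>" \<one> X] L.cod_dag[of "inl C (X \<oplus> \<one>) \<one> \<cdot> inr C X \<one>" \<one> X] by simp_all
  show "L_le C X (inr C X \<one>) ?d" using L_bot_le[of ?d X \<one>] d by simp
qed simp

text \<open>On \<open>inl\<close> the component is fixed by the unit. By \<open>L_dag_inr\<close>
  the other injection is itself an iterate of a unit composite, so preservation of iteration fixes
  the component there too.\<close>

lemma morphism_from_L_unique:
  assumes "complete_elgot_morphism C (L_elgot C) N \<xi>"
  shows "\<xi> = from_L"
proof
  fix X
  interpret complete_elgot_morphism C "L_elgot C" N \<xi> by (rule assms)
  have \<xi>: "Dom C (\<xi> X) = X \<oplus> \<one>" "Cod C (\<xi> X) = Tob N X" for X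
    using component_hom[of X] by (simp_all add: hom_iff)
  have \<xi>_eta: "\<xi> X \<cdot> inl C X \<one> = eta N X" for X using preserves_eta[of X] by simp
  have "diverge X = dag N X (\<xi> (X \<oplus> \<one>) \<cdot> (inl C (X \<oplus> \<one>) \<one> \<cdot> inr C X \<one>))"
    unfolding diverge_def using cmp_eq[OF \<xi>_eta[of "X \<oplus> \<one>"], of "inr C X \<one>"] \<xi> by simp
  also have "\<dots> = \<xi> X \<cdot> dag (L_elgot C) X (inl C (X \<oplus> \<one>) \<one> \<cdot> inr C X \<one>)"
    by (rule preserves_dag) (simp add: hom_iff)
  finally have "\<xi> X \<cdot> inr C X \<one> = diverge X" by (simp only: L_dag_inr)
  then show "\<xi> X = from_L X"
    by (intro copair_ext[of "\<xi> X" X \<one>]) (simp_all add: \<xi> \<xi>_eta from_L_def)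
qed

end

theorem theorem6p10:
  fixes C :: "('o, 'a) bicart" (structure)
  assumes "hyperextensive C"
    and "chosen_binary_coproducts C"
    and "chosen_finite_products C"
  shows "omega_continuous_monad C (L_monad C) (L_le C)
    \<and> (\<forall>X Y. \<forall>f \<in> hom C X (Tob (L_monad C) (Y \<oplus> X)).
         is_least_iterate C (L_monad C) (L_le C) Y f (dag (L_elgot C) Y f))
    \<and> initial_complete_elgot_monad C (L_elgot C)"
proof -
  interpret hyperextensive_bicart C
    by (intro hyperextensive_bicart.intro assms)
  have "\<exists>!\<xi>. complete_elgot_morphism C (L_elgot C) N \<xi>" if "complete_elgot_monad C N" for N :: "('o, 'a) elgot"
  proof -
    interpret L_initial C N
      by (intro L_initial.intro elgot_kleisli.intro hyperextensive_bicart_axioms that)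
    show ?thesis using from_L_morphism morphism_from_L_unique by blast
  qed
  then show ?thesis
    using L_omega_continuous L_elgot_dag_least omega_elgot.complete_elgot_monad[OF L_omega_elgot]
    unfolding initial_complete_elgot_monad_def by blast
qed

end
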